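(* Let $\Gamma=\langle y,z\mid yzyz^{-2}yz=zyz^{-2}yzy\rangle$ be the fundamental group of the exterior of the Whitehead link, and let $\mathcal{X}_3^{\rm sym}(\Gamma)$ be the symmetric slice of its irreducible ${\rm SL}(3,\mathbb{C})$-character variety. Then there exist a hypersurface $H\subset\mathbb{C}^5$, a nonempty Zariski open subset $V$ of $H$, and a nonempty Zariski open subset $U$ of $\mathcal{X}_3^{\rm sym}(\Gamma)$ such that $U$ is a regular $\mathbb{Z}/6\mathbb{Z}$-cover of $V$.
   Context: For a finitely presented group $\Gamma$, $\mathcal{X}_3(\Gamma)$ denotes the irreducible ${\rm SL}(3,\mathbb{C})$-character variety of $\Gamma$, which parameterizes conjugacy classes of irreducible representations $\Gamma\to{\rm SL}(3,\mathbb{C})$ (it carries its usual structure as the irreducible locus in the quotient of the representation variety ${\rm Hom}(\Gamma,{\rm SL}(3,\mathbb{C}))$ by conjugation, whose coordinates are trace functions). For the group $\Gamma$ of the Whitehead link with the presentation given in the claim, a representation $\rho:\Gamma\to{\rm SL}(3,\mathbb{C})$ is the same as a pair $(\mathbf{y},\mathbf{z})=(\rho(y),\rho(z))$ of elements of ${\rm SL}(3,\mathbb{C})$ satisfying $\mathbf{y}\mathbf{z}\mathbf{y}\mathbf{z}^{-2}\mathbf{y}\mathbf{z}=\mathbf{z}\mathbf{y}\mathbf{z}^{-2}\mathbf{y}\mathbf{z}\mathbf{y}$. It is irreducible if and only if $\mathbf{y},\mathbf{z}$ do not share an eigenvector and their transposes $\mathbf{y}^{\rm tr},\mathbf{z}^{\rm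 tr}$ do not share an eigenvector. The symmetric slice $\mathcal{X}_3^{\rm sym}(\Gamma)\subset\mathcal{X}_3(\Gamma)$ is the subset of conjugacy classes of irreducible representations whose pairs $(\mathbf{y},\mathbf{z})$ satisfy ${\rm tr}([\mathbf{y},\mathbf{z}])={\rm tr}([\mathbf{z},\mathbf{y}])$, where $[\mathbf{y},\mathbf{z}]=\mathbf{y}\mathbf{z}\mathbf{y}^{-1}\mathbf{z}^{-1}$. Zariski open subsets of $\mathcal{X}_3^{\rm sym}(\Gamma)$ are taken in its subspace Zariski topology. A hypersurface in $\mathbb{C}^5$ is the zero locus of a nonconstant polynomial in five variables. A regular $\mathbb{Z}/6\mathbb{Z}$-cover is a regular (Galois) covering with deck transformation group $\mathbb{Z}/6\mathbb{Z}$. *)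

theory Defs
  imports "HOL-Analysis.Analysis" "HOL-Algebra.Bij" "HOL-Algebra.Elementary_Groups"
begin

section \<open>Groups given by generators and relations\<close>

text \<open>A letter \<open>(g, True)\<close> stands for the generator \<open>g\<close> and \<open>(g, False)\<close> for its formal
  inverse. A pair \<open>(r, s)\<close> in \<open>R\<close> is the relation \<open>r = s\<close>.\<close>

type_synonym 'g word = "('g \<times> bool) list"

inductive word_eq :: "('g word \<times> 'g word) set \<Rightarrow> 'g word \<Rightarrow> 'g word \<Rightarrow> bool"
  for R :: "('g word \<times> 'g word) set" where
  refl: "word_eq R u u"
| sym: "word_eq R u v \<Longrightarrow> word_eq R v u"
| trans: "word_eq R u v \<Longrightarrow> word_eq R v w \<Longrightarrow> word_eq R u w"
| cancel: "word_eq R (u @ [(g, b), (g, \<not> b)] @ v) (u @ v)"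
| rel: "(r, s) \<in> R \<Longrightarrow> word_eq R (u @ r @ v) (u @ s @ v)"

definition word_class :: "('g word \<times> 'g word) set \<Rightarrow> 'g word \<Rightarrow> 'g word set" where
  "word_class R u = {v. word_eq R u v}"

definition presented_group :: "('g word \<times> 'g word) set \<Rightarrow> 'g word set monoid" where
  "presented_group R =
    \<lparr>carrier = range (word_class R),
     mult = (\<lambda>A B. \<Union>a\<in>A. \<Union>b\<in>B. word_class R (a @ b)),
     one = word_class R []\<rparr>"

lemma word_class_eq_iff: "word_class R u = word_class R v \<longleftrightarrow> word_eq R u v"
proof
  assume "word_class R u = word_class R v"
  moreover have "v \<in> word_class R v" by (simp add: word_class_def word_eq.refl)
  ultimately show "word_eq R u v" unfolding word_class_def by blast
next
  assume "word_eq R u v"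
  then show "word_class R u = word_class R v"
    unfolding word_class_def by (intro Collect_cong) (metis word_eq.sym word_eq.trans)
qed

lemma word_eq_append_left: "word_eq R u v \<Longrightarrow> word_eq R (x @ u) (x @ v)"
proof (induction rule: word_eq.induct)
  case (cancel u g b v)
  then show ?case using word_eq.cancel[of R "x @ u" g b v] by simp
next
  case (rel r s u v)
  then show ?case using word_eq.rel[of r s R "x @ u" v] by simp
qed (rule word_eq.refl, rule word_eq.sym, assumption, rule word_eq.trans, assumption+)

lemma word_eq_append_right: "word_eq R u v \<Longrightarrow> word_eq R (u @ x) (v @ x)"
proof (induction rule: word_eq.induct)
  case (cancel u g b v)
  then show ?case using word_eq.cancel[of R u g b "v @ x"] by simp
next
  case (rel r s u v)
  then show ?case using word_eq.rel[of r s R u "v @ x"] by simp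
qed (rule word_eq.refl, rule word_eq.sym, assumption, rule word_eq.trans, assumption+)

lemma presented_group_mult:
  "word_class R u \<otimes>\<^bsub>presented_group R\<^esub> word_class R v = word_class R (u @ v)"
proof -
  have "word_class R (a @ b) = word_class R (u @ v)"
    if "a \<in> word_class R u" "b \<in> word_class R v" for a b
  proof -
    have "word_eq R u a" "word_eq R v b" using that by (simp_all add: word_class_def)
    then have "word_eq R (u @ v) (a @ b)"
      by (rule word_eq.trans[OF word_eq_append_right word_eq_append_left])
    then show ?thesis unfolding word_class_eq_iff by (rule word_eq.sym)
  qed
  then have "(\<Union>a\<in>word_class R u. \<Union>b\<in>word_class R v. word_class R (a @ b)) =
      (\<Union>a\<in>word_class R u. \<Union>b\<in>word_class R v. word_class R (u @ v))"
    by (intro SUP_cong) simp_all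
  moreover have "word_class R u \<noteq> {}" "word_class R v \<noteq> {}"
    using word_eq.refl[of R] unfolding word_class_def by blast+
  ultimately show ?thesis
    by (simp add: presented_group_def)
qed

lemma word_eq_inverse: "\<exists>v. word_eq R (v @ u) []"
proof (induction u)
  case Nil
  show ?case by (metis append_Nil word_eq.refl)
next
  case (Cons a u)
  obtain g b where a: "a = (g, b)" by force
  obtain v where v: "word_eq R (v @ u) []" using Cons by blast
  have "word_eq R (v @ [(g, \<not> b), (g, \<not> \<not> b)] @ u) (v @ u)" by (rule word_eq.cancel)
  then have "word_eq R ((v @ [(g, \<not> b)]) @ (a # u)) []"
    using word_eq.trans[OF _ v] by (simp add: a)
  then show ?case by blast
qed

lemma group_presented_group: "group (presented_group R)"
proof (rule groupI)
  have one: "\<one>\<^bsub>presented_group R\<^esub> = word_class R []"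
    and carr: "carrier (presented_group R) = range (word_class R)"
    by (simp_all add: presented_group_def)
  show "\<one>\<^bsub>presented_group R\<^esub> \<in> carrier (presented_group R)"
    by (simp add: one carr)
  fix x y z
  assume x: "x \<in> carrier (presented_group R)"
  then obtain u where u: "x = word_class R u" by (auto simp: carr)
  show "\<one>\<^bsub>presented_group R\<^esub> \<otimes>\<^bsub>presented_group R\<^esub> x = x"
    by (simp add: one u presented_group_mult)
  obtain v where "word_eq R (v @ u) []" using word_eq_inverse[of R u] by blast
  then show "\<exists>y\<in>carrier (presented_group R). y \<otimes>\<^bsub>presented_group R\<^esub> x = \<one>\<^bsub>presented_group R\<^esub>"
    by (auto simp: one carr u presented_group_mult word_class_eq_iff)
  assume "y \<in> carrier (presented_group R)"
  then obtain v where v: "y = word_class R v" by (auto simp: carr)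
  show "x \<otimes>\<^bsub>presented_group R\<^esub> y \<in> carrier (presented_group R)"
    by (simp add: carr u v presented_group_mult)
  assume "z \<in> carrier (presented_group R)"
  then obtain w where w: "z = word_class R w" by (auto simp: carr)
  show "x \<otimes>\<^bsub>presented_group R\<^esub> y \<otimes>\<^bsub>presented_group R\<^esub> z =
    x \<otimes>\<^bsub>presented_group R\<^esub> (y \<otimes>\<^bsub>presented_group R\<^esub> z)"
    by (simp add: u v w presented_group_mult)
qed


section \<open>The Whitehead link group\<close>

datatype gen = GenY | GenZ

text \<open>The single relation is $yzyz^{-2}yz = zyz^{-2}yzy$.\<close>

definition whitehead_rel :: "(gen word \<times> gen word) set" where
  "whitehead_rel =
    {([(GenY, True), (GenZ, True), (GenY, True), (GenZ, False), (GenZ, False), (GenY, True), (GenZ, True)],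
      [(GenZ, True), (GenY, True), (GenZ, False), (GenZ, False), (GenY, True), (GenZ, True), (GenY, True)])}"

definition whitehead_group :: "gen word set monoid" where
  "whitehead_group = presented_group whitehead_rel"

definition gen_y :: "gen word set" where
  "gen_y = word_class whitehead_rel [(GenY, True)]"

definition gen_z :: "gen word set" where
  "gen_z = word_class whitehead_rel [(GenZ, True)]"


section \<open>Irreducible \<open>SL(3, \<complex>)\<close>-representations and characters\<close>

definition SL3 :: "(complex^3^3) monoid" where
  "SL3 = \<lparr>carrier = {A. det A = 1}, mult = (**), one = mat 1\<rparr>"

definition irreducible_rep :: "('a, 'b) monoid_scheme \<Rightarrow> ('a \<Rightarrow> complex^3^3) \<Rightarrow> bool" where
  "irreducible_rep G \<rho> \<longleftrightarrow> \<rho> \<in> hom G SL3 \<and>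
    (\<forall>W. vec.subspace W \<and> (\<forall>g\<in>carrier G. \<forall>w\<in>W. \<rho> g *v w \<in> W) \<longrightarrow> W = {0} \<or> W = UNIV)"

text \<open>Representations are functions on the whole type, so this relation also identifies
  functions that differ only outside the carrier.\<close>

definition conj_rel :: "('a, 'b) monoid_scheme \<Rightarrow> (('a \<Rightarrow> complex^3^3) \<times> ('a \<Rightarrow> complex^3^3)) set" where
  "conj_rel G = {(\<rho>, \<rho>'). \<exists>A. det A = 1 \<and>
    (\<forall>g\<in>carrier G. \<rho>' g = A ** \<rho> g ** matrix_inv A)}"

definition irr_char_variety :: "('a, 'b) monoid_scheme \<Rightarrow> ('a \<Rightarrow> complex^3^3) set set" where
  "irr_char_variety G = {\<rho>. irreducible_rep G \<rho>} //
    (conj_rel G \<inter> {\<rho>. irreducible_rep G \<rho>} \<times> {\<rho>. irreducible_rep G \<rho>})"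

definition trace_fun :: "'a \<Rightarrow> ('a \<Rightarrow> complex^3^3) set \<Rightarrow> complex" where
  "trace_fun g C = trace ((SOME \<rho>. \<rho> \<in> C) g)"

definition trace_coords :: "('a, 'b) monoid_scheme \<Rightarrow> (('a \<Rightarrow> complex^3^3) set \<Rightarrow> complex) set" where
  "trace_coords G = trace_fun ` carrier G"

definition commutator :: "('a, 'b) monoid_scheme \<Rightarrow> 'a \<Rightarrow> 'a \<Rightarrow> 'a" where
  "commutator G a b = a \<otimes>\<^bsub>G\<^esub> b \<otimes>\<^bsub>G\<^esub> inv\<^bsub>G\<^esub> a \<otimes>\<^bsub>G\<^esub> inv\<^bsub>G\<^esub> b"

definition sym_slice :: "(gen word set \<Rightarrow> complex^3^3) set set" where
  "sym_slice = {C \<in> irr_char_variety whitehead_group.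
    trace_fun (commutator whitehead_group gen_y gen_z) C =
    trace_fun (commutator whitehead_group gen_z gen_y) C}"

text \<open>The trace functions do not depend on the representative chosen by \<open>SOME\<close>.\<close>

lemma trace_fun_eq:
  assumes "C \<in> irr_char_variety G" "\<rho> \<in> C" "g \<in> carrier G"
  shows "trace_fun g C = trace (\<rho> g)"
proof -
  have inverse: "A ** matrix_inv A = mat 1" "matrix_inv A ** A = mat 1"
    if "det A = 1" for A :: "complex^3^3"
  proof -
    have "\<exists>B. A ** B = mat 1 \<and> B ** A = mat 1"
      using that invertible_det_nz[of A] by (simp add: invertible_def)
    from someI_ex[OF this] show "A ** matrix_inv A = mat 1" "matrix_inv A ** A = mat 1"
      by (simp_all add: matrix_inv_def)
  qed
  obtain \<sigma> where C: "C = (conj_rel G \<inter> {\<rho>. irreducible_rep G \<rho>} \<times> {\<rho>. irreducible_rep G \<rho>}) `` {\<sigma>}"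
    using assms(1) unfolding irr_char_variety_def by (auto elim: quotientE)
  have *: "trace (\<tau> g) = trace (\<sigma> g)" if "\<tau> \<in> C" for \<tau>
  proof -
    have "(\<sigma>, \<tau>) \<in> conj_rel G" using that C by blast
    then obtain A where "det A = 1" "\<tau> g = A ** \<sigma> g ** matrix_inv A"
      using assms(3) unfolding conj_rel_def by blast
    then have A: "det A = 1" "\<tau> g = A ** (\<sigma> g ** matrix_inv A)"
      by (simp_all add: matrix_mul_assoc)
    have "trace (\<tau> g) = trace ((\<sigma> g ** matrix_inv A) ** A)"
      unfolding A(2) by (rule trace_mul_sym)
    also have "\<dots> = trace (\<sigma> g)"
      by (simp only: matrix_mul_assoc [symmetric] inverse(2)[OF A(1)] matrix_mul_rid)
    finally show ?thesis .
  qed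
  have "(SOME \<rho>. \<rho> \<in> C) \<in> C" by (rule someI [where P = "\<lambda>\<rho>. \<rho> \<in> C", OF assms(2)])
  from *[OF this] *[OF assms(2)] show ?thesis unfolding trace_fun_def by simp
qed


section \<open>Varieties as sets with coordinate functions\<close>

text \<open>A (quasi-affine) variety is a set of points \<open>X\<close> together with a family \<open>F\<close> of coordinate
  functions on the ambient type: the five projections for subsets of \<open>\<complex>\<^sup>5\<close>, all trace functions
  for subsets of the character variety. No finiteness of \<open>F\<close> is required; the algebra
  generated by the trace functions of a finitely generated group is finitely generated anyway.\<close>

inductive_set poly_funs :: "('a \<Rightarrow> complex) set \<Rightarrow> ('a \<Rightarrow> complex) set"
  for F :: "('a \<Rightarrow> complex) set" where
  coord: "f \<in> F \<Longrightarrow> f \<in> poly_funs F"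
| const: "(\<lambda>_. c) \<in> poly_funs F"
| add: "f \<in> poly_funs F \<Longrightarrow> g \<in> poly_funs F \<Longrightarrow> (\<lambda>x. f x + g x) \<in> poly_funs F"
| mult: "f \<in> poly_funs F \<Longrightarrow> g \<in> poly_funs F \<Longrightarrow> (\<lambda>x. f x * g x) \<in> poly_funs F"

definition zariski_open :: "('a \<Rightarrow> complex) set \<Rightarrow> 'a set \<Rightarrow> 'a set \<Rightarrow> bool" where
  "zariski_open F X U \<longleftrightarrow> (\<exists>P \<subseteq> poly_funs F. U = X - {x. \<forall>f\<in>P. f x = 0})"

definition regular_fun :: "('a \<Rightarrow> complex) set \<Rightarrow> 'a set \<Rightarrow> ('a \<Rightarrow> complex) \<Rightarrow> bool" where
  "regular_fun F X h \<longleftrightarrow> (\<forall>x\<in>X. \<exists>f\<in>poly_funs F. \<exists>g\<in>poly_funs F. g x \<noteq> 0 \<and>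
    (\<forall>u\<in>X. g u \<noteq> 0 \<longrightarrow> h u = f u / g u))"

definition variety_morphism ::
  "('a \<Rightarrow> complex) set \<Rightarrow> 'a set \<Rightarrow> ('b \<Rightarrow> complex) set \<Rightarrow> 'b set \<Rightarrow> ('a \<Rightarrow> 'b) \<Rightarrow> bool" where
  "variety_morphism F X G Y p \<longleftrightarrow> p ` X \<subseteq> Y \<and> (\<forall>g\<in>G. regular_fun F X (g \<circ> p))"

definition classical_topology :: "('a \<Rightarrow> complex) set \<Rightarrow> 'a set \<Rightarrow> 'a topology" where
  "classical_topology F X =
    subtopology (topology_generated_by {f -` T | f T. f \<in> F \<and> open T}) X"

definition affine_coords :: "(complex^'n \<Rightarrow> complex) set" where
  "affine_coords = range (\<lambda>i x. x $ i)"

lemma classical_topology_affine: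
  "classical_topology (affine_coords :: (complex^'n \<Rightarrow> complex) set) X = top_of_set X"
proof -
  have "topology_generated_by {f -` T | f T. f \<in> (affine_coords :: (complex^'n \<Rightarrow> complex) set) \<and> open T} = euclidean"
    (is "topology_generated_by ?B = _")
  proof (rule topology_eq[THEN iffD2], intro allI iffI)
    fix S assume "openin (topology_generated_by ?B) S"
    then have "generate_topology_on ?B S" by (simp add: openin_topology_generated_by_iff)
    then show "openin euclidean S"
    proof induction
      case (Basis s)
      then obtain i T where "s = (\<lambda>x. x $ i) -` T" "open T" by (auto simp: affine_coords_def)
      then show ?case by (simp add: open_vimage_vec_nth)
    qed auto
  next
    fix S :: "(complex^'n) set" assume "openin euclidean S"
    then have S: "open S" by simp
    show "openin (topology_generated_by ?B) S"
    proof (subst openin_subopen, intro ballI)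
      fix x assume "x \<in> S"
      then obtain A where A: "\<And>i. open (A i) \<and> x$i \<in> A i" "\<And>y. (\<forall>i. y$i \<in> A i) \<longrightarrow> y \<in> S"
        using S unfolding open_vec_def by metis
      have "openin (topology_generated_by ?B) (\<Inter>i\<in>UNIV. (\<lambda>x. x $ i) -` A i)"
        using A(1) by (intro openin_INT2) (auto intro!: topology_generated_by_Basis simp: affine_coords_def)
      moreover have "x \<in> (\<Inter>i\<in>UNIV. (\<lambda>x. x $ i) -` A i)" using A(1) by simp
      moreover have "(\<Inter>i\<in>UNIV. (\<lambda>x. x $ i) -` A i) \<subseteq> S" using A(2) by auto
      ultimately show "\<exists>T. openin (topology_generated_by ?B) T \<and> x \<in> T \<and> T \<subseteq> S"
        by (intro exI conjI)
    qed
  qed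
  then show ?thesis by (simp add: classical_topology_def)
qed

definition hypersurface :: "(complex^'n) set \<Rightarrow> bool" where
  "hypersurface H \<longleftrightarrow>
    (\<exists>f\<in>poly_funs affine_coords. \<not> f constant_on UNIV \<and> H = {x. f x = 0})"


section \<open>Regular coverings\<close>

text \<open>The library's \<open>covering_space\<close> for abstract topologies, since the character variety
  carries no canonical type class topology.\<close>

definition covering_map :: "'a topology \<Rightarrow> 'b topology \<Rightarrow> ('a \<Rightarrow> 'b) \<Rightarrow> bool" where
  "covering_map T S p \<longleftrightarrow> continuous_map T S p \<and> p ` topspace T = topspace S \<and>
    (\<forall>y\<in>topspace S. \<exists>W. y \<in> W \<and> openin S W \<and>
      (\<exists>\<V>. \<Union>\<V> = topspace T \<inter> p -` W \<and> (\<forall>V\<in>\<V>. openin T V) \<and> pairwise disjnt \<V> \<and>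
        (\<forall>V\<in>\<V>. homeomorphic_map (subtopology T V) (subtopology S W) p)))"

definition deck_group :: "'a topology \<Rightarrow> ('a \<Rightarrow> 'b) \<Rightarrow> ('a \<Rightarrow> 'a) monoid" where
  "deck_group T p = BijGroup (topspace T)
    \<lparr>carrier := {\<sigma> \<in> Bij (topspace T). homeomorphic_map T T \<sigma> \<and>
                  (\<forall>x\<in>topspace T. p (\<sigma> x) = p x)}\<rparr>"

text \<open>As usual in covering space theory the total space is connected; hence the deck group
  automatically acts freely, and fibres have as many points as the deck group. The covering is
  one of varieties: the projection and the deck transformations are morphisms.\<close>

definition is_regular_cover ::
  "('c, 'd) monoid_scheme \<Rightarrow> ('a \<Rightarrow> complex) set \<Rightarrow> 'a set \<Rightarrow>
    ('b \<Rightarrow> complex) set \<Rightarrow> 'b set \<Rightarrow> ('a \<Rightarrow> 'b) \<Rightarrow> bool" where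
  "is_regular_cover D F X G Y p \<longleftrightarrow>
    (let T = classical_topology F X; S = classical_topology G Y in
      variety_morphism F X G Y p \<and> connected_space T \<and> covering_map T S p \<and>
      (\<forall>x\<in>X. \<forall>x'\<in>X. p x = p x' \<longrightarrow> (\<exists>\<sigma>\<in>carrier (deck_group T p). \<sigma> x = x')) \<and>
      (\<forall>\<sigma>\<in>carrier (deck_group T p). variety_morphism F X F X \<sigma>) \<and>
      deck_group T p \<cong> D)"

end

theory Submission
  imports Defs "HOL-Computational_Algebra.Fundamental_Theorem_Algebra"
begin

text \<open>Put \<open>x = inverse z\<close> and diagonalise \<open>y\<close>, with eigenvalues \<open>y\<^sub>1, y\<^sub>2, y\<^sub>3\<close>. The relation says that \<open>y\<close> commutes
  with \<open>z y x\<^sup>2 y z\<close>, that is, \<open>y x\<^sup>2 y = x D x\<close> for some diagonal matrix \<open>D\<close>. The condition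
  \<open>tr [y, z] = tr [z, y]\<close> means that the two cyclic products \<open>x\<^sub>1\<^sub>2 x\<^sub>2\<^sub>3 x\<^sub>3\<^sub>1\<close> and \<open>x\<^sub>1\<^sub>3 x\<^sub>3\<^sub>2 x\<^sub>2\<^sub>1\<close> agree
  (\<open>commutator_traces\<close>), and this is what is needed to conjugate \<open>x\<close> by a diagonal matrix into the
  shape \<open>x\<^sub>i\<^sub>j = m\<^sub>i \<delta>\<^sub>i\<^sub>j + \<rho>\<^sub>j\<close>, a diagonal matrix plus a matrix of rank one
  (\<open>diagonal_scaling\<close>).

  For such a matrix the off-diagonal entries of the relation separate into
  \<open>y\<^sub>i y\<^sub>j (n\<^sub>i + n\<^sub>j) = E\<^sub>i + E\<^sub>j\<close>, with \<open>n\<^sub>i = m\<^sub>i + h\<close>, \<open>E\<^sub>i = m\<^sub>i D\<^sub>i + b\<close>, \<open>2 h = \<Sum>\<rho>\<^sub>i\<close> and \<open>2 b = \<Sum>\<rho>\<^sub>i D\<^sub>i\<close>. Lagrange interpolation on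
  the three eigenvalues writes \<open>n\<^sub>i = w / y\<^sub>i + (r + al t) - 2 t y\<^sub>i\<close>, with \<open>al = tr y\<close>; then \<open>E\<^sub>i\<close> has a
  similar shape with \<open>r\<close> and \<open>t\<close> exchanged, and the remaining unknowns satisfy linear equations over
  the field generated by a few parameters. The system is homogeneous under scaling \<open>x\<close>. After
  normalising the scale there remain four free parameters \<open>r, t, w, la\<close>, and \<open>det x = 1\<close> fixes
  the scale up to a cube root of unity. Thus an open part of the symmetric slice is isomorphic
  to an open part \<open>param_variety\<close> of the hypersurface \<open>zeta\<^sup>3 = F (r, t, w, la)\<close>
  (\<open>param_class_coords\<close>, \<open>param_of_generic\<close>). Eigenvalues are not rational functions of the trace
  coordinates, but both directions of the isomorphism are symmetric in them, which makes them
  rational (locale \<open>cubic_spectrum\<close>).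

  The function \<open>F\<close> is symmetric in \<open>r\<close> and \<open>t\<close>, since determinants in the relation give
  \<open>\<Prod>D\<^sub>i = 1\<close> (\<open>F_swap\<close>). Hence \<open>(r, t, w, la, zeta) \<mapsto> (t, r, w, la, omega zeta)\<close>, with \<open>omega\<close> a primitive
  cube root of unity, generates an action of the cyclic group of order \<open>6\<close>. It is free
  because \<open>r \<noteq> t\<close> and \<open>zeta \<noteq> 0\<close>, and its invariants \<open>(r + t, r t, w, la)\<close> identify the quotient with a
  principal open subset of \<open>\<complex>\<^sup>4\<close>, that is, of a hyperplane in \<open>\<complex>\<^sup>5\<close>.

  A free action of a finite cyclic group on a connected Hausdorff space yields a regular
  covering whose deck group is that cyclic group (locale \<open>free_cyclic_quotient\<close>). Connectedness of
  \<open>param_variety\<close> holds because it is a threefold covering of a connected space and one of the fibres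
  lies in a connected curve (\<open>connected_param_variety\<close>).\<close>

section \<open>Quotients by free actions of finite cyclic groups\<close>

text \<open>The quotient is presented by an open map whose fibres are the orbits, so that no quotient
  topology has to be formed.\<close>

locale free_cyclic_quotient =
  fixes T :: "'a topology" and S :: "'b topology" and g :: "'a \<Rightarrow> 'a" and p :: "'a \<Rightarrow> 'b" and n :: nat
  assumes n_pos: "0 < n"
    and hausdorff: "Hausdorff_space T"
    and generator: "continuous_map T T g"
    and period: "\<And>x. x \<in> topspace T \<Longrightarrow> (g ^^ n) x = x"
    and free: "\<And>x i. x \<in> topspace T \<Longrightarrow> 0 < i \<Longrightarrow> i < n \<Longrightarrow> (g ^^ i) x \<noteq> x"
    and continuous: "continuous_map T S p" and open_proj: "open_map T S p"
    and surj: "p ` topspace T = topspace S"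
    and fibre: "\<And>x y. x \<in> topspace T \<Longrightarrow> y \<in> topspace T \<Longrightarrow> p x = p y \<longleftrightarrow> (\<exists>i<n. y = (g ^^ i) x)"
begin

lemma funpow_funpow: "(g ^^ i) ((g ^^ j) x) = (g ^^ (i + j)) x"
  by (simp add: funpow_add)

lemma continuous_funpow: "continuous_map T T (g ^^ i)"
proof (induction i)
  case (Suc i)
  then show ?case using continuous_map_compose[OF Suc generator] by (simp add: o_def)
qed (simp add: id_def)

lemma funpow_in: "x \<in> topspace T \<Longrightarrow> (g ^^ i) x \<in> topspace T"
  using continuous_funpow[of i] by (auto simp: continuous_map_def)

lemma funpow_cancel:
  assumes "x \<in> topspace T" "i \<le> n"
  shows "(g ^^ i) ((g ^^ (n - i)) x) = x" "(g ^^ (n - i)) ((g ^^ i) x) = x"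
  using period[OF assms(1)] assms(2) by (simp_all add: funpow_funpow)

lemma funpow_eq_shift:
  assumes "a \<in> topspace T" "b \<in> topspace T" "(g ^^ i) a = (g ^^ j) b" "i < j" "j < n"
  shows "a = (g ^^ (j - i)) b"
proof -
  have "a = (g ^^ (n - i)) ((g ^^ i) a)" using funpow_cancel(2)[of a i] assms by simp
  also have "\<dots> = (g ^^ (n - i + j)) b" by (simp only: assms(3) funpow_funpow)
  also have "\<dots> = (g ^^ n) ((g ^^ (j - i)) b)" using assms by (simp add: funpow_funpow)
  also have "\<dots> = (g ^^ (j - i)) b" using period funpow_in assms by simp
  finally show ?thesis .
qed

lemma homeomorphic_maps_funpow: "i \<le> n \<Longrightarrow> homeomorphic_maps T T (g ^^ i) (g ^^ (n - i))"
  unfolding homeomorphic_maps_def using continuous_funpow funpow_cancel by auto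

lemma homeomorphic_map_funpow: "i \<le> n \<Longrightarrow> homeomorphic_map T T (g ^^ i)"
  using homeomorphic_maps_funpow homeomorphic_map_maps by blast

lemma proj_funpow: "x \<in> topspace T \<Longrightarrow> i < n \<Longrightarrow> p ((g ^^ i) x) = p x"
  using fibre[of x "(g ^^ i) x"] funpow_in[of x i] by auto

text \<open>Around each point the translates of a small neighbourhood are disjoint, because the
  finitely many translates of the point are distinct and \<open>T\<close> is Hausdorff.\<close>

lemma small_neighbourhood:
  assumes x: "x \<in> topspace T"
  obtains Q where "openin T Q" "x \<in> Q" "\<And>a i. a \<in> Q \<Longrightarrow> 0 < i \<Longrightarrow> i < n \<Longrightarrow> (g ^^ i) a \<notin> Q"
proof -
  have "\<exists>A B. openin T A \<and> openin T B \<and> x \<in> A \<and> (g ^^ i) x \<in> B \<and> disjnt A B"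
    if "i \<in> {0<..<n}" for i
    using hausdorff x funpow_in[OF x, of i] free[OF x, of i] that
    unfolding Hausdorff_space_def by force
  then obtain A B where AB: "\<And>i. i \<in> {0<..<n} \<Longrightarrow> openin T (A i) \<and> openin T (B i) \<and> x \<in> A i \<and>
      (g ^^ i) x \<in> B i \<and> disjnt (A i) (B i)" by metis
  define C where "C i = (if i \<in> {0<..<n} then A i \<inter> {a \<in> topspace T. (g ^^ i) a \<in> B i} else topspace T)" for i
  define Q where "Q = (\<Inter>i\<in>{..<n}. C i)"
  have "openin T (C i)" for i
    unfolding C_def using AB[of i] openin_continuous_map_preimage[OF continuous_funpow, of "B i" i] by auto
  then have "openin T Q" unfolding Q_def using n_pos by (intro openin_INT2) auto
  moreover have "x \<in> Q" unfolding Q_def C_def using AB x by auto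
  moreover have "(g ^^ i) a \<notin> Q" if "a \<in> Q" "0 < i" "i < n" for a i
  proof
    assume "(g ^^ i) a \<in> Q"
    then have "(g ^^ i) a \<in> C i" "a \<in> C i" using that unfolding Q_def by auto
    then show False using that AB[of i] unfolding C_def disjnt_def by auto
  qed
  ultimately show thesis by (rule that)
qed

text \<open>The translates of a small neighbourhood are the sheets over its image.\<close>

lemma covering: "covering_map T S p"
  unfolding covering_map_def
proof (intro conjI ballI, rule continuous, rule surj)
  fix y assume "y \<in> topspace S"
  then have "y \<in> p ` topspace T" by (simp only: surj)
  then obtain x where x: "x \<in> topspace T" "p x = y" by (elim imageE) simp
  obtain Q where Q: "openin T Q" "x \<in> Q" "\<And>a i. a \<in> Q \<Longrightarrow> 0 < i \<Longrightarrow> i < n \<Longrightarrow> (g ^^ i) a \<notin> Q"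
    using small_neighbourhood[OF x(1)] by blast
  have QT: "a \<in> topspace T" if "a \<in> Q" for a using Q(1) that openin_subset by blast
  define V where "V i = (g ^^ i) ` Q" for i
  have Vopen: "openin T (V i)" if "i < n" for i
    using homeomorphic_imp_open_map[OF homeomorphic_map_funpow[of i]] Q(1) that
    unfolding V_def open_map_def by auto
  have W: "openin S (p ` Q)" using open_proj Q(1) unfolding open_map_def by blast
  have disj: "(g ^^ i) a \<noteq> (g ^^ j) b" if "a \<in> Q" "b \<in> Q" "i < j" "j < n" for a b i j
    using funpow_eq_shift[of a b i j] QT Q(3)[OF that(2), of "j - i"] that by auto
  have inj: "inj_on p (V i)" if i: "i < n" for i
  proof (rule inj_onI)
    fix u v assume "u \<in> V i" "v \<in> V i" "p u = p v"
    then obtain a b where ab: "a \<in> Q" "b \<in> Q" "u = (g ^^ i) a" "v = (g ^^ i) b" unfolding V_def by blast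
    then have "p a = p b" using \<open>p u = p v\<close> proj_funpow[OF _ i] QT by simp
    then obtain k where "k < n" "b = (g ^^ k) a" using fibre QT ab by meson
    then have "b = a" using Q(3)[OF ab(1), of k] ab by (cases "k = 0") auto
    then show "u = v" using ab by simp
  qed
  have pV: "p ` V i = p ` Q" if "i < n" for i
    unfolding V_def image_image using proj_funpow[OF _ that] QT by auto
  have hom: "homeomorphic_map (subtopology T (V i)) (subtopology S (p ` Q)) p" if i: "i < n" for i
  proof (rule bijective_open_imp_homeomorphic_map)
    have sub: "V i \<subseteq> topspace T" "p ` Q \<subseteq> topspace S"
      using Vopen[OF i] W openin_subset by blast+
    show "continuous_map (subtopology T (V i)) (subtopology S (p ` Q)) p"
      using continuous pV[OF i] by (auto simp: continuous_map_in_subtopology intro: continuous_map_from_subtopology)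
    show "open_map (subtopology T (V i)) (subtopology S (p ` Q)) p"
      unfolding open_map_def
    proof (intro allI impI)
      fix O' assume "openin (subtopology T (V i)) O'"
      then have "openin T O'" "O' \<subseteq> V i" using openin_open_subtopology[OF Vopen[OF i]] by auto
      then have "openin S (p ` O')" "p ` O' \<subseteq> p ` Q" using open_proj pV[OF i] unfolding open_map_def by blast+
      then show "openin (subtopology S (p ` Q)) (p ` O')" using openin_open_subtopology[OF W] by auto
    qed
    show "p ` topspace (subtopology T (V i)) = topspace (subtopology S (p ` Q))"
      using sub pV[OF i] by (simp add: Int_absorb1)
    show "inj_on p (topspace (subtopology T (V i)))"
      using inj[OF i] by (rule inj_on_subset) auto
  qed
  have "\<Union>(V ` {..<n}) = topspace T \<inter> p -` (p ` Q)"
  proof (intro equalityI subsetI)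
    fix z assume "z \<in> \<Union>(V ` {..<n})"
    then obtain i a where "i < n" "a \<in> Q" "z = (g ^^ i) a" unfolding V_def by blast
    then show "z \<in> topspace T \<inter> p -` (p ` Q)" using funpow_in proj_funpow QT by auto
  next
    fix z assume "z \<in> topspace T \<inter> p -` (p ` Q)"
    then obtain a where "a \<in> Q" "p a = p z" "z \<in> topspace T" by force
    then obtain i where "i < n" "z = (g ^^ i) a" using fibre QT by meson
    then show "z \<in> \<Union>(V ` {..<n})" using \<open>a \<in> Q\<close> unfolding V_def by blast
  qed
  moreover have "pairwise disjnt (V ` {..<n})"
    unfolding pairwise_def disjnt_def
  proof (intro ballI impI)
    fix P R assume "P \<in> V ` {..<n}" "R \<in> V ` {..<n}" "P \<noteq> R"
    then obtain i j where ij: "i < n" "j < n" "P = V i" "R = V j" "i \<noteq> j" by blast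
    show "P \<inter> R = {}"
    proof (rule ccontr)
      assume "P \<inter> R \<noteq> {}"
      then obtain a b where "a \<in> Q" "b \<in> Q" "(g ^^ i) a = (g ^^ j) b" unfolding ij V_def by blast
      then show False using disj[of a b i j] disj[of b a j i] ij by (metis linorder_neqE_nat)
    qed
  qed
  ultimately show "\<exists>W. y \<in> W \<and> openin S W \<and> (\<exists>\<V>. \<Union>\<V> = topspace T \<inter> p -` W \<and>
      (\<forall>V\<in>\<V>. openin T V) \<and> pairwise disjnt \<V> \<and>
      (\<forall>V\<in>\<V>. homeomorphic_map (subtopology T V) (subtopology S W) p))"
    using W Q(2) x(2) Vopen hom by (intro exI[of _ "p ` Q"] conjI exI[of _ "V ` {..<n}"]) auto
qed

definition deck :: "nat \<Rightarrow> 'a \<Rightarrow> 'a" where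
  "deck i = restrict (g ^^ i) (topspace T)"

lemma deck_in: "i < n \<Longrightarrow> deck i \<in> carrier (deck_group T p)"
proof -
  assume i: "i < n"
  have hom: "homeomorphic_map T T (deck i)"
    by (rule homeomorphic_map_eq[OF homeomorphic_map_funpow[of i]]) (use i in \<open>auto simp: deck_def\<close>)
  moreover have "bij_betw (deck i) (topspace T) (topspace T)"
    using hom unfolding homeomorphic_eq_everything_map bij_betw_def by blast
  ultimately show ?thesis
    using proj_funpow[OF _ i] by (simp add: deck_group_def Bij_def deck_def)
qed

lemma deck_transitive:
  assumes "x \<in> topspace T" "x' \<in> topspace T" "p x = p x'"
  shows "\<exists>\<sigma>\<in>carrier (deck_group T p). \<sigma> x = x'"
proof -
  obtain i where "i < n" "x' = (g ^^ i) x" using assms fibre[of x x'] by blast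
  then show ?thesis using deck_in[of i] assms(1) by (intro bexI[of _ "deck i"]) (auto simp: deck_def)
qed

text \<open>A deck transformation agrees with some power of the generator at one point; the sets on
  which it agrees with the various powers are closed, disjoint and finite in number, so by
  connectedness one of them is everything.\<close>

lemma deck_eq_funpow:
  assumes conn: "connected_space T" and ne: "topspace T \<noteq> {}"
    and \<sigma>: "\<sigma> \<in> carrier (deck_group T p)"
  obtains i where "i < n" "\<sigma> = deck i"
proof -
  have \<sigma>': "\<sigma> \<in> extensional (topspace T)" "homeomorphic_map T T \<sigma>" "\<And>x. x \<in> topspace T \<Longrightarrow> p (\<sigma> x) = p x"
    using \<sigma> by (auto simp: deck_group_def Bij_def)
  have \<sigma>c: "continuous_map T T \<sigma>" using \<sigma>'(2) homeomorphic_imp_continuous_map by blast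
  have \<sigma>T: "\<sigma> x \<in> topspace T" if "x \<in> topspace T" for x using \<sigma>c that by (auto simp: continuous_map_def)
  define A where "A k = {x \<in> topspace T. \<sigma> x = (g ^^ k) x}" for k
  have closed: "closedin T (A k)" for k
    unfolding A_def using closedin_continuous_maps_eq[OF hausdorff \<sigma>c continuous_funpow] .
  have cover: "\<exists>k<n. x \<in> A k" if "x \<in> topspace T" for x
    using fibre[OF that \<sigma>T[OF that]] \<sigma>'(3)[OF that] that unfolding A_def by auto
  have disj: "A i \<inter> A j = {}" if "i < j" "j < n" for i j
  proof (rule ccontr)
    assume "A i \<inter> A j \<noteq> {}"
    then obtain x where x: "x \<in> topspace T" "\<sigma> x = (g ^^ i) x" "\<sigma> x = (g ^^ j) x" unfolding A_def by blast
    then show False using funpow_eq_shift[OF x(1) x(1), of i j] free[OF x(1), of "j - i"] that less_imp_diff_less[of j n i] by simp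
  qed
  obtain x0 where "x0 \<in> topspace T" using ne by blast
  then obtain i where i: "i < n" "x0 \<in> A i" using cover by blast
  have "A i = topspace T - (\<Union>j\<in>{..<n} - {i}. A j)"
  proof (intro equalityI subsetI)
    fix x assume "x \<in> A i"
    moreover have "x \<notin> A j" if "j \<in> {..<n} - {i}" for j
      using disj[of i j] disj[of j i] i \<open>x \<in> A i\<close> that by (cases j i rule: linorder_cases) auto
    ultimately show "x \<in> topspace T - (\<Union>j\<in>{..<n} - {i}. A j)" unfolding A_def by blast
  qed (use cover in blast)
  moreover have "closedin T (\<Union>j\<in>{..<n} - {i}. A j)" using closed by (intro closedin_Union) auto
  ultimately have "openin T (A i)" by auto
  then have "A i = topspace T" using conn closed[of i] i unfolding connected_space_clopen_in by blast
  then have "\<sigma> = deck i"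
    using \<sigma>'(1) unfolding deck_def A_def extensional_def by (auto simp: fun_eq_iff)
  then show thesis using that i by blast
qed

lemma deck_group_iso:
  assumes conn: "connected_space T" and ne: "topspace T \<noteq> {}"
  shows "deck_group T p \<cong> integer_mod_group n"
proof -
  let ?Z = "integer_mod_group n" and ?D = "deck_group T p"
  have carr: "carrier ?Z = {0..<int n}" using n_pos by (simp add: carrier_integer_mod_group)
  have mult: "x \<otimes>\<^bsub>?Z\<^esub> y = (x + y) mod int n" for x y by (simp add: integer_mod_group_def)
  have inj: "inj_on (\<lambda>z. deck (nat z)) (carrier ?Z)"
  proof (rule inj_onI)
    fix a b assume ab: "a \<in> carrier ?Z" "b \<in> carrier ?Z" "deck (nat a) = deck (nat b)"
    obtain x where x: "x \<in> topspace T" using ne by blast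
    have e: "(g ^^ nat a) x = (g ^^ nat b) x" using fun_cong[OF ab(3), of x] x by (simp add: deck_def)
    have *: False if "(g ^^ i) x = (g ^^ j) x" "i < j" "j < n" for i j
      using funpow_eq_shift[OF x x that] free[OF x, of "j - i"] that less_imp_diff_less[of j n i] by simp
    show "a = b"
    proof (rule ccontr)
      assume "a \<noteq> b"
      then have "nat a < nat b \<or> nat b < nat a" "nat a < n" "nat b < n" using ab carr by auto
      then show False using *[of "nat a" "nat b"] *[of "nat b" "nat a"] e by metis
    qed
  qed
  have "deck (nat ((x + y) mod int n)) = compose (topspace T) (deck (nat x)) (deck (nat y))"
    if "x \<in> carrier ?Z" "y \<in> carrier ?Z" for x y
  proof
    fix u
    have xy: "0 \<le> x" "x < int n" "0 \<le> y" "y < int n" using that carr by auto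
    have "(g ^^ nat ((x + y) mod int n)) u = (g ^^ nat x) ((g ^^ nat y) u)" if u: "u \<in> topspace T"
    proof (cases "x + y < int n")
      case True
      then show ?thesis using xy by (simp add: nat_add_distrib funpow_funpow)
    next
      case False
      then have "(x + y) mod int n = x + y - int n"
        using mod_pos_pos_trivial[of "x + y - int n" "int n"] minus_mod_self2[of "x + y" "int n"] xy False by simp
      then have "nat x + nat y = n + nat ((x + y) mod int n)" using xy False by simp
      then have "(g ^^ nat x) ((g ^^ nat y) u) = (g ^^ n) ((g ^^ nat ((x + y) mod int n)) u)"
        by (simp add: funpow_funpow)
      then show ?thesis using period funpow_in u by simp
    qed
    then show "deck (nat ((x + y) mod int n)) u = compose (topspace T) (deck (nat x)) (deck (nat y)) u"
      using funpow_in by (simp add: compose_def deck_def)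
  qed
  moreover have deckZ: "deck (nat x) \<in> carrier ?D" if "x \<in> carrier ?Z" for x
    using deck_in[of "nat x"] that carr by auto
  moreover have "\<sigma> \<otimes>\<^bsub>?D\<^esub> \<tau> = compose (topspace T) \<sigma> \<tau>" if "\<sigma> \<in> carrier ?D" "\<tau> \<in> carrier ?D" for \<sigma> \<tau>
    using that by (simp add: deck_group_def BijGroup_def)
  ultimately have "(\<lambda>z. deck (nat z)) \<in> hom ?Z ?D" unfolding hom_def by (auto simp: mult)
  moreover have "(\<lambda>z. deck (nat z)) ` carrier ?Z = carrier ?D"
  proof (intro equalityI subsetI)
    fix \<sigma> assume "\<sigma> \<in> carrier ?D"
    then obtain i where "i < n" "\<sigma> = deck i" using deck_eq_funpow[OF conn ne] by blast
    then show "\<sigma> \<in> (\<lambda>z. deck (nat z)) ` carrier ?Z" using carr by (intro image_eqI[of _ _ "int i"]) auto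
  qed (use deckZ in auto)
  ultimately have "(\<lambda>z. deck (nat z)) \<in> iso ?Z ?D" using inj by (simp add: iso_def bij_betw_def)
  then have "?Z \<cong> ?D" unfolding is_iso_def by blast
  then show ?thesis by (rule group.iso_sym[OF group_integer_mod_group])
qed

end

section \<open>Fractions of coordinate polynomials\<close>

text \<open>One numerator and one denominator serve the whole of \<open>X\<close>. This is stronger than being regular, and
  in return it passes to sums, quotients and compositions without gluing.\<close>

definition frac :: "('a \<Rightarrow> complex) set \<Rightarrow> 'a set \<Rightarrow> ('a \<Rightarrow> complex) \<Rightarrow> bool" where
  "frac F X h \<longleftrightarrow> (\<exists>f\<in>poly_funs F. \<exists>g\<in>poly_funs F. \<forall>x\<in>X. g x \<noteq> 0 \<and> h x = f x / g x)"

lemma frac_poly: "f \<in> poly_funs F \<Longrightarrow> frac F X f"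
  unfolding frac_def by (intro bexI[of _ f] bexI[of _ "\<lambda>_. 1"]) (auto intro: poly_funs.const)

lemma frac_coord: "f \<in> F \<Longrightarrow> frac F X f"
  by (intro frac_poly poly_funs.coord)

lemma frac_const: "frac F X (\<lambda>_. c)"
  by (intro frac_poly poly_funs.const)

lemma frac_add: assumes "frac F X h" "frac F X k" shows "frac F X (\<lambda>x. h x + k x)"
proof -
  obtain f g where 1: "f \<in> poly_funs F" "g \<in> poly_funs F" "\<And>x. x \<in> X \<Longrightarrow> g x \<noteq> 0 \<and> h x = f x / g x"
    using assms(1) unfolding frac_def by blast
  obtain f' g' where 2: "f' \<in> poly_funs F" "g' \<in> poly_funs F" "\<And>x. x \<in> X \<Longrightarrow> g' x \<noteq> 0 \<and> k x = f' x / g' x"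
    using assms(2) unfolding frac_def by blast
  show ?thesis unfolding frac_def
    by (rule bexI[of _ "\<lambda>x. f x * g' x + f' x * g x"], rule bexI[of _ "\<lambda>x. g x * g' x"])
      (use 1 2 in \<open>simp_all add: poly_funs.add poly_funs.mult add_frac_eq\<close>)
qed

lemma frac_mult: assumes "frac F X h" "frac F X k" shows "frac F X (\<lambda>x. h x * k x)"
proof -
  obtain f g where 1: "f \<in> poly_funs F" "g \<in> poly_funs F" "\<And>x. x \<in> X \<Longrightarrow> g x \<noteq> 0 \<and> h x = f x / g x"
    using assms(1) unfolding frac_def by blast
  obtain f' g' where 2: "f' \<in> poly_funs F" "g' \<in> poly_funs F" "\<And>x. x \<in> X \<Longrightarrow> g' x \<noteq> 0 \<and> k x = f' x / g' x"
    using assms(2) unfolding frac_def by blast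
  show ?thesis unfolding frac_def
    by (rule bexI[of _ "\<lambda>x. f x * f' x"], rule bexI[of _ "\<lambda>x. g x * g' x"])
      (use 1 2 in \<open>simp_all add: poly_funs.mult\<close>)
qed

lemma frac_uminus: "frac F X h \<Longrightarrow> frac F X (\<lambda>x. - h x)"
  using frac_mult[OF frac_const[of F X "-1"]] by fastforce

lemma frac_diff: "frac F X h \<Longrightarrow> frac F X k \<Longrightarrow> frac F X (\<lambda>x. h x - k x)"
  using frac_add[OF _ frac_uminus, of F X h k] by simp

lemma frac_power: "frac F X h \<Longrightarrow> frac F X (\<lambda>x. h x ^ n)"
  by (induction n) (auto intro: frac_const frac_mult)

lemma frac_divide:
  assumes "frac F X h" "frac F X k" "\<And>x. x \<in> X \<Longrightarrow> k x \<noteq> 0"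
  shows "frac F X (\<lambda>x. h x / k x)"
proof -
  obtain f g where 1: "f \<in> poly_funs F" "g \<in> poly_funs F" "\<And>x. x \<in> X \<Longrightarrow> g x \<noteq> 0 \<and> h x = f x / g x"
    using assms(1) unfolding frac_def by blast
  obtain f' g' where 2: "f' \<in> poly_funs F" "g' \<in> poly_funs F" "\<And>x. x \<in> X \<Longrightarrow> g' x \<noteq> 0 \<and> k x = f' x / g' x"
    using assms(2) unfolding frac_def by blast
  show ?thesis unfolding frac_def
    by (rule bexI[of _ "\<lambda>x. f x * g' x"], rule bexI[of _ "\<lambda>x. g x * f' x"])
      (use 1 2 assms(3) in \<open>auto simp: poly_funs.mult\<close>)
qed

lemma frac_cong: "(\<And>x. x \<in> X \<Longrightarrow> h x = k x) \<Longrightarrow> frac F X h \<longleftrightarrow> frac F X k"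
  unfolding frac_def by simp

lemma frac_sum3: "(\<And>i. frac F X (\<lambda>x. h x i)) \<Longrightarrow> frac F X (\<lambda>x. \<Sum>i\<in>(UNIV :: 3 set). h x i)"
  unfolding sum_3 by (intro frac_add)

lemmas frac_intros = frac_const frac_add frac_mult frac_uminus frac_diff frac_power frac_divide frac_sum3

lemma frac_regular: "frac F X h \<Longrightarrow> regular_fun F X h"
  unfolding frac_def regular_fun_def by blast

lemma frac_poly_comp:
  assumes "f \<in> poly_funs G" "\<And>g. g \<in> G \<Longrightarrow> frac F X (\<lambda>x. g (\<phi> x))"
  shows "frac F X (\<lambda>x. f (\<phi> x))"
  using assms(1) by induction (auto intro: frac_intros assms(2))

lemma frac_comp:
  assumes "frac G Y h" "\<And>g. g \<in> G \<Longrightarrow> frac F X (\<lambda>x. g (\<phi> x))" "\<And>x. x \<in> X \<Longrightarrow> \<phi> x \<in> Y"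
  shows "frac F X (\<lambda>x. h (\<phi> x))"
proof -
  obtain f g where fg: "f \<in> poly_funs G" "g \<in> poly_funs G" "\<And>y. y \<in> Y \<Longrightarrow> g y \<noteq> 0 \<and> h y = f y / g y"
    using assms(1) unfolding frac_def by blast
  have "frac F X (\<lambda>x. f (\<phi> x) / g (\<phi> x))"
    using fg assms(3) by (intro frac_divide frac_poly_comp[OF _ assms(2)]) auto
  then show ?thesis using fg assms(3) by (subst frac_cong[where k = "\<lambda>x. f (\<phi> x) / g (\<phi> x)"]) auto
qed

definition principal_open :: "('a \<Rightarrow> complex) set \<Rightarrow> 'a set \<Rightarrow> 'a set \<Rightarrow> bool" where
  "principal_open F X U \<longleftrightarrow> (\<exists>f\<in>poly_funs F. U = {x \<in> X. f x \<noteq> 0})"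

lemma principal_open_refl: "principal_open F X X"
  unfolding principal_open_def by (rule bexI[of _ "\<lambda>_. 1"]) (auto intro: poly_funs.const)

text \<open>Open conditions can be imposed one after another, where each of the functions involved has to be
  a fraction only on the set cut out so far.\<close>

lemma principal_open_step:
  assumes "principal_open F X U" "frac F U h"
  shows "principal_open F X {x \<in> U. h x \<noteq> 0}"
proof -
  obtain e where e: "e \<in> poly_funs F" "U = {x \<in> X. e x \<noteq> 0}"
    using assms(1) unfolding principal_open_def by blast
  obtain f g where fg: "f \<in> poly_funs F" "g \<in> poly_funs F" "\<And>x. x \<in> U \<Longrightarrow> g x \<noteq> 0 \<and> h x = f x / g x"
    using assms(2) unfolding frac_def by blast
  show ?thesis unfolding principal_open_def
    by (rule bexI[of _ "\<lambda>x. e x * f x"]) (use e fg in \<open>auto intro: poly_funs.mult\<close>)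
qed

lemma principal_open_zariski: "principal_open F X U \<Longrightarrow> zariski_open F X U"
proof -
  assume "principal_open F X U"
  then obtain f where "f \<in> poly_funs F" "U = {x \<in> X. f x \<noteq> 0}" unfolding principal_open_def by blast
  then show ?thesis unfolding zariski_open_def by (intro exI[of _ "{f}"]) auto
qed

lemma topspace_classical_topology: "F \<noteq> {} \<Longrightarrow> topspace (classical_topology F X) = X"
proof -
  assume "F \<noteq> {}"
  then obtain f where "f \<in> F" by blast
  then have "f -` UNIV \<in> {f -` T |f T. f \<in> F \<and> open T}" by blast
  then have "\<Union>{f -` T |f T. f \<in> F \<and> open T} = UNIV" by auto
  then show ?thesis unfolding classical_topology_def by simp
qed

lemma continuous_map_binary:
  fixes f :: "'a \<Rightarrow> 'b::topological_space" and g :: "'a \<Rightarrow> 'c::topological_space"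
  assumes "continuous_map T euclidean f" "continuous_map T euclidean g"
    and "continuous_on UNIV (\<lambda>z. b (fst z) (snd z) :: 'd::topological_space)"
  shows "continuous_map T euclidean (\<lambda>x. b (f x) (g x))"
proof -
  have "continuous_map T (prod_topology euclidean euclidean) (\<lambda>x. (f x, g x))"
    by (rule continuous_map_pairedI) (rule assms)+
  then have "continuous_map T euclidean (\<lambda>x. (f x, g x))" by (simp add: euclidean_product_topology)
  moreover have "continuous_map euclidean euclidean (\<lambda>z. b (fst z) (snd z))" using assms(3) by simp
  ultimately have "continuous_map T euclidean ((\<lambda>z. b (fst z) (snd z)) \<circ> (\<lambda>x. (f x, g x)))"
    by (rule continuous_map_compose)
  then show ?thesis by (simp add: o_def)
qed

lemma continuous_map_poly:
  "f \<in> poly_funs F \<Longrightarrow> continuous_map (classical_topology F X) euclidean f"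
proof (induction rule: poly_funs.induct)
  case (coord f)
  show ?case unfolding classical_topology_def
  proof (rule continuous_map_from_subtopology, unfold continuous_map_def, intro conjI allI impI)
    let ?B = "topology_generated_by {f -` T |f T. f \<in> F \<and> open T}"
    have ts: "topspace ?B = UNIV"
      using topspace_classical_topology[of F UNIV] coord unfolding classical_topology_def by auto
    fix U :: "complex set" assume "openin euclidean U"
    then have "openin ?B (f -` U)" by (intro topology_generated_by_Basis) (use coord in auto)
    moreover have "{x \<in> topspace ?B. f x \<in> U} = f -` U" unfolding ts by auto
    ultimately show "openin ?B {x \<in> topspace ?B. f x \<in> U}" by (simp only:)
  qed simp
qed (auto intro!: continuous_map_binary[where b = "(+)"] continuous_map_binary[where b = "(*)"] continuous_intros)

lemma continuous_map_frac:
  assumes "frac F X h" "F \<noteq> {}"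
  shows "continuous_map (classical_topology F X) euclidean h"
proof -
  let ?T = "classical_topology F X"
  obtain f g where fg: "f \<in> poly_funs F" "g \<in> poly_funs F" "\<And>x. x \<in> X \<Longrightarrow> g x \<noteq> 0 \<and> h x = f x / g x"
    using assms(1) unfolding frac_def by blast
  have "continuous_map ?T (top_of_set (- {0})) g"
    using fg assms(2) continuous_map_poly[OF fg(2), of X] by (auto simp: continuous_map_in_subtopology topspace_classical_topology)
  moreover have "continuous_map (top_of_set (- {0})) euclidean (inverse :: complex \<Rightarrow> complex)"
    by (auto intro!: continuous_intros)
  ultimately have "continuous_map ?T euclidean (inverse \<circ> g)"
    by (rule continuous_map_compose)
  then have "continuous_map ?T euclidean (\<lambda>x. f x / g x)"
    unfolding divide_inverse o_def
    by (rule continuous_map_binary[where b = "(*)", OF continuous_map_poly[OF fg(1)]]) (auto intro!: continuous_intros)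
  then show ?thesis
    by (rule continuous_map_eq) (use fg assms(2) in \<open>auto simp: topspace_classical_topology\<close>)
qed

lemma continuous_map_classical:
  assumes "\<And>g. g \<in> G \<Longrightarrow> frac F X (\<lambda>x. g (\<phi> x))" "\<And>x. x \<in> X \<Longrightarrow> \<phi> x \<in> Y" "F \<noteq> {}" "G \<noteq> {}"
  shows "continuous_map (classical_topology F X) (classical_topology G Y) \<phi>"
  unfolding classical_topology_def[of G Y] continuous_map_in_subtopology
proof
  let ?T = "classical_topology F X"
  have ts: "topspace ?T = X" using assms(3) by (rule topspace_classical_topology)
  show "\<phi> \<in> topspace ?T \<rightarrow> Y" using assms(2) ts by auto
  have un: "\<Union>{f -` T |f T. f \<in> G \<and> open T} = UNIV"
    using topspace_classical_topology[OF assms(4), of UNIV] unfolding classical_topology_def by simp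
  show "continuous_map ?T (topology_generated_by {f -` T |f T. f \<in> G \<and> open T}) \<phi>"
  proof (rule continuous_on_generated_topo)
    fix U assume "U \<in> {f -` T |f T. f \<in> G \<and> open T}"
    then obtain g T where gT: "g \<in> G" "open T" "U = g -` T" by blast
    have "openin ?T {x \<in> topspace ?T. g (\<phi> x) \<in> T}"
      using gT by (intro openin_continuous_map_preimage[OF continuous_map_frac[OF assms(1)]] assms(3)) auto
    then show "openin ?T (\<phi> -` U \<inter> topspace ?T)"
      unfolding gT(3) by (simp add: vimage_def Int_def conj_commute)
  qed (simp add: un)
qed

lemma variety_morphismI:
  assumes "\<And>g. g \<in> G \<Longrightarrow> frac F X (\<lambda>x. g (\<phi> x))" "\<And>x. x \<in> X \<Longrightarrow> \<phi> x \<in> Y"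
  shows "variety_morphism F X G Y \<phi>"
  unfolding variety_morphism_def o_def
proof (intro conjI ballI)
  show "regular_fun F X (\<lambda>x. g (\<phi> x))" if "g \<in> G" for g using that by (intro frac_regular assms(1))
qed (use assms(2) in blast)


section \<open>Functions on the spectrum of a cubic\<close>

text \<open>The roots \<open>y x i\<close> are not fractions of coordinates, only the coefficients of their cubic
  are. Functions of the form \<open>c\<^sub>0 + c\<^sub>1 y + c\<^sub>2 y\<^sup>2\<close>, whose coefficients are fractions that do not depend on the
  chosen root, form the cubic algebra over the fractions; sums and products over the three roots are
  its trace and norm and hence fractions.\<close>

locale cubic_spectrum =
  fixes F :: "('a \<Rightarrow> complex) set" and X :: "'a set" and y :: "'a \<Rightarrow> 3 \<Rightarrow> complex"
    and al be :: "'a \<Rightarrow> complex"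
  assumes al: "frac F X al" and be: "frac F X be"
    and e1: "\<And>x. x \<in> X \<Longrightarrow> y x 1 + y x 2 + y x 3 = al x"
    and e2: "\<And>x. x \<in> X \<Longrightarrow> y x 1 * y x 2 + y x 1 * y x 3 + y x 2 * y x 3 = be x"
    and e3: "\<And>x. x \<in> X \<Longrightarrow> y x 1 * y x 2 * y x 3 = 1"
begin

definition spec_fun :: "('a \<Rightarrow> 3 \<Rightarrow> complex) \<Rightarrow> bool" where
  "spec_fun \<kappa> \<longleftrightarrow> (\<exists>c0 c1 c2. frac F X c0 \<and> frac F X c1 \<and> frac F X c2 \<and>
    (\<forall>x\<in>X. \<forall>i. \<kappa> x i = c0 x + c1 x * y x i + c2 x * (y x i)\<^sup>2))"

lemma y_nonzero: "x \<in> X \<Longrightarrow> y x i \<noteq> 0"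
  using e3[of x] exhaust_3[of i] by auto

lemma y_cubic: "x \<in> X \<Longrightarrow> y x i * (y x i)\<^sup>2 = al x * (y x i)\<^sup>2 - be x * y x i + 1"
proof -
  assume x: "x \<in> X"
  have "i = 1 \<or> i = 2 \<or> i = 3" by (rule exhaust_3)
  then show ?thesis
    by (elim disjE) (simp_all add: e1[OF x, symmetric] e2[OF x, symmetric] e3[OF x, symmetric] algebra_simps power2_eq_square)
qed

lemma spec_funI:
  assumes "frac F X c0" "frac F X c1" "frac F X c2"
    "\<And>x i. x \<in> X \<Longrightarrow> \<kappa> x i = c0 x + c1 x * y x i + c2 x * (y x i)\<^sup>2"
  shows "spec_fun \<kappa>"
  using assms unfolding spec_fun_def by blast

lemma spec_fun_const: "frac F X c \<Longrightarrow> spec_fun (\<lambda>x i. c x)"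
  by (rule spec_funI[of c "\<lambda>_. 0" "\<lambda>_. 0"]) (auto intro: frac_intros)

lemma spec_fun_y: "spec_fun y"
  by (rule spec_funI[of "\<lambda>_. 0" "\<lambda>_. 1" "\<lambda>_. 0"]) (auto intro: frac_intros)

lemma spec_fun_add: assumes "spec_fun \<kappa>" "spec_fun \<mu>" shows "spec_fun (\<lambda>x i. \<kappa> x i + \<mu> x i)"
proof -
  obtain a0 a1 a2 where a: "frac F X a0" "frac F X a1" "frac F X a2"
    "\<And>x i. x \<in> X \<Longrightarrow> \<kappa> x i = a0 x + a1 x * y x i + a2 x * (y x i)\<^sup>2" using assms(1) unfolding spec_fun_def by blast
  obtain b0 b1 b2 where b: "frac F X b0" "frac F X b1" "frac F X b2"
    "\<And>x i. x \<in> X \<Longrightarrow> \<mu> x i = b0 x + b1 x * y x i + b2 x * (y x i)\<^sup>2" using assms(2) unfolding spec_fun_def by blast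
  show ?thesis
    by (rule spec_funI[of "\<lambda>x. a0 x + b0 x" "\<lambda>x. a1 x + b1 x" "\<lambda>x. a2 x + b2 x"])
      (use a b in \<open>auto intro!: frac_intros simp: algebra_simps\<close>)
qed

lemma spec_fun_mult: assumes "spec_fun \<kappa>" "spec_fun \<mu>" shows "spec_fun (\<lambda>x i. \<kappa> x i * \<mu> x i)"
proof -
  obtain a0 a1 a2 where a: "frac F X a0" "frac F X a1" "frac F X a2"
    "\<And>x i. x \<in> X \<Longrightarrow> \<kappa> x i = a0 x + a1 x * y x i + a2 x * (y x i)\<^sup>2" using assms(1) unfolding spec_fun_def by blast
  obtain b0 b1 b2 where b: "frac F X b0" "frac F X b1" "frac F X b2"
    "\<And>x i. x \<in> X \<Longrightarrow> \<mu> x i = b0 x + b1 x * y x i + b2 x * (y x i)\<^sup>2" using assms(2) unfolding spec_fun_def by blast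
  \<comment> \<open>reduce the degree with the cubic equation and its multiple by \<open>y\<close>\<close>
  have red: "(a + b * z + c * z\<^sup>2) * (d + e * z + f * z\<^sup>2) =
      (a * d + (b * f + c * e) + c * f * A) + (a * e + b * d - (b * f + c * e) * B + c * f * (1 - A * B)) * z +
      (a * f + b * e + c * d + (b * f + c * e) * A + c * f * (A * A - B)) * z\<^sup>2"
    if "z * z\<^sup>2 = A * z\<^sup>2 - B * z + 1" for a b c d e f z A B :: complex
    using that by algebra
  show ?thesis
    by (rule spec_funI[of "\<lambda>x. a0 x * b0 x + (a1 x * b2 x + a2 x * b1 x) + a2 x * b2 x * al x"
          "\<lambda>x. a0 x * b1 x + a1 x * b0 x - (a1 x * b2 x + a2 x * b1 x) * be x + a2 x * b2 x * (1 - al x * be x)"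
          "\<lambda>x. a0 x * b2 x + a1 x * b1 x + a2 x * b0 x + (a1 x * b2 x + a2 x * b1 x) * al x + a2 x * b2 x * (al x * al x - be x)"])
      (use a b al be red[OF y_cubic] in \<open>auto intro!: frac_intros\<close>)
qed

lemma spec_fun_scale: "frac F X c \<Longrightarrow> spec_fun \<kappa> \<Longrightarrow> spec_fun (\<lambda>x i. c x * \<kappa> x i)"
  by (rule spec_fun_mult[OF spec_fun_const])

lemma spec_fun_diff: "spec_fun \<kappa> \<Longrightarrow> spec_fun \<mu> \<Longrightarrow> spec_fun (\<lambda>x i. \<kappa> x i - \<mu> x i)"
  using spec_fun_add[OF _ spec_fun_scale[OF frac_const[of F X "-1"]], of \<kappa> \<mu>] by simp

lemma spec_fun_power: "spec_fun \<kappa> \<Longrightarrow> spec_fun (\<lambda>x i. \<kappa> x i ^ n)"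
  by (induction n) (auto intro: spec_fun_const frac_const spec_fun_mult)

lemma spec_fun_cong: "(\<And>x i. x \<in> X \<Longrightarrow> \<kappa> x i = \<mu> x i) \<Longrightarrow> spec_fun \<mu> \<Longrightarrow> spec_fun \<kappa>"
  unfolding spec_fun_def by simp

lemma frac_sum_spec: assumes "spec_fun \<kappa>" shows "frac F X (\<lambda>x. \<Sum>i\<in>UNIV. \<kappa> x i)"
proof -
  obtain a0 a1 a2 where a: "frac F X a0" "frac F X a1" "frac F X a2"
    "\<And>x i. x \<in> X \<Longrightarrow> \<kappa> x i = a0 x + a1 x * y x i + a2 x * (y x i)\<^sup>2" using assms(1) unfolding spec_fun_def by blast
  have "(\<Sum>i\<in>UNIV. \<kappa> x i) = 3 * a0 x + a1 x * al x + a2 x * (al x * al x - 2 * be x)" if "x \<in> X" for x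
    using a(4)[OF that] by (simp add: sum_3 e1[OF that, symmetric] e2[OF that, symmetric] algebra_simps power2_eq_square)
  then show ?thesis
    by (subst frac_cong[where k = "\<lambda>x. 3 * a0 x + a1 x * al x + a2 x * (al x * al x - 2 * be x)"])
      (use a al be in \<open>auto intro!: frac_intros\<close>)
qed

lemma frac_prod_spec: assumes "spec_fun \<kappa>" shows "frac F X (\<lambda>x. \<kappa> x 1 * \<kappa> x 2 * \<kappa> x 3)"
proof -
  define p where "p n x = (\<Sum>i\<in>UNIV. \<kappa> x i ^ n)" for n x
  have p: "frac F X (p n)" for n unfolding p_def by (intro frac_sum_spec spec_fun_power assms)
  \<comment> \<open>Newton's identity for the third elementary symmetric function\<close>
  have *: "\<kappa> x 1 * \<kappa> x 2 * \<kappa> x 3 = (p 1 x ^ 3 - 3 * p 1 x * p 2 x + 2 * p 3 x) / 6" for x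
    by (simp add: p_def sum_3 power3_eq_cube power2_eq_square algebra_simps)
  show ?thesis unfolding * by (intro frac_intros p) simp
qed

text \<open>By the Cayley--Hamilton identity, \<open>\<kappa>\<close> times \<open>\<kappa>\<^sup>2 - p\<^sub>1 \<kappa> + (p\<^sub>1\<^sup>2 - p\<^sub>2) / 2\<close> is the norm of \<open>\<kappa>\<close>, where
  \<open>p\<^sub>n\<close> is the trace of \<open>\<kappa>\<^sup>n\<close>.\<close>

lemma spec_fun_inverse:
  assumes "spec_fun \<kappa>" "\<And>x i. x \<in> X \<Longrightarrow> \<kappa> x i \<noteq> 0"
  shows "spec_fun (\<lambda>x i. inverse (\<kappa> x i))"
proof -
  define p where "p n x = (\<Sum>i\<in>UNIV. \<kappa> x i ^ n)" for n x
  define e where "e x = \<kappa> x 1 * \<kappa> x 2 * \<kappa> x 3" for x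
  have p: "frac F X (p n)" for n unfolding p_def by (intro frac_sum_spec spec_fun_power assms)
  have e: "frac F X e" unfolding e_def by (intro frac_prod_spec assms)
  have e0: "e x \<noteq> 0" if "x \<in> X" for x using assms(2)[OF that] by (simp add: e_def)
  have *: "inverse (\<kappa> x i) = (1 / e x) * (\<kappa> x i ^ 2 - p 1 x * \<kappa> x i + (p 1 x ^ 2 - p 2 x) / 2)" if "x \<in> X" for x i
  proof -
    have "i = 1 \<or> i = 2 \<or> i = 3" by (rule exhaust_3)
    then have "\<kappa> x i * (\<kappa> x i ^ 2 - p 1 x * \<kappa> x i + (p 1 x ^ 2 - p 2 x) / 2) = e x"
      by (elim disjE) (simp_all add: p_def e_def sum_3 power2_eq_square field_simps)
    then show ?thesis using e0[OF that] assms(2)[OF that, of i] by (simp add: field_simps)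
  qed
  show ?thesis
    by (rule spec_fun_cong[OF *], assumption)
      (intro spec_fun_scale spec_fun_add spec_fun_diff spec_fun_power spec_fun_const frac_intros p e e0 assms; simp)
qed

lemma spec_fun_divide:
  "spec_fun \<kappa> \<Longrightarrow> spec_fun \<mu> \<Longrightarrow> (\<And>x i. x \<in> X \<Longrightarrow> \<mu> x i \<noteq> 0) \<Longrightarrow> spec_fun (\<lambda>x i. \<kappa> x i / \<mu> x i)"
  unfolding divide_inverse by (intro spec_fun_mult spec_fun_inverse)

lemmas spec_fun_intros = spec_fun_const spec_fun_y spec_fun_add spec_fun_mult spec_fun_diff spec_fun_power spec_fun_divide

lemma matrix_add_rdistrib': "(A + B) ** C = A ** C + B ** (C :: complex^3^3)"
  by (simp add: vec_eq_iff matrix_matrix_mult_def sum.distrib distrib_right)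

text \<open>A permutation of the roots conjugates these matrices by a permutation matrix. They are closed under
  products and their traces are therefore fractions.\<close>

inductive spec_matrix :: "('a \<Rightarrow> complex^3^3) \<Rightarrow> bool" where
  diag: "spec_fun \<kappa> \<Longrightarrow> spec_matrix (\<lambda>x. \<chi> i j. if i = j then \<kappa> x i else 0)"
| outer: "spec_fun a \<Longrightarrow> spec_fun b \<Longrightarrow> spec_matrix (\<lambda>x. \<chi> i j. a x i * b x j)"
| add: "spec_matrix M \<Longrightarrow> spec_matrix N \<Longrightarrow> spec_matrix (\<lambda>x. M x + N x)"

lemma spec_matrix_mult:
  assumes "spec_matrix M" "spec_matrix N" shows "spec_matrix (\<lambda>x. M x ** N x)"
  using assms(1)
proof induction
  case (diag \<kappa>)
  show ?case using assms(2)
  proof induction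
    case (diag \<mu>)
    have "(\<lambda>x. (\<chi> i j. if i = j then \<kappa> x i else 0) ** (\<chi> i j. if i = j then \<mu> x i else 0)) =
        (\<lambda>x. (\<chi> i j. if i = j then \<kappa> x i * \<mu> x i else 0) :: complex^3^3)"
      by (simp add: fun_eq_iff vec_eq_iff matrix_matrix_mult_def sum_3 forall_3)
    then show ?case using spec_matrix.diag[OF spec_fun_mult[OF \<open>spec_fun \<kappa>\<close> \<open>spec_fun \<mu>\<close>]] by simp
  next
    case (outer a b)
    have "(\<lambda>x. (\<chi> i j. if i = j then \<kappa> x i else 0) ** (\<chi> i j. a x i * b x j)) =
        (\<lambda>x. (\<chi> i j. (\<kappa> x i * a x i) * b x j) :: complex^3^3)"
      by (simp add: fun_eq_iff vec_eq_iff matrix_matrix_mult_def sum_3 forall_3)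
    then show ?case using spec_matrix.outer[OF spec_fun_mult[OF \<open>spec_fun \<kappa>\<close> \<open>spec_fun a\<close>] \<open>spec_fun b\<close>] by simp
  qed (auto simp: matrix_add_ldistrib intro: spec_matrix.add)
next
  case (outer a b)
  show ?case using assms(2)
  proof induction
    case (diag \<mu>)
    have "(\<lambda>x. (\<chi> i j. a x i * b x j) ** (\<chi> i j. if i = j then \<mu> x i else 0)) =
        (\<lambda>x. (\<chi> i j. a x i * (b x j * \<mu> x j)) :: complex^3^3)"
      by (simp add: fun_eq_iff vec_eq_iff matrix_matrix_mult_def sum_3 forall_3)
    then show ?case using spec_matrix.outer[OF \<open>spec_fun a\<close> spec_fun_mult[OF \<open>spec_fun b\<close> \<open>spec_fun \<mu>\<close>]] by simp
  next
    case (outer c d)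
    have "(\<lambda>x. (\<chi> i j. a x i * b x j) ** (\<chi> i j. c x i * d x j)) =
        (\<lambda>x. (\<chi> i j. ((\<Sum>l\<in>UNIV. b x l * c x l) * a x i) * d x j) :: complex^3^3)"
      by (simp add: fun_eq_iff vec_eq_iff matrix_matrix_mult_def sum_3 algebra_simps)
    then show ?case
      using spec_matrix.outer[OF spec_fun_scale[OF frac_sum_spec[OF spec_fun_mult[OF \<open>spec_fun b\<close> \<open>spec_fun c\<close>]] \<open>spec_fun a\<close>] \<open>spec_fun d\<close>]
      by simp
  qed (auto simp: matrix_add_ldistrib intro: spec_matrix.add)
next
  case (add M M')
  then show ?case using spec_matrix.add by (auto simp: matrix_add_rdistrib')
qed

lemma frac_trace_spec_matrix: "spec_matrix M \<Longrightarrow> frac F X (\<lambda>x. trace (M x))"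
proof (induction rule: spec_matrix.induct)
  case (diag \<kappa>)
  then show ?case using frac_sum_spec[OF diag] by (simp add: trace_def)
next
  case (outer a b)
  then show ?case using frac_sum_spec[OF spec_fun_mult[OF outer]] by (simp add: trace_def)
next
  case (add M N)
  then show ?case by (simp add: trace_add frac_add)
qed

end

section \<open>Solving the relation in an eigenbasis\<close>

text \<open>The derivative of the characteristic polynomial \<open>z\<^sup>3 - al z\<^sup>2 + be z - 1\<close>; at a root it is the product of
  the differences to the other two, the denominator of Lagrange interpolation.\<close>

definition spec_deriv :: "complex \<Rightarrow> complex \<Rightarrow> complex \<Rightarrow> complex" where
  "spec_deriv al be z = 3 * z\<^sup>2 - 2 * al * z + be"

text \<open>Off the diagonal, these entries of \<open>x\<^sup>2\<close> and \<open>x D x\<close> are \<open>\<rho>\<^sub>j\<close> times a function of \<open>i\<close> plus a function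
  of \<open>j\<close>. This separation of variables makes the relation solvable.\<close>

lemma square_entry:
  fixes m rho :: "3 \<Rightarrow> complex"
  shows "(\<Sum>l\<in>UNIV. ((if i = l then m i else 0) + rho l) * ((if l = j then m l else 0) + rho j)) =
    (if i = j then (m i)\<^sup>2 else 0) + rho j * (m i + m j + (\<Sum>l\<in>UNIV. rho l))"
  using exhaust_3[of i] exhaust_3[of j]
  by (elim disjE) (simp_all add: sum_3 algebra_simps power2_eq_square)

lemma twisted_square_entry:
  fixes m rho D :: "3 \<Rightarrow> complex"
  shows "(\<Sum>l\<in>UNIV. ((if i = l then m i else 0) + rho l) * D l * ((if l = j then m l else 0) + rho j)) =
    (if i = j then (m i)\<^sup>2 * D i else 0) + rho j * (m i * D i + m j * D j + (\<Sum>l\<in>UNIV. rho l * D l))"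
  using exhaust_3[of i] exhaust_3[of j]
  by (elim disjE) (simp_all add: sum_3 algebra_simps power2_eq_square)

lemma affine_moment:
  fixes k u v :: "3 \<Rightarrow> complex"
  shows "(\<Sum>i\<in>UNIV. (A * u i + B - C * v i) * (k i - 1)) =
    A * ((\<Sum>i\<in>UNIV. k i * u i) - (\<Sum>i\<in>UNIV. u i)) + B * ((\<Sum>i\<in>UNIV. k i) - 3) -
    C * ((\<Sum>i\<in>UNIV. k i * v i) - (\<Sum>i\<in>UNIV. v i))"
  by (simp add: sum_3 algebra_simps)

locale eigenvalues =
  fixes y :: "3 \<Rightarrow> complex" and al be :: complex
  assumes e1: "y 1 + y 2 + y 3 = al"
    and e2: "y 1 * y 2 + y 1 * y 3 + y 2 * y 3 = be"
    and e3: "y 1 * y 2 * y 3 = 1"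
    and distinct: "y 1 \<noteq> y 2" "y 1 \<noteq> y 3" "y 2 \<noteq> y 3"
begin

abbreviation dv :: "3 \<Rightarrow> complex" where
  "dv i \<equiv> spec_deriv al be (y i)"

lemma y_nonzero: "y i \<noteq> 0"
  using e3 exhaust_3[of i] by auto

lemma dv_simps: "dv 1 = (y 1 - y 2) * (y 1 - y 3)" "dv 2 = (y 2 - y 1) * (y 2 - y 3)" "dv 3 = (y 3 - y 1) * (y 3 - y 2)"
proof -
  show "dv 1 = (y 1 - y 2) * (y 1 - y 3)"
    unfolding spec_deriv_def unfolding e1[symmetric] e2[symmetric] by (simp add: algebra_simps power2_eq_square)
  show "dv 2 = (y 2 - y 1) * (y 2 - y 3)"
    unfolding spec_deriv_def unfolding e1[symmetric] e2[symmetric] by (simp add: algebra_simps power2_eq_square)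
  show "dv 3 = (y 3 - y 1) * (y 3 - y 2)"
    unfolding spec_deriv_def unfolding e1[symmetric] e2[symmetric] by (simp add: algebra_simps power2_eq_square)
qed

lemma dv_nonzero: "dv i \<noteq> 0"
  using exhaust_3[of i] dv_simps distinct by auto

lemma inverse_y: "1 / y 1 = y 2 * y 3" "1 / y 2 = y 1 * y 3" "1 / y 3 = y 1 * y 2"
  using e3 y_nonzero by (simp_all add: field_simps)

lemma inverse_y_poly: "1 / y i = (y i)\<^sup>2 - al * y i + be"
  using exhaust_3[of i] unfolding e1[symmetric] e2[symmetric]
  by (elim disjE) (simp_all add: inverse_y algebra_simps power2_eq_square)

lemma y_cube: "y i * (y i)\<^sup>2 = al * (y i)\<^sup>2 - be * y i + 1"
proof -
  have "y i * (1 / y i) = 1" using y_nonzero by simp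
  then show ?thesis unfolding inverse_y_poly by (simp add: algebra_simps power2_eq_square)
qed

text \<open>Lagrange interpolation: a function on the spectrum is determined by its first three
  moments.\<close>

lemma lagrange:
  shows "v i * dv i = (\<Sum>j\<in>UNIV. v j * (y j)\<^sup>2) - (al - y i) * (\<Sum>j\<in>UNIV. v j * y j) + (\<Sum>j\<in>UNIV. v j) / y i"
proof -
  have d: "(\<Sum>j\<in>UNIV. v j) / y i = (\<Sum>j\<in>UNIV. v j) * (1 / y i)" by simp
  have a: "al - y 1 = y 2 + y 3" "al - y 2 = y 1 + y 3" "al - y 3 = y 1 + y 2" unfolding e1[symmetric] by simp_all
  have "i = 1 \<or> i = 2 \<or> i = 3" by (rule exhaust_3)
  then show ?thesis unfolding d
    by (elim disjE; simp only: inverse_y dv_simps sum_3 a; simp add: algebra_simps power2_eq_square)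
qed

lemma lagrange_converse:
  assumes "\<And>i. v i * dv i = T2 - (al - y i) * T1 + T0 / y i"
  shows "(\<Sum>j\<in>UNIV. v j) = T0" "(\<Sum>j\<in>UNIV. v j * y j) = T1" "(\<Sum>j\<in>UNIV. v j * (y j)\<^sup>2) = T2"
proof -
  let ?D = "(y 1 - y 2) * (y 1 - y 3) * (y 2 - y 3)"
  have D: "?D \<noteq> 0" using distinct by simp
  have h1: "v 1 * ((y 1 - y 2) * (y 1 - y 3)) = T2 - (y 2 + y 3) * T1 + T0 * (y 2 * y 3)"
    using assms[of 1, unfolded dv_simps] unfolding inverse_y[symmetric] e1[symmetric] by simp
  have h2: "v 2 * ((y 2 - y 1) * (y 2 - y 3)) = T2 - (y 1 + y 3) * T1 + T0 * (y 1 * y 3)"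
    using assms[of 2, unfolded dv_simps] unfolding inverse_y[symmetric] e1[symmetric] by simp
  have h3: "v 3 * ((y 3 - y 1) * (y 3 - y 2)) = T2 - (y 1 + y 2) * T1 + T0 * (y 1 * y 2)"
    using assms[of 3, unfolded dv_simps] unfolding inverse_y[symmetric] e1[symmetric] by simp
  have D_mult: "(v 1 * c1 + v 2 * c2 + v 3 * c3) * ?D =
      c1 * (T2 - (y 2 + y 3) * T1 + T0 * (y 2 * y 3)) * (y 2 - y 3) -
      c2 * (T2 - (y 1 + y 3) * T1 + T0 * (y 1 * y 3)) * (y 1 - y 3) +
      c3 * (T2 - (y 1 + y 2) * T1 + T0 * (y 1 * y 2)) * (y 1 - y 2)" for c1 c2 c3
    unfolding h1[symmetric] h2[symmetric] h3[symmetric] by (simp add: algebra_simps)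
  have "(v 1 * 1 + v 2 * 1 + v 3 * 1) * ?D = T0 * ?D" unfolding D_mult by (simp add: algebra_simps)
  then show "(\<Sum>j\<in>UNIV. v j) = T0" unfolding mult_right_cancel[OF D] by (simp add: sum_3)
  have "(v 1 * y 1 + v 2 * y 2 + v 3 * y 3) * ?D = T1 * ?D" unfolding D_mult by (simp add: algebra_simps)
  then show "(\<Sum>j\<in>UNIV. v j * y j) = T1" unfolding mult_right_cancel[OF D] by (simp add: sum_3)
  have "(v 1 * (y 1)\<^sup>2 + v 2 * (y 2)\<^sup>2 + v 3 * (y 3)\<^sup>2) * ?D = T2 * ?D"
    unfolding D_mult by (simp add: algebra_simps power2_eq_square)
  then show "(\<Sum>j\<in>UNIV. v j * (y j)\<^sup>2) = T2" unfolding mult_right_cancel[OF D] by (simp add: sum_3)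
qed

end

text \<open>The letters \<open>P\<close> and \<open>Q\<close> stand for \<open>al t + h\<close> and \<open>be r + b\<close>, the letters \<open>p\<close> and \<open>q\<close> for \<open>al t - h\<close> and
  \<open>be r - b\<close>. The values chosen for \<open>p\<close>, \<open>q\<close> and \<open>s\<close> solve the linear equations of \<open>relation_equations\<close>
  and \<open>solve_la_nu\<close> with \<open>nu = 1\<close>; \<open>km\<close>, \<open>s\<close>, \<open>kp\<close> are the moments of \<open>k\<close> with exponents \<open>-1, 0, 1\<close>.\<close>

locale params =
  fixes r t w la :: complex
begin

definition s where "s = (3 + la + w) / (1 - la)"
definition P where "P = la * r + t\<^sup>2"
definition Q where "Q = la * t + r\<^sup>2"
definition p where "p = ((s + 3) * r\<^sup>2 - w * t * s + w * Q) / (r * (s - 1))"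
definition q where "q = ((s + 3) * t\<^sup>2 - w * r * s + w * P) / (t * (s - 1))"
definition al where "al = (P + p) / (2 * t)"
definition be where "be = (Q + q) / (2 * r)"
definition h where "h = (P - p) / 2"
definition b where "b = (Q - q) / 2"
definition kp where "kp = (r * s - h) / t"
definition km where "km = (t * s - b) / r"

end

text \<open>The solution of the relation with given parameters, before scaling to determinant one: \<open>k\<close> is interpolated
  from its moments, \<open>E\<^sub>i = m\<^sub>i D\<^sub>i\<close>, and \<open>k\<^sub>i = 1 + 2 \<rho>\<^sub>i / m\<^sub>i\<close>.\<close>

locale normal_form = params r t w la + eigenvalues y "params.al r t w la" "params.be r t w la"
  for r t w la :: complex and y :: "3 \<Rightarrow> complex" +
  assumes r0: "r \<noteq> 0" and t0: "t \<noteq> 0" and la1: "la \<noteq> 1" and s1: "s \<noteq> 1"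
begin

definition k :: "3 \<Rightarrow> complex" where "k i = (y i * kp - (al - y i) * y i * s + km) / dv i"
definition m :: "3 \<Rightarrow> complex" where "m i = w / y i + (r + p) - 2 * t * y i"
definition rho :: "3 \<Rightarrow> complex" where "rho i = m i * (k i - 1) / 2"
definition E :: "3 \<Rightarrow> complex" where "E i = w * y i + (t + q) - 2 * r / y i"

lemma s_eq: "s * (1 - la) = 3 + la + w"
  using la1 by (simp add: s_def)

lemma p_eq: "r * (s - 1) * p = (s + 3) * r\<^sup>2 - w * t * s + w * Q"
  using r0 s1 by (simp add: p_def)

lemma q_eq: "t * (s - 1) * q = (s + 3) * t\<^sup>2 - w * r * s + w * P"
  using t0 s1 by (simp add: q_def)

lemma al_eq: "2 * (t * al) = P + p" using t0 by (simp add: al_def)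
lemma be_eq: "2 * (r * be) = Q + q" using r0 by (simp add: be_def)
lemma h_eq: "2 * h = P - p" by (simp add: h_def)
lemma b_eq: "2 * b = Q - q" by (simp add: b_def)
lemma kp_eq: "t * kp = r * s - h" using t0 by (simp add: kp_def)
lemma km_eq: "r * km = t * s - b" using r0 by (simp add: km_def)

text \<open>The compatibility condition under which \<open>k\<close>, interpolated from three moments, also satisfies the
  diagonal equations \<open>k_eq\<close>.\<close>

lemma moment_eq: "s * (r ^ 3 - al * r\<^sup>2 * t + be * r * t\<^sup>2 - t ^ 3) = h * r\<^sup>2 - b * t\<^sup>2"
proof -
  have "2 * s * (r ^ 3 - t ^ 3) - s * r\<^sup>2 * (P + p) + s * t\<^sup>2 * (Q + q) = r\<^sup>2 * (P - p) - t\<^sup>2 * (Q - q)"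
    using s_eq p_eq q_eq unfolding P_def Q_def by algebra
  then have "2 * s * (r ^ 3 - t ^ 3) - s * r\<^sup>2 * (2 * (t * al)) + s * t\<^sup>2 * (2 * (r * be)) = r\<^sup>2 * (2 * h) - t\<^sup>2 * (2 * b)"
    unfolding al_eq be_eq h_eq b_eq .
  then show ?thesis by algebra
qed

lemma k_dv: "k i * dv i = y i * kp - (al - y i) * y i * s + km"
  using dv_nonzero by (simp add: k_def)

lemma k_moments: "(\<Sum>i\<in>UNIV. k i / y i) = km" "(\<Sum>i\<in>UNIV. k i) = s" "(\<Sum>i\<in>UNIV. k i * y i) = kp"
proof -
  have "(k i / y i) * dv i = kp - (al - y i) * s + km / y i" for i
    using k_dv[of i] y_nonzero[of i] by (simp add: field_simps)
  from lagrange_converse[OF this] y_nonzero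
  show "(\<Sum>i\<in>UNIV. k i / y i) = km" "(\<Sum>i\<in>UNIV. k i) = s" "(\<Sum>i\<in>UNIV. k i * y i) = kp"
    by (simp_all add: power2_eq_square)
qed

lemma k_eq: "k i * dv i * (r - t * y i) = h * (y i)\<^sup>2 - b"
proof -
  have "r * t * ((y i * kp - (al - y i) * y i * s + km) * (r - t * y i) - (h * (y i)\<^sup>2 - b)) = 0"
    using kp_eq km_eq moment_eq y_cube[of i] by algebra
  then show ?thesis using r0 t0 by (simp add: k_dv)
qed

lemma G_eq: "(y i)\<^sup>2 * (m i + h) - (E i + b) = dv i * (r - t * y i)"
proof -
  have "p + h = t * al" using al_eq h_eq by algebra
  moreover have "q + b = r * be" using be_eq b_eq by algebra
  moreover have "(y i)\<^sup>2 * (w / y i) = w * y i" using y_nonzero[of i] by (simp add: power2_eq_square)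
  moreover have "2 * r / y i = 2 * r * ((y i)\<^sup>2 - al * y i + be)"
    unfolding inverse_y_poly[of i, symmetric] by simp
  ultimately show ?thesis using y_cube[of i] unfolding m_def E_def spec_deriv_def by algebra
qed

text \<open>The numbers \<open>h\<close> and \<open>b\<close> came from the parameters; \<open>rho_sum\<close> and \<open>E_sum\<close> identify them with half
  the sums of \<open>\<rho>\<^sub>i\<close> and of \<open>\<rho>\<^sub>i D\<^sub>i\<close> that occur in the relation.\<close>

lemma rho_sum: "(\<Sum>i\<in>UNIV. rho i) = 2 * h"
proof -
  let ?S = "\<Sum>i\<in>UNIV. m i * (k i - 1)"
  have "?S = w * ((\<Sum>i\<in>UNIV. k i / y i) - (\<Sum>i\<in>UNIV. 1 / y i)) + (r + p) * ((\<Sum>i\<in>UNIV. k i) - 3) - 2 * t * ((\<Sum>i\<in>UNIV. k i * y i) - (\<Sum>i\<in>UNIV. y i))"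
    by (simp add: m_def sum_3 algebra_simps diff_divide_distrib)
  also have "(\<Sum>i\<in>UNIV. 1 / y i) = be" by (simp add: sum_3 inverse_y e2[symmetric])
  also have "(\<Sum>i\<in>UNIV. y i) = al" by (simp add: sum_3 e1)
  finally have S: "?S = w * (km - be) + (r + p) * (s - 3) - 2 * t * (kp - al)" unfolding k_moments .
  have "r * (?S - 4 * h) = 0"
    unfolding S using al_eq be_eq h_eq b_eq kp_eq km_eq p_eq by algebra
  then show ?thesis using r0 by (simp add: rho_def sum_divide_distrib[symmetric])
qed

lemma E_sum: "(\<Sum>i\<in>UNIV. E i * (k i - 1)) = 4 * b"
proof -
  let ?S = "\<Sum>i\<in>UNIV. E i * (k i - 1)"
  have "?S = w * ((\<Sum>i\<in>UNIV. k i * y i) - (\<Sum>i\<in>UNIV. y i)) + (t + q) * ((\<Sum>i\<in>UNIV. k i) - 3) - 2 * r * ((\<Sum>i\<in>UNIV. k i / y i) - (\<Sum>i\<in>UNIV. 1 / y i))"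
    by (simp add: E_def sum_3 algebra_simps diff_divide_distrib)
  also have "(\<Sum>i\<in>UNIV. 1 / y i) = be" by (simp add: sum_3 inverse_y e2[symmetric])
  also have "(\<Sum>i\<in>UNIV. y i) = al" by (simp add: sum_3 e1)
  finally have S: "?S = w * (kp - al) + (t + q) * (s - 3) - 2 * r * (km - be)" unfolding k_moments .
  have "t * (?S - 4 * b) = 0"
    unfolding S using al_eq be_eq h_eq b_eq kp_eq km_eq q_eq by algebra
  then show ?thesis using t0 by simp
qed

lemma off_diagonal: "i \<noteq> j \<Longrightarrow> y i * y j * (m i + m j + 2 * h) = E i + E j + 2 * b"
proof -
  assume ij: "i \<noteq> j"
  have 1: "p + h = t * (y 1 + y 2 + y 3)" using al_eq h_eq unfolding e1 by algebra
  have 2: "q + b = r * (y 1 * y 2 + y 1 * y 3 + y 2 * y 3)" using be_eq b_eq unfolding e2 by algebra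
  have m: "m l = w * (1 / y l) + (r + p) - 2 * t * y l" and E: "E l = w * y l + (t + q) - 2 * r * (1 / y l)" for l
    by (simp_all add: m_def E_def)
  have "y 1 * y 2 * (m 1 + m 2 + 2 * h) = E 1 + E 2 + 2 * b" "y 1 * y 3 * (m 1 + m 3 + 2 * h) = E 1 + E 3 + 2 * b"
    "y 2 * y 3 * (m 2 + m 3 + 2 * h) = E 2 + E 3 + 2 * b"
    unfolding m E inverse_y using 1 2 e3 by algebra+
  then show ?thesis using ij exhaust_3[of i] exhaust_3[of j] by (elim disjE) (simp_all add: ac_simps)
qed

lemma diagonal: "(y i)\<^sup>2 * (m i)\<^sup>2 + 2 * (y i)\<^sup>2 * rho i * (m i + h) = m i * E i + 2 * rho i * (E i + b)"
proof -
  have "2 * rho i = m i * (k i - 1)" by (simp add: rho_def)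
  then show ?thesis using k_eq[of i] G_eq[of i] by algebra
qed

end

text \<open>Elimination of the moments \<open>kp\<close>, \<open>km\<close>, \<open>k2\<close> of \<open>k\<close>; the proof displays the multipliers. The first two
  conclusions are equations for \<open>al t - h\<close> and \<open>be r - b\<close>, the third one relates \<open>al t + h\<close> and \<open>be r + b\<close>.\<close>

lemma relation_equations:
  fixes r t w s h b al be kp km k2 :: complex
  assumes 1: "r * s - t * kp = h" and 2: "b = t * s - r * km" and 3: "r * kp - t * k2 = al * h"
    and 4: "km = k2 - al * kp + be * s"
    and 5: "4 * h = w * (km - be) + (r + al * t - h) * (s - 3) - 2 * t * (kp - al)"
    and 6: "4 * b = w * (kp - al) + (r * be + t - b) * (s - 3) - 2 * r * (km - be)"
  shows "r * (s - 1) * (al * t - h) = (s + 3) * r\<^sup>2 - w * t * s + w * (be * r + b)" (is "?L1 = ?R1")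
    and "t * (s - 1) * (be * r - b) = (s + 3) * t\<^sup>2 - w * r * s + w * (al * t + h)" (is "?L2 = ?R2")
    and "(al * t + h) * (r\<^sup>2 * (1 + s) - w * t) - (be * r + b) * (t\<^sup>2 * (1 + s) - w * r) = (s - 3) * (r ^ 3 - t ^ 3)" (is "?L3 = ?R3")
proof -
  have "?L1 - ?R1 = r * ((w * (km - be) + (r + al * t - h) * (s - 3) - 2 * t * (kp - al)) - 4 * h) +
      w * ((t * s - r * km) - b) + 2 * r * (h - (r * s - t * kp))"
    by (simp add: algebra_simps power2_eq_square)
  also have "\<dots> = 0" unfolding 1 2[symmetric] 5[symmetric] by simp
  finally have E1: "?L1 - ?R1 = 0" .
  have "?L2 - ?R2 = t * ((w * (kp - al) + (r * be + t - b) * (s - 3) - 2 * r * (km - be)) - 4 * b) +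
      w * ((r * s - t * kp) - h) + 2 * t * (b - (t * s - r * km))"
    by (simp add: algebra_simps power2_eq_square)
  also have "\<dots> = 0" unfolding 1 2[symmetric] 6[symmetric] by simp
  finally have E2: "?L2 - ?R2 = 0" .
  have "s * (r ^ 3 - al * r\<^sup>2 * t + be * r * t\<^sup>2 - t ^ 3) - (h * r\<^sup>2 - b * t\<^sup>2) =
      r * t * ((r * kp - t * k2) - al * (r * s - t * kp)) + r\<^sup>2 * ((r * s - t * kp) - h) - t\<^sup>2 * ((t * s - r * km) - b) -
      r * t\<^sup>2 * (km - (k2 - al * kp + be * s))"
    by (simp add: algebra_simps power2_eq_square power3_eq_cube)
  also have "\<dots> = 0" unfolding 1 2[symmetric] 3 4[symmetric] by simp
  finally have X: "s * (r ^ 3 - al * r\<^sup>2 * t + be * r * t\<^sup>2 - t ^ 3) - (h * r\<^sup>2 - b * t\<^sup>2) = 0" .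
  have "?L3 - ?R3 = - 2 * (s * (r ^ 3 - al * r\<^sup>2 * t + be * r * t\<^sup>2 - t ^ 3) - (h * r\<^sup>2 - b * t\<^sup>2)) -
      (r * (?L1 - ?R1) - t * (?L2 - ?R2))"
    by (simp add: algebra_simps power2_eq_square power3_eq_cube)
  also have "\<dots> = 0" unfolding E1 E2 X by simp
  finally show "?L3 = ?R3" by simp
  show "?L1 = ?R1" "?L2 = ?R2" using E1 E2 by simp_all
qed

text \<open>The vectors \<open>(r, t)\<close> and \<open>(t\<^sup>2, r\<^sup>2)\<close> have determinant \<open>r\<^sup>3 - t\<^sup>3\<close>; the numbers \<open>la\<close> and \<open>nu\<close> are the
  coordinates of \<open>(P, Q)\<close> in this basis.\<close>

lemma solve_la_nu:
  fixes P Q r t la nu :: complex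
  assumes "la * (r ^ 3 - t ^ 3) = P * r\<^sup>2 - Q * t\<^sup>2" "nu * (r ^ 3 - t ^ 3) = Q * r - P * t" "r ^ 3 \<noteq> t ^ 3"
  shows "P = la * r + nu * t\<^sup>2" "Q = la * t + nu * r\<^sup>2"
    and "P * (r\<^sup>2 * (1 + s) - w * t) - Q * (t\<^sup>2 * (1 + s) - w * r) = (s - 3) * (r ^ 3 - t ^ 3) \<Longrightarrow>
      la * (1 + s) + nu * w = s - 3"
proof -
  have R: "r ^ 3 - t ^ 3 \<noteq> 0" using assms(3) by simp
  have "(la * r + nu * t\<^sup>2) * (r ^ 3 - t ^ 3) = la * (r ^ 3 - t ^ 3) * r + nu * (r ^ 3 - t ^ 3) * t\<^sup>2"
    "(la * t + nu * r\<^sup>2) * (r ^ 3 - t ^ 3) = la * (r ^ 3 - t ^ 3) * t + nu * (r ^ 3 - t ^ 3) * r\<^sup>2"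
    "(la * (1 + s) + nu * w) * (r ^ 3 - t ^ 3) = la * (r ^ 3 - t ^ 3) * (1 + s) + nu * (r ^ 3 - t ^ 3) * w"
    by (simp_all add: algebra_simps)
  note e = this[unfolded assms(1,2)]
  have "(la * r + nu * t\<^sup>2) * (r ^ 3 - t ^ 3) = P * (r ^ 3 - t ^ 3)"
    unfolding e by (simp add: algebra_simps power2_eq_square power3_eq_cube)
  then show "P = la * r + nu * t\<^sup>2" using R by simp
  have "(la * t + nu * r\<^sup>2) * (r ^ 3 - t ^ 3) = Q * (r ^ 3 - t ^ 3)"
    unfolding e by (simp add: algebra_simps power2_eq_square power3_eq_cube)
  then show "Q = la * t + nu * r\<^sup>2" using R by simp
  assume "P * (r\<^sup>2 * (1 + s) - w * t) - Q * (t\<^sup>2 * (1 + s) - w * r) = (s - 3) * (r ^ 3 - t ^ 3)"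
  then have "(la * (1 + s) + nu * w) * (r ^ 3 - t ^ 3) = (s - 3) * (r ^ 3 - t ^ 3)"
    unfolding e by (simp add: algebra_simps power2_eq_square)
  then show "la * (1 + s) + nu * w = s - 3" using R by simp
qed

text \<open>Conversely, from a solution of the relation in the eigenbasis the parameters are
  recovered by interpolation.\<close>

locale coords =
  fixes y :: "3 \<Rightarrow> complex" and al be :: complex and m rho :: "3 \<Rightarrow> complex"
begin

definition h where "h = (\<Sum>i\<in>UNIV. rho i) / 2"
definition n where "n i = m i + h"
definition w where "w = (\<Sum>i\<in>UNIV. n i / spec_deriv al be (y i))"
definition t where "t = - (\<Sum>i\<in>UNIV. n i * y i / spec_deriv al be (y i)) / 2"
definition r where "r = (\<Sum>i\<in>UNIV. n i * y i * (y i - al) / spec_deriv al be (y i)) - al * t"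
definition k where "k i = 1 + 2 * rho i / m i"
definition s where "s = (\<Sum>i\<in>UNIV. k i)"
definition b where "b = t * s - r * (\<Sum>i\<in>UNIV. k i / y i)"
definition la where "la = ((al * t + h) * r\<^sup>2 - (be * r + b) * t\<^sup>2) / (r ^ 3 - t ^ 3)"
definition nu where "nu = ((be * r + b) * r - (al * t + h) * t) / (r ^ 3 - t ^ 3)"

end

locale relation_solution = coords y al be m rho + eigenvalues y al be
  for y al be m rho +
  fixes D :: "3 \<Rightarrow> complex"
  assumes m0: "m i \<noteq> 0" and rho0: "rho i \<noteq> 0"
    and rel: "y i * y j * (\<Sum>l\<in>UNIV. ((if i = l then m i else 0) + rho l) * ((if l = j then m l else 0) + rho j)) =
      (\<Sum>l\<in>UNIV. ((if i = l then m i else 0) + rho l) * D l * ((if l = j then m l else 0) + rho j))"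
    and r0: "r \<noteq> 0" and t0: "t \<noteq> 0" and rt0: "r ^ 3 \<noteq> t ^ 3" and nu0: "nu \<noteq> 0" and la1: "la \<noteq> 1" and s1: "s \<noteq> 1"
begin

definition b' where "b' = (\<Sum>i\<in>UNIV. rho i * D i) / 2"
definition En where "En i = m i * D i + b'"

lemma off_diagonal: "i \<noteq> j \<Longrightarrow> y i * y j * (n i + n j) = En i + En j"
proof -
  assume "i \<noteq> j"
  then have "rho j * (y i * y j * (n i + n j) - (En i + En j)) = 0"
    using rel[of i j] unfolding square_entry twisted_square_entry n_def En_def h_def b'_def
    by (simp add: algebra_simps)
  then show ?thesis using rho0 by simp
qed

lemma diagonal: "k i * ((y i)\<^sup>2 * n i - En i) = h * (y i)\<^sup>2 - b'"
proof -
  have 1: "2 * rho i = m i * (k i - 1)" using m0[of i] by (simp add: k_def)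
  have "(y i)\<^sup>2 * (m i)\<^sup>2 + 2 * (y i)\<^sup>2 * rho i * n i = m i * (m i * D i) + 2 * rho i * En i"
    using rel[of i i] unfolding square_entry twisted_square_entry n_def En_def h_def b'_def
    by (simp add: algebra_simps power2_eq_square)
  then have "m i * (k i * ((y i)\<^sup>2 * n i - En i) - (h * (y i)\<^sup>2 - b')) = 0"
    using 1 unfolding n_def En_def by algebra
  then show ?thesis using m0 by simp
qed

lemma interpolation:
  "v i = (\<Sum>j\<in>UNIV. v j / (y j * dv j)) + (\<Sum>j\<in>UNIV. v j * (y j - al) / dv j) * y i + (\<Sum>j\<in>UNIV. v j / dv j) * (y i)\<^sup>2"
proof -
  define a where "a j = v j / dv j" for j
  have v: "v j = a j * dv j" for j using dv_nonzero by (simp add: a_def)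
  have 1: "v j / (y j * dv j) = a j * ((y j)\<^sup>2 - al * y j + be)" for j
    unfolding a_def inverse_y_poly[symmetric] by simp
  have 2: "v j * (y j - al) / dv j = a j * y j - al * a j" for j
    unfolding a_def by (simp add: algebra_simps diff_divide_distrib)
  have 3: "v j / dv j = a j" for j by (simp add: a_def)
  have "v i = (\<Sum>j\<in>UNIV. a j * (y j)\<^sup>2) - (al - y i) * (\<Sum>j\<in>UNIV. a j * y j) + (\<Sum>j\<in>UNIV. a j) * (1 / y i)"
    using lagrange[of a i] v[of i] by simp
  then show ?thesis unfolding 1 2 3 inverse_y_poly by (simp add: sum_3 algebra_simps)
qed

lemma n_eq: "n i * y i = w + (r + al * t) * y i - 2 * t * (y i)\<^sup>2"
proof -
  have "(\<Sum>j\<in>UNIV. n j * y j / (y j * dv j)) = w" using y_nonzero by (simp add: w_def)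
  moreover have "(\<Sum>j\<in>UNIV. n j * y j * (y j - al) / dv j) = r + al * t" by (simp add: r_def)
  moreover have "(\<Sum>j\<in>UNIV. n j * y j / dv j) = - 2 * t" by (simp add: t_def)
  ultimately show ?thesis using interpolation[of "\<lambda>j. n j * y j" i] by simp
qed

lemma n_eq': "n i = w * (1 / y i) + (r + al * t) - 2 * t * y i"
  using n_eq[of i] y_nonzero[of i] by (simp add: field_simps power2_eq_square)

text \<open>The three sums \<open>En i + En j\<close> with \<open>i \<noteq> j\<close> determine the three numbers \<open>En i\<close>.\<close>

lemma En_eq: "En i = w * y i + r * (be - 2 * (1 / y i)) + t"
proof -
  define f where "f i = w * y i + r * (be - 2 * (1 / y i)) + t" for i
  have identity: "a * b * (w * u + (r + A * t) - 2 * t * a + (w * v + (r + A * t) - 2 * t * b)) =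
      w * a + r * (B - 2 * u) + t + (w * b + r * (B - 2 * v) + t)"
    if "a * b * c = 1" "A = a + b + c" "B = a * b + a * c + b * c" "u = b * c" "v = a * c" for a b c A B u v
    unfolding that using that(1) by algebra
  have f12: "y 1 * y 2 * (n 1 + n 2) = f 1 + f 2" unfolding f_def n_eq' inverse_y
    by (rule identity[of "y 1" "y 2" "y 3"]) (use e1 e2 e3 in \<open>simp_all add: ac_simps\<close>)
  have f13: "y 1 * y 3 * (n 1 + n 3) = f 1 + f 3" unfolding f_def n_eq' inverse_y
    by (rule identity[of "y 1" "y 3" "y 2"]) (use e1 e2 e3 in \<open>simp_all add: ac_simps\<close>)
  have f23: "y 2 * y 3 * (n 2 + n 3) = f 2 + f 3" unfolding f_def n_eq' inverse_y
    by (rule identity[of "y 2" "y 3" "y 1"]) (use e1 e2 e3 in \<open>simp_all add: ac_simps\<close>)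
  have "En 1 + En 2 = f 1 + f 2" "En 1 + En 3 = f 1 + f 3" "En 2 + En 3 = f 2 + f 3"
    using off_diagonal[of 1 2] off_diagonal[of 1 3] off_diagonal[of 2 3] f12 f13 f23 by simp_all
  then have "2 * En 1 = 2 * f 1" "2 * En 2 = 2 * f 2" "2 * En 3 = 2 * f 3" by algebra+
  then have "En i = f i" using exhaust_3[of i] by auto
  then show ?thesis unfolding f_def .
qed

lemma k_eq: "k i * (r - t * y i) * dv i = h * (y i)\<^sup>2 - b'"
proof -
  have "(y i)\<^sup>2 * n i = y i * (n i * y i)" by (simp add: power2_eq_square)
  then have "(y i)\<^sup>2 * n i - En i = (r - t * y i) * dv i"
    unfolding n_eq En_eq inverse_y_poly spec_deriv_def using y_cube[of i] by algebra
  then show ?thesis using diagonal[of i] by (simp add: mult.assoc)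
qed

lemma k_moments:
  "r * s - t * (\<Sum>i\<in>UNIV. k i * y i) = h" "b = b'"
  "r * (\<Sum>i\<in>UNIV. k i * y i) - t * (\<Sum>i\<in>UNIV. k i * (y i)\<^sup>2) = al * h"
proof -
  define v where "v i = k i * (r - t * y i)" for i
  have "v i * dv i = (al * (al * h) - be * h - b') - (al - y i) * (al * h) + h / y i" for i
  proof -
    have "h / y i = h * ((y i)\<^sup>2 - al * y i + be)" unfolding inverse_y_poly[symmetric] by simp
    then show ?thesis using k_eq[of i] unfolding v_def by algebra
  qed
  from lagrange_converse(1,2)[OF this]
  show "r * s - t * (\<Sum>i\<in>UNIV. k i * y i) = h"
    "r * (\<Sum>i\<in>UNIV. k i * y i) - t * (\<Sum>i\<in>UNIV. k i * (y i)\<^sup>2) = al * h"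
    unfolding v_def s_def by (simp_all add: sum_3 algebra_simps power2_eq_square)
  have "(v i / y i) * dv i = al * h - (al - y i) * h + (- b') / y i" for i
  proof -
    have "(v i / y i) * dv i = (h * (y i)\<^sup>2 - b') / y i" using k_eq[of i] by (simp add: v_def)
    then show ?thesis using y_nonzero[of i] by (simp add: field_simps power2_eq_square)
  qed
  from lagrange_converse(1)[OF this]
  have "r * (\<Sum>i\<in>UNIV. k i / y i) - t * s = - b'"
    using y_nonzero unfolding v_def s_def by (simp add: sum_3 field_simps)
  then show "b = b'" unfolding b_def by algebra
qed

lemma equations:
  shows "r * (s - 1) * (al * t - h) = (s + 3) * r\<^sup>2 - w * t * s + w * (be * r + b)"
    "t * (s - 1) * (be * r - b) = (s + 3) * t\<^sup>2 - w * r * s + w * (al * t + h)"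
    "(al * t + h) * (r\<^sup>2 * (1 + s) - w * t) - (be * r + b) * (t\<^sup>2 * (1 + s) - w * r) = (s - 3) * (r ^ 3 - t ^ 3)"
proof -
  define kp where "kp = (\<Sum>i\<in>UNIV. k i * y i)"
  define km where "km = (\<Sum>i\<in>UNIV. k i / y i)"
  define k2 where "k2 = (\<Sum>i\<in>UNIV. k i * (y i)\<^sup>2)"
  have 1: "r * s - t * kp = h" and 3: "r * kp - t * k2 = al * h" using k_moments unfolding kp_def k2_def by simp_all
  have 2: "b = t * s - r * km" by (simp add: b_def km_def)
  have "k i * (1 / y i) = k i * (y i)\<^sup>2 - al * (k i * y i) + be * k i" for i
    unfolding inverse_y_poly by (simp add: algebra_simps)
  then have 4: "km = k2 - al * kp + be * s"
    unfolding km_def k2_def kp_def s_def by (simp add: sum_3 algebra_simps)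
  have sy: "(\<Sum>i\<in>UNIV. 1 / y i) = be" "(\<Sum>i\<in>UNIV. y i) = al"
    by (simp_all add: sum_3 inverse_y e2[symmetric] e1)
  have rk: "2 * rho i = m i * (k i - 1)" for i using m0[of i] by (simp add: k_def)
  have mi: "m i = w * (1 / y i) + (r + al * t - h) - 2 * t * y i" for i using n_eq'[of i] unfolding n_def by algebra
  have Ei: "m i * D i = w * y i + (r * be + t - b) - 2 * r * (1 / y i)" for i
    using En_eq[of i] unfolding En_def k_moments(2) by algebra
  have "4 * h = (\<Sum>i\<in>UNIV. m i * (k i - 1))" unfolding h_def rk[symmetric] by (simp add: sum_3)
  also have "\<dots> = (\<Sum>i\<in>UNIV. (w * (1 / y i) + (r + al * t - h) - 2 * t * y i) * (k i - 1))"
    by (rule sum.cong[OF HOL.refl], rule arg_cong2[where f = "(*)"], rule mi, rule HOL.refl)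
  also have "\<dots> = w * (km - (\<Sum>i\<in>UNIV. 1 / y i)) + (r + al * t - h) * (s - 3) - 2 * t * (kp - (\<Sum>i\<in>UNIV. y i))"
    by (subst affine_moment) (simp add: km_def s_def kp_def)
  finally have 5: "4 * h = w * (km - be) + (r + al * t - h) * (s - 3) - 2 * t * (kp - al)" unfolding sy .
  have "4 * b = (\<Sum>i\<in>UNIV. (2 * rho i) * D i)" unfolding k_moments(2) b'_def by (simp add: sum_3)
  also have "\<dots> = (\<Sum>i\<in>UNIV. (m i * D i) * (k i - 1))" unfolding rk by (simp add: sum_3 algebra_simps)
  also have "\<dots> = (\<Sum>i\<in>UNIV. (w * y i + (r * be + t - b) - 2 * r * (1 / y i)) * (k i - 1))"
    by (rule sum.cong[OF HOL.refl], rule arg_cong2[where f = "(*)"], rule Ei, rule HOL.refl)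
  also have "\<dots> = w * (kp - (\<Sum>i\<in>UNIV. y i)) + (r * be + t - b) * (s - 3) - 2 * r * (km - (\<Sum>i\<in>UNIV. 1 / y i))"
    by (subst affine_moment) (simp add: km_def s_def kp_def)
  finally have 6: "4 * b = w * (kp - al) + (r * be + t - b) * (s - 3) - 2 * r * (km - be)" unfolding sy .
  note eqs = relation_equations[OF 1 2 3 4 5 6]
  show "r * (s - 1) * (al * t - h) = (s + 3) * r\<^sup>2 - w * t * s + w * (be * r + b)" by (rule eqs(1))
  show "t * (s - 1) * (be * r - b) = (s + 3) * t\<^sup>2 - w * r * s + w * (al * t + h)" by (rule eqs(2))
  show "(al * t + h) * (r\<^sup>2 * (1 + s) - w * t) - (be * r + b) * (t\<^sup>2 * (1 + s) - w * r) = (s - 3) * (r ^ 3 - t ^ 3)" by (rule eqs(3))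
qed

lemma la_nu: "al * t + h = la * r + nu * t\<^sup>2" "be * r + b = la * t + nu * r\<^sup>2" "la * (1 + s) + nu * w = s - 3"
proof -
  have R: "r ^ 3 - t ^ 3 \<noteq> 0" using rt0 by simp
  have l: "la * (r ^ 3 - t ^ 3) = (al * t + h) * r\<^sup>2 - (be * r + b) * t\<^sup>2"
    and n: "nu * (r ^ 3 - t ^ 3) = (be * r + b) * r - (al * t + h) * t"
    using R by (simp_all add: la_def nu_def)
  show "al * t + h = la * r + nu * t\<^sup>2" "be * r + b = la * t + nu * r\<^sup>2" "la * (1 + s) + nu * w = s - 3"
    using solve_la_nu[OF l n rt0] equations(3) by blast+
qed

text \<open>The relation is homogeneous in \<open>m\<close> and \<open>\<rho>\<close>, and \<open>r, t, w, h, b\<close> scale with them while \<open>nu\<close> scales inversely.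
  Multiplication by \<open>nu\<close> therefore normalises \<open>nu\<close> to \<open>1\<close>.\<close>

lemma params_eqs:
  shows "params.s (nu * w) la = s" "params.P (nu * r) (nu * t) la = nu * (al * t + h)"
    "params.Q (nu * r) (nu * t) la = nu * (be * r + b)"
    "params.p (nu * r) (nu * t) (nu * w) la = nu * (al * t - h)" "params.q (nu * r) (nu * t) (nu * w) la = nu * (be * r - b)"
    "params.al (nu * r) (nu * t) (nu * w) la = al" "params.be (nu * r) (nu * t) (nu * w) la = be"
    "params.h (nu * r) (nu * t) (nu * w) la = nu * h" "params.b (nu * r) (nu * t) (nu * w) la = nu * b"
proof -
  have "s * (1 - la) = 3 + la + nu * w" using la_nu(3) by (simp add: algebra_simps)
  then show s: "params.s (nu * w) la = s" using la1 by (simp add: params.s_def field_simps)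
  show P: "params.P (nu * r) (nu * t) la = nu * (al * t + h)" unfolding params.P_def la_nu(1) by (simp add: algebra_simps power2_eq_square)
  show Q: "params.Q (nu * r) (nu * t) la = nu * (be * r + b)" unfolding params.Q_def la_nu(2) by (simp add: algebra_simps power2_eq_square)
  have "(s + 3) * (nu * r)\<^sup>2 - nu * w * (nu * t) * s + nu * w * (nu * (be * r + b)) = (nu * (al * t - h)) * (nu * r * (s - 1))"
    using arg_cong[OF equations(1), of "\<lambda>z. nu * nu * z"] by (simp add: algebra_simps power2_eq_square)
  then show p: "params.p (nu * r) (nu * t) (nu * w) la = nu * (al * t - h)"
    using nu0 r0 s1 unfolding params.p_def s Q by simp
  have "(s + 3) * (nu * t)\<^sup>2 - nu * w * (nu * r) * s + nu * w * (nu * (al * t + h)) = (nu * (be * r - b)) * (nu * t * (s - 1))"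
    using arg_cong[OF equations(2), of "\<lambda>z. nu * nu * z"] by (simp add: algebra_simps power2_eq_square)
  then show q: "params.q (nu * r) (nu * t) (nu * w) la = nu * (be * r - b)"
    using nu0 t0 s1 unfolding params.q_def s P by simp
  show "params.al (nu * r) (nu * t) (nu * w) la = al" "params.be (nu * r) (nu * t) (nu * w) la = be"
    "params.h (nu * r) (nu * t) (nu * w) la = nu * h" "params.b (nu * r) (nu * t) (nu * w) la = nu * b"
    unfolding params.al_def params.be_def params.h_def params.b_def P Q p q
    using nu0 r0 t0 by (simp_all add: field_simps)
qed

end

section \<open>Matrices of determinant one\<close>

lemma matrix_inv_eqI:
  fixes A B :: "complex^3^3"
  assumes "A ** B = mat 1" shows "matrix_inv A = B"
proof -
  have BA: "B ** A = mat 1" using assms matrix_left_right_inverse by blast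
  have "\<exists>A'. A ** A' = mat 1 \<and> A' ** A = mat 1" using assms BA by blast
  then have "matrix_inv A ** A = mat 1" unfolding matrix_inv_def by (metis (mono_tags, lifting) someI_ex)
  then have "matrix_inv A ** (A ** B) = B" by (simp add: matrix_mul_assoc)
  then show ?thesis by (simp add: assms)
qed

definition adjugate :: "complex^3^3 \<Rightarrow> complex^3^3" where
  "adjugate A = vector [
    vector [A$2$2 * A$3$3 - A$2$3 * A$3$2, A$1$3 * A$3$2 - A$1$2 * A$3$3, A$1$2 * A$2$3 - A$1$3 * A$2$2],
    vector [A$2$3 * A$3$1 - A$2$1 * A$3$3, A$1$1 * A$3$3 - A$1$3 * A$3$1, A$1$3 * A$2$1 - A$1$1 * A$2$3],
    vector [A$2$1 * A$3$2 - A$2$2 * A$3$1, A$1$2 * A$3$1 - A$1$1 * A$3$2, A$1$1 * A$2$2 - A$1$2 * A$2$1]]"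

lemma adjugate_right: "det A = 1 \<Longrightarrow> A ** adjugate A = mat 1"
  by (simp add: vec_eq_iff forall_3 adjugate_def matrix_matrix_mult_def sum_3 vector_3 mat_def det_3 algebra_simps)

lemma matrix_inv_adjugate: "det A = 1 \<Longrightarrow> matrix_inv A = adjugate A"
  by (rule matrix_inv_eqI[OF adjugate_right])

lemma matrix_inv_right: "det A = 1 \<Longrightarrow> A ** matrix_inv (A :: complex^3^3) = mat 1"
  by (simp add: matrix_inv_adjugate adjugate_right)

lemma matrix_inv_left: "det A = 1 \<Longrightarrow> matrix_inv (A :: complex^3^3) ** A = mat 1"
  using matrix_inv_right matrix_left_right_inverse by blast

lemma det_matrix_inv: "det A = 1 \<Longrightarrow> det (matrix_inv (A :: complex^3^3)) = 1"
  using arg_cong[OF matrix_inv_right, of A det] by (simp add: det_mul)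

lemma matrix_inv_twice: "det A = 1 \<Longrightarrow> matrix_inv (matrix_inv (A :: complex^3^3)) = A"
  by (rule matrix_inv_eqI[OF matrix_inv_left])

lemma trace_matrix_inv_minors:
  "det (A :: complex^3^3) = 1 \<Longrightarrow> trace (matrix_inv A) =
    (A$2$2 * A$3$3 - A$2$3 * A$3$2) + (A$1$1 * A$3$3 - A$1$3 * A$3$1) + (A$1$1 * A$2$2 - A$1$2 * A$2$1)"
  by (simp add: matrix_inv_adjugate trace_def sum_3 adjugate_def vector_3)

text \<open>Cube roots of scalars turn any invertible conjugating matrix into one of determinant one.\<close>

lemma conjugator_det_one:
  fixes B Y X :: "complex^3^3"
  assumes "det B \<noteq> 0" "B ** Y = Y' ** B" "B ** X = X' ** B"
  obtains A where "det A = 1" "Y' = A ** Y ** matrix_inv A" "X' = A ** X ** matrix_inv A"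
proof -
  define c where "c = inverse (det B) powr (1 / 3)"
  have "c ^ 3 = inverse (det B)" using assms(1) unfolding c_def by (simp add: powr_def exp_of_nat_mult[symmetric])
  then have c: "c ^ 3 * det B = 1" using assms(1) by simp
  define A where "A = (\<chi> i j. c * B $ i $ j)"
  have detA: "det A = 1" using c by (simp add: A_def det_3 power3_eq_cube algebra_simps)
  have "A ** M = (\<chi> i j. c * (B ** M) $ i $ j)" "M ** A = (\<chi> i j. c * (M ** B) $ i $ j)" for M
    by (simp_all add: A_def vec_eq_iff matrix_matrix_mult_def sum_3 algebra_simps)
  then have "A ** Y = Y' ** A" "A ** X = X' ** A" by (simp_all add: assms(2,3))
  then have "Y' = A ** Y ** matrix_inv A" "X' = A ** X ** matrix_inv A"
    using matrix_inv_right[OF detA] by (simp_all flip: matrix_mul_assoc)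
  then show thesis using that detA by blast
qed

section \<open>Evaluating words\<close>

definition letter :: "complex^3^3 \<Rightarrow> complex^3^3 \<Rightarrow> gen \<times> bool \<Rightarrow> complex^3^3" where
  "letter Y Z a = (let M = (case fst a of GenY \<Rightarrow> Y | GenZ \<Rightarrow> Z) in if snd a then M else matrix_inv M)"

definition word_value :: "complex^3^3 \<Rightarrow> complex^3^3 \<Rightarrow> gen word \<Rightarrow> complex^3^3" where
  "word_value Y Z u = foldr (\<lambda>a M. letter Y Z a ** M) u (mat 1)"

lemma word_value_simps [simp]:
  "word_value Y Z [] = mat 1" "word_value Y Z (a # u) = letter Y Z a ** word_value Y Z u"
  by (simp_all add: word_value_def)

lemma word_value_append: "word_value Y Z (u @ v) = word_value Y Z u ** word_value Y Z v"
  by (induction u) (simp_all add: matrix_mul_assoc)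

text \<open>The relation of the group says that the first matrix commutes with the product \<open>B\<close>.\<close>

definition whitehead_pair :: "complex^3^3 \<Rightarrow> complex^3^3 \<Rightarrow> bool" where
  "whitehead_pair Y Z \<longleftrightarrow> det Y = 1 \<and> det Z = 1 \<and>
    (let B = Z ** Y ** matrix_inv Z ** matrix_inv Z ** Y ** Z in Y ** B = B ** Y)"

lemma det_letter: "det Y = 1 \<Longrightarrow> det Z = 1 \<Longrightarrow> det (letter Y Z a) = 1"
  by (cases a; cases "fst a") (simp_all add: letter_def det_matrix_inv)

lemma det_word_value: "det Y = 1 \<Longrightarrow> det Z = 1 \<Longrightarrow> det (word_value Y Z u) = 1"
  by (induction u) (simp_all add: det_letter det_mul)

lemma letter_cancel: "det Y = 1 \<Longrightarrow> det Z = 1 \<Longrightarrow> letter Y Z (g, b) ** letter Y Z (g, \<not> b) = mat 1"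
  by (cases b; cases g) (simp_all add: letter_def matrix_inv_right matrix_inv_left)

lemma word_value_relator:
  "(r, s) \<in> whitehead_rel \<Longrightarrow> word_value Y Z r = word_value Y Z s \<longleftrightarrow>
    (let B = Z ** Y ** matrix_inv Z ** matrix_inv Z ** Y ** Z in Y ** B = B ** Y)"
  by (simp add: whitehead_rel_def letter_def matrix_mul_assoc)

lemma word_value_respects:
  assumes "whitehead_pair Y Z" "word_eq whitehead_rel u v"
  shows "word_value Y Z u = word_value Y Z v"
  using assms(2)
proof induction
  case (cancel u g b v)
  have "det Y = 1" "det Z = 1" using assms(1) by (simp_all add: whitehead_pair_def)
  then show ?case using letter_cancel[of Y Z g b] by (simp add: word_value_append matrix_mul_assoc)
next
  case (rel r s u v)
  then have "word_value Y Z r = word_value Y Z s"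
    using assms(1) word_value_relator[OF rel] by (simp add: whitehead_pair_def)
  then show ?case by (simp add: word_value_append)
qed simp_all

definition rep_of :: "complex^3^3 \<Rightarrow> complex^3^3 \<Rightarrow> gen word set \<Rightarrow> complex^3^3" where
  "rep_of Y Z c = word_value Y Z (SOME u. c = word_class whitehead_rel u)"

lemma rep_of_class:
  assumes "whitehead_pair Y Z" shows "rep_of Y Z (word_class whitehead_rel u) = word_value Y Z u"
proof -
  let ?v = "SOME v. word_class whitehead_rel u = word_class whitehead_rel v"
  have "word_class whitehead_rel u = word_class whitehead_rel ?v" by (rule someI) (rule HOL.refl)
  then have "word_eq whitehead_rel u ?v" by (simp add: word_class_eq_iff)
  then show ?thesis using word_value_respects[OF assms] by (simp add: rep_of_def)
qed

lemma carrier_whitehead: "carrier whitehead_group = range (word_class whitehead_rel)"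
  by (simp add: whitehead_group_def presented_group_def)

lemma mult_whitehead:
  "word_class whitehead_rel u \<otimes>\<^bsub>whitehead_group\<^esub> word_class whitehead_rel v = word_class whitehead_rel (u @ v)"
  by (simp add: whitehead_group_def presented_group_mult)

lemma rep_of_hom: "whitehead_pair Y Z \<Longrightarrow> rep_of Y Z \<in> hom whitehead_group SL3"
  by (auto simp: hom_def carrier_whitehead rep_of_class mult_whitehead word_value_append SL3_def
      whitehead_pair_def det_word_value)

lemma hom_word_value:
  assumes "\<rho> \<in> hom whitehead_group SL3"
  shows "\<rho> (word_class whitehead_rel u) = word_value (\<rho> gen_y) (\<rho> gen_z) u"
    and "whitehead_pair (\<rho> gen_y) (\<rho> gen_z)"
proof -
  let ?c = "word_class whitehead_rel" and ?Y = "\<rho> gen_y" and ?Z = "\<rho> gen_z"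
  have det: "det (\<rho> (?c u)) = 1" for u using assms by (auto simp: hom_def carrier_whitehead SL3_def)
  have mult: "\<rho> (?c (u @ v)) = \<rho> (?c u) ** \<rho> (?c v)" for u v
    using assms by (auto simp: hom_def carrier_whitehead SL3_def simp flip: mult_whitehead)
  have idem: "\<rho> (?c []) ** \<rho> (?c []) = \<rho> (?c [])" using mult[of "[]" "[]"] by simp
  have "matrix_inv (\<rho> (?c [])) ** (\<rho> (?c []) ** \<rho> (?c [])) = mat 1"
    unfolding idem by (rule matrix_inv_left[OF det])
  then have one: "\<rho> (?c []) = mat 1"
    unfolding matrix_mul_assoc matrix_inv_left[OF det] by simp
  have pos: "\<rho> (?c [(g, True)]) = letter ?Y ?Z (g, True)" for g
    by (cases g) (simp_all add: letter_def gen_y_def gen_z_def)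
  have neg: "\<rho> (?c [(g, False)]) = letter ?Y ?Z (g, False)" for g
  proof -
    have "word_eq whitehead_rel ([] @ [(g, True), (g, \<not> True)] @ []) ([] @ [])" by (rule word_eq.cancel)
    then have "?c [(g, True), (g, False)] = ?c []" by (simp add: word_class_eq_iff)
    then have "\<rho> (?c [(g, True)]) ** \<rho> (?c [(g, False)]) = mat 1"
      using mult[of "[(g, True)]" "[(g, False)]"] one by simp
    then have "matrix_inv (\<rho> (?c [(g, True)])) = \<rho> (?c [(g, False)])" by (rule matrix_inv_eqI)
    then show ?thesis unfolding pos by (simp add: letter_def)
  qed
  show val: "\<rho> (?c u) = word_value ?Y ?Z u" for u
  proof (induction u)
    case (Cons a u)
    have "\<rho> (?c [a]) = letter ?Y ?Z a" using pos neg by (cases a; cases "snd a") auto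
    then show ?case using mult[of "[a]" u] Cons by simp
  qed (simp add: one)
  have dYZ: "det ?Y = 1" "det ?Z = 1" using det by (simp_all add: gen_y_def gen_z_def)
  obtain r s where rs: "(r, s) \<in> whitehead_rel" by (auto simp: whitehead_rel_def)
  have "?c r = ?c s" using word_eq.rel[OF rs, of "[]" "[]"] by (simp add: word_class_eq_iff)
  then have "word_value ?Y ?Z r = word_value ?Y ?Z s" by (simp flip: val)
  then show "whitehead_pair ?Y ?Z" unfolding whitehead_pair_def using dYZ word_value_relator[OF rs] by blast
qed

lemma word_value_conj:
  assumes "det A = 1" "det Y = 1" "det Z = 1"
  shows "word_value (A ** Y ** matrix_inv A) (A ** Z ** matrix_inv A) u = A ** word_value Y Z u ** matrix_inv A"
proof -
  have c: "matrix_inv (A ** M ** matrix_inv A) = A ** matrix_inv M ** matrix_inv A" if "det M = 1" for M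
  proof (rule matrix_inv_eqI)
    have "A ** M ** matrix_inv A ** (A ** matrix_inv M ** matrix_inv A) =
        A ** (M ** ((matrix_inv A ** A) ** (matrix_inv M ** matrix_inv A)))" by (simp only: matrix_mul_assoc)
    also have "\<dots> = A ** ((M ** matrix_inv M) ** matrix_inv A)"
      unfolding matrix_inv_left[OF assms(1)] by (simp only: matrix_mul_lid matrix_mul_assoc)
    also have "\<dots> = mat 1" unfolding matrix_inv_right[OF that] by (simp add: matrix_inv_right assms)
    finally show "A ** M ** matrix_inv A ** (A ** matrix_inv M ** matrix_inv A) = mat 1" .
  qed
  have l: "letter (A ** Y ** matrix_inv A) (A ** Z ** matrix_inv A) a = A ** letter Y Z a ** matrix_inv A" for a
    using assms by (cases a; cases "fst a") (simp_all add: letter_def c)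
  show ?thesis
  proof (induction u)
    case (Cons a u)
    have "A ** letter Y Z a ** matrix_inv A ** (A ** word_value Y Z u ** matrix_inv A) =
        A ** letter Y Z a ** ((matrix_inv A ** A) ** word_value Y Z u) ** matrix_inv A" by (simp only: matrix_mul_assoc)
    then show ?case using Cons by (simp add: l matrix_inv_left[OF assms(1)] matrix_mul_assoc)
  qed (simp add: matrix_inv_right assms)
qed

section \<open>Characters\<close>

definition char_class :: "(gen word set \<Rightarrow> complex^3^3) \<Rightarrow> (gen word set \<Rightarrow> complex^3^3) set" where
  "char_class \<rho> = {\<sigma>. irreducible_rep whitehead_group \<sigma> \<and> (\<rho>, \<sigma>) \<in> conj_rel whitehead_group}"

lemma conj_rel_refl: "(\<rho>, \<rho>) \<in> conj_rel G"
proof -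
  have "matrix_inv (mat 1 :: complex^3^3) = mat 1" by (rule matrix_inv_eqI) simp
  then show ?thesis unfolding conj_rel_def by (auto intro!: exI[of _ "mat 1"])
qed

lemma conj_rel_sym: assumes "(\<rho>, \<sigma>) \<in> conj_rel G" shows "(\<sigma>, \<rho>) \<in> conj_rel G"
proof -
  obtain A where A: "det A = 1" "\<And>g. g \<in> carrier G \<Longrightarrow> \<sigma> g = A ** \<rho> g ** matrix_inv A"
    using assms unfolding conj_rel_def by blast
  have "\<rho> g = matrix_inv A ** \<sigma> g ** matrix_inv (matrix_inv A)" if "g \<in> carrier G" for g
  proof -
    have "matrix_inv A ** \<sigma> g ** A = (matrix_inv A ** A) ** \<rho> g ** (matrix_inv A ** A)"
      unfolding A(2)[OF that] by (simp only: matrix_mul_assoc)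
    then show ?thesis by (simp add: matrix_inv_left[OF A(1)] matrix_inv_twice[OF A(1)])
  qed
  then show ?thesis using det_matrix_inv[OF A(1)] unfolding conj_rel_def by blast
qed

lemma conj_rel_trans: assumes "(\<rho>, \<sigma>) \<in> conj_rel G" "(\<sigma>, \<tau>) \<in> conj_rel G" shows "(\<rho>, \<tau>) \<in> conj_rel G"
proof -
  obtain A where A: "det A = 1" "\<And>g. g \<in> carrier G \<Longrightarrow> \<sigma> g = A ** \<rho> g ** matrix_inv A"
    using assms unfolding conj_rel_def by blast
  obtain B where B: "det B = 1" "\<And>g. g \<in> carrier G \<Longrightarrow> \<tau> g = B ** \<sigma> g ** matrix_inv B"
    using assms unfolding conj_rel_def by blast
  have "matrix_inv (B ** A) = matrix_inv A ** matrix_inv B"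
  proof (rule matrix_inv_eqI)
    have "B ** A ** (matrix_inv A ** matrix_inv B) = B ** ((A ** matrix_inv A) ** matrix_inv B)" by (simp only: matrix_mul_assoc)
    then show "B ** A ** (matrix_inv A ** matrix_inv B) = mat 1" by (simp add: matrix_inv_right A B)
  qed
  then have "\<tau> g = (B ** A) ** \<rho> g ** matrix_inv (B ** A)" if "g \<in> carrier G" for g
    by (simp add: A(2)[OF that] B(2)[OF that] matrix_mul_assoc)
  moreover have "det (B ** A) = 1" using A B by (simp add: det_mul)
  ultimately show ?thesis unfolding conj_rel_def by blast
qed

lemma char_class_self: "irreducible_rep whitehead_group \<rho> \<Longrightarrow> \<rho> \<in> char_class \<rho>"
  by (simp add: char_class_def conj_rel_refl)

lemma char_class_eq: "(\<rho>, \<sigma>) \<in> conj_rel whitehead_group \<Longrightarrow> char_class \<rho> = char_class \<sigma>"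
  unfolding char_class_def using conj_rel_trans conj_rel_sym by blast

lemma irr_char_variety_eq:
  "irr_char_variety whitehead_group = char_class ` {\<rho>. irreducible_rep whitehead_group \<rho>}"
proof -
  have "(conj_rel whitehead_group \<inter> {\<rho>. irreducible_rep whitehead_group \<rho>} \<times> {\<rho>. irreducible_rep whitehead_group \<rho>}) `` {\<rho>} = char_class \<rho>"
    if "irreducible_rep whitehead_group \<rho>" for \<rho>
    using that unfolding char_class_def by auto
  then show ?thesis unfolding irr_char_variety_def quotient_def by auto
qed

lemma irr_char_rep:
  assumes "C \<in> irr_char_variety whitehead_group"
  obtains \<rho> where "irreducible_rep whitehead_group \<rho>" "\<rho> \<in> hom whitehead_group SL3" "C = char_class \<rho>"
  using assms unfolding irr_char_variety_eq irreducible_rep_def by blast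

abbreviation word_trace :: "gen word \<Rightarrow> (gen word set \<Rightarrow> complex^3^3) set \<Rightarrow> complex" where
  "word_trace u \<equiv> trace_fun (word_class whitehead_rel u)"

lemma word_trace_coord: "word_trace u \<in> trace_coords whitehead_group"
  unfolding trace_coords_def carrier_whitehead by blast

lemma word_trace_eq:
  assumes "irreducible_rep whitehead_group \<rho>"
  shows "word_trace u (char_class \<rho>) = trace (word_value (\<rho> gen_y) (\<rho> gen_z) u)"
proof -
  have "\<rho> \<in> hom whitehead_group SL3" using assms by (simp add: irreducible_rep_def)
  moreover have "word_trace u (char_class \<rho>) = trace (\<rho> (word_class whitehead_rel u))"
    by (rule trace_fun_eq[of _ whitehead_group])
      (use assms in \<open>auto simp: irr_char_variety_eq char_class_self carrier_whitehead\<close>)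
  ultimately show ?thesis using hom_word_value(1) by simp
qed

lemma commutator_whitehead:
  "commutator whitehead_group gen_y gen_z = word_class whitehead_rel [(GenY, True), (GenZ, True), (GenY, False), (GenZ, False)]"
  "commutator whitehead_group gen_z gen_y = word_class whitehead_rel [(GenZ, True), (GenY, True), (GenZ, False), (GenY, False)]"
proof -
  interpret group whitehead_group unfolding whitehead_group_def by (rule group_presented_group)
  have one: "\<one>\<^bsub>whitehead_group\<^esub> = word_class whitehead_rel []" by (simp add: whitehead_group_def presented_group_def)
  have inv: "inv\<^bsub>whitehead_group\<^esub> word_class whitehead_rel [(g, True)] = word_class whitehead_rel [(g, False)]" for g
  proof (rule inv_equality)
    have "word_eq whitehead_rel ([] @ [(g, False), (g, \<not> False)] @ []) ([] @ [])" by (rule word_eq.cancel)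
    then show "word_class whitehead_rel [(g, False)] \<otimes>\<^bsub>whitehead_group\<^esub> word_class whitehead_rel [(g, True)] = \<one>\<^bsub>whitehead_group\<^esub>"
      by (simp add: mult_whitehead one word_class_eq_iff)
  qed (auto simp: carrier_whitehead)
  show "commutator whitehead_group gen_y gen_z = word_class whitehead_rel [(GenY, True), (GenZ, True), (GenY, False), (GenZ, False)]"
    "commutator whitehead_group gen_z gen_y = word_class whitehead_rel [(GenZ, True), (GenY, True), (GenZ, False), (GenY, False)]"
    unfolding commutator_def gen_y_def gen_z_def inv mult_whitehead by simp_all
qed

lemma sym_slice_iff:
  "C \<in> sym_slice \<longleftrightarrow> C \<in> irr_char_variety whitehead_group \<and>
    word_trace [(GenY, True), (GenZ, True), (GenY, False), (GenZ, False)] C =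
    word_trace [(GenZ, True), (GenY, True), (GenZ, False), (GenY, False)] C"
  unfolding sym_slice_def commutator_whitehead by simp

section \<open>Pairs in normal form\<close>

definition diag_mat :: "(3 \<Rightarrow> complex) \<Rightarrow> complex^3^3" where
  "diag_mat d = (\<chi> i j. if i = j then d i else 0)"

definition diag_plus_rank_one :: "(3 \<Rightarrow> complex) \<Rightarrow> (3 \<Rightarrow> complex) \<Rightarrow> complex^3^3" where
  "diag_plus_rank_one m rho = (\<chi> i j. (if i = j then m i else 0) + rho j)"

lemma diag_mat_mult: "(diag_mat d ** M) $ i $ j = d i * M $ i $ j" "(M ** diag_mat d) $ i $ j = M $ i $ j * d j"
  using exhaust_3[of i] exhaust_3[of j] by (auto simp: diag_mat_def matrix_matrix_mult_def sum_3)

lemma det_diag_mat: "det (diag_mat d) = d 1 * d 2 * d 3"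
  by (simp add: det_3 diag_mat_def)

lemma det_diag_plus_rank_one:
  "det (diag_plus_rank_one m rho) = m 1 * m 2 * m 3 + rho 1 * m 2 * m 3 + rho 2 * m 1 * m 3 + rho 3 * m 1 * m 2"
  by (simp add: det_3 diag_plus_rank_one_def algebra_simps)

context eigenvalues
begin

lemma det_diag: "det (diag_mat y) = 1"
  by (simp add: det_diag_mat e3)

lemma inverse_diag: "matrix_inv (diag_mat y) = diag_mat (\<lambda>i. 1 / y i)"
  by (rule matrix_inv_eqI) (simp add: vec_eq_iff diag_mat_mult, simp add: diag_mat_def mat_def y_nonzero)

lemma y_inj: "y i = y j \<longleftrightarrow> i = j"
  using exhaust_3[of i] exhaust_3[of j] distinct by auto

lemma commutes_diag_iff: "diag_mat y ** B = B ** diag_mat y \<longleftrightarrow> (\<exists>D. B = diag_mat D)"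
proof
  assume "diag_mat y ** B = B ** diag_mat y"
  then have "y i * B $ i $ j = B $ i $ j * y j" for i j by (metis diag_mat_mult)
  then have "B $ i $ j = 0" if "i \<noteq> j" for i j using that y_inj[of i j] by (metis mult.commute mult_cancel_left)
  then have "B = diag_mat (\<lambda>i. B $ i $ i)" by (simp add: vec_eq_iff diag_mat_def)
  then show "\<exists>D. B = diag_mat D" by blast
qed (auto simp: vec_eq_iff diag_mat_mult, auto simp: diag_mat_def)

text \<open>A matrix commuting with \<open>diag_mat y\<close> is diagonal, and multiplying \<open>z y x\<^sup>2 y z = D\<close> by \<open>x\<close>, the inverse of
  \<open>z\<close>, on both sides leaves an equation without inverses.\<close>

lemma whitehead_pair_iff:
  assumes "det X = 1"
  shows "whitehead_pair (diag_mat y) (matrix_inv X) \<longleftrightarrow>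
    (\<exists>D. \<forall>i j. y i * y j * (\<Sum>l\<in>UNIV. X $ i $ l * X $ l $ j) = (\<Sum>l\<in>UNIV. X $ i $ l * D l * X $ l $ j))"
proof -
  let ?Y = "diag_mat y" and ?Z = "matrix_inv X"
  let ?B = "?Z ** ?Y ** X ** X ** ?Y ** ?Z"
  have e: "?B = diag_mat D \<longleftrightarrow> ?Y ** (X ** X) ** ?Y = X ** diag_mat D ** X" for D
  proof
    assume "?B = diag_mat D"
    then have "X ** diag_mat D ** X = X ** ?B ** X" by simp
    also have "\<dots> = (X ** ?Z) ** ?Y ** (X ** X) ** ?Y ** (?Z ** X)" by (simp only: matrix_mul_assoc)
    finally show "?Y ** (X ** X) ** ?Y = X ** diag_mat D ** X"
      by (simp add: matrix_inv_right[OF assms] matrix_inv_left[OF assms])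
  next
    assume a: "?Y ** (X ** X) ** ?Y = X ** diag_mat D ** X"
    have "?B = ?Z ** (?Y ** (X ** X) ** ?Y) ** ?Z" by (simp only: matrix_mul_assoc)
    also have "\<dots> = (?Z ** X) ** diag_mat D ** (X ** ?Z)" unfolding a by (simp only: matrix_mul_assoc)
    finally show "?B = diag_mat D" by (simp add: matrix_inv_right[OF assms] matrix_inv_left[OF assms])
  qed
  have "(?Y ** (X ** X) ** ?Y) $ i $ j = y i * y j * (\<Sum>l\<in>UNIV. X $ i $ l * X $ l $ j)" for i j
    by (simp add: diag_mat_mult) (simp add: matrix_matrix_mult_def)
  moreover have "(X ** diag_mat D ** X) $ i $ j = (\<Sum>l\<in>UNIV. X $ i $ l * D l * X $ l $ j)" for D i j
    by (subst matrix_matrix_mult_def) (simp add: diag_mat_mult)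
  ultimately have "?Y ** (X ** X) ** ?Y = X ** diag_mat D ** X \<longleftrightarrow>
      (\<forall>i j. y i * y j * (\<Sum>l\<in>UNIV. X $ i $ l * X $ l $ j) = (\<Sum>l\<in>UNIV. X $ i $ l * D l * X $ l $ j))" for D
    by (simp add: vec_eq_iff)
  then show ?thesis
    using det_diag assms det_matrix_inv[OF assms]
    by (simp add: whitehead_pair_def matrix_inv_twice commutes_diag_iff e)
qed

text \<open>A subspace that is invariant under a diagonal matrix with distinct entries is spanned by
  basis vectors, and the other matrix moves each of these to a vector without zero coordinates.\<close>

lemma invariant_subspace_trivial:
  assumes W: "vec.subspace W" and Y: "\<And>v. v \<in> W \<Longrightarrow> diag_mat y *v v \<in> W" and X: "\<And>v. v \<in> W \<Longrightarrow> X *v v \<in> W"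
    and off: "\<And>i j. i \<noteq> j \<Longrightarrow> X $ i $ j \<noteq> 0"
  shows "W = {0} \<or> W = UNIV"
proof (rule disjCI)
  assume "W \<noteq> UNIV"
  have scale: "v \<in> W \<Longrightarrow> c *s v \<in> W" and add: "u \<in> W \<Longrightarrow> v \<in> W \<Longrightarrow> u + v \<in> W" for c u v
    using W vec.subspace_scale vec.subspace_add by blast+
  have shift: "(diag_mat y *v v) + (- c) *s v \<in> W" if "v \<in> W" for v c
    using that by (intro add scale Y)
  have entry: "((diag_mat y *v v) + (- c) *s v) $ i = (y i - c) * v $ i" for v c i
    using exhaust_3[of i] by (auto simp: diag_mat_def matrix_vector_mult_def sum_3 algebra_simps)
  have axis: "axis i 1 \<in> W" if v: "v \<in> W" "v $ i \<noteq> 0" for v i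
  proof -
    define j :: 3 where "j = (if i = 1 then 2 else 1)"
    define k :: 3 where "k = (if i = 3 then 2 else 3)"
    have jk: "j \<noteq> i" "k \<noteq> i" "l = i \<or> l = j \<or> l = k" for l
      using exhaust_3[of i] exhaust_3[of l] by (auto simp: j_def k_def)
    define a where "a = (diag_mat y *v v) + (- y j) *s v"
    define b where "b = (diag_mat y *v a) + (- y k) *s a"
    have bW: "b \<in> W" unfolding b_def a_def by (intro shift v)
    have be: "b $ l = (y l - y k) * ((y l - y j) * v $ l)" for l unfolding b_def a_def entry ..
    have "\<And>l. l \<noteq> i \<Longrightarrow> b $ l = 0" subgoal for l using jk(3)[of l] be[of l] by auto done
    moreover have "b $ i \<noteq> 0" using be[of i] v(2) jk(1,2) y_inj[of i j] y_inj[of i k] by auto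
    ultimately have "axis i 1 = inverse (b $ i) *s b" by (auto simp: vec_eq_iff axis_def)
    then show ?thesis using scale[OF bW] by simp
  qed
  show "W = {0}"
  proof (rule ccontr)
    assume "W \<noteq> {0}"
    then obtain v where v: "v \<in> W" "v \<noteq> 0" using vec.subspace_0[OF W] by blast
    then obtain i where i: "v $ i \<noteq> 0" by (auto simp: vec_eq_iff)
    have ai: "axis i 1 \<in> W" using axis v i by blast
    have aj: "axis j 1 \<in> W" for j
    proof (cases "j = i")
      case False
      have "(X *v axis i 1) $ j = X $ j $ i"
        using exhaust_3[of i] by (auto simp: matrix_vector_mult_def sum_3 axis_def)
      then show ?thesis using axis[OF X[OF ai]] off[OF False] by simp
    qed (use ai in simp)
    have "u \<in> W" for u :: "complex^3"
    proof -
      have "u = u $ 1 *s axis 1 1 + (u $ 2 *s axis 2 1 + u $ 3 *s axis 3 1)"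
        by (simp add: vec_eq_iff forall_3 axis_def)
      moreover have "u $ 1 *s axis 1 1 + (u $ 2 *s axis 2 1 + u $ 3 *s axis 3 1) \<in> W"
        by (intro add scale aj)
      ultimately show ?thesis by (rule ssubst)
    qed
    then show False using \<open>W \<noteq> UNIV\<close> by blast
  qed
qed

lemma irreducible_rep_of:
  assumes "whitehead_pair (diag_mat y) (matrix_inv X)" "det X = 1" "\<And>i j. i \<noteq> j \<Longrightarrow> X $ i $ j \<noteq> 0"
  shows "irreducible_rep whitehead_group (rep_of (diag_mat y) (matrix_inv X))"
  unfolding irreducible_rep_def
proof (intro conjI allI impI)
  show "rep_of (diag_mat y) (matrix_inv X) \<in> hom whitehead_group SL3" by (rule rep_of_hom[OF assms(1)])
  fix W assume W: "vec.subspace W \<and> (\<forall>g\<in>carrier whitehead_group. \<forall>w\<in>W. rep_of (diag_mat y) (matrix_inv X) g *v w \<in> W)"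
  then have inv: "word_value (diag_mat y) (matrix_inv X) u *v v \<in> W" if "v \<in> W" for u v
  proof -
    have "rep_of (diag_mat y) (matrix_inv X) (word_class whitehead_rel u) *v v \<in> W"
      using W that by (auto simp: carrier_whitehead)
    then show ?thesis unfolding rep_of_class[OF assms(1)] .
  qed
  show "W = {0} \<or> W = UNIV"
  proof (rule invariant_subspace_trivial)
    show "diag_mat y *v v \<in> W" if "v \<in> W" for v using inv[OF that, of "[(GenY, True)]"] by (simp add: letter_def)
    show "X *v v \<in> W" if "v \<in> W" for v
      using inv[OF that, of "[(GenZ, False)]"] by (simp add: letter_def matrix_inv_twice[OF assms(2)])
  qed (use W assms(3) in auto)
qed

text \<open>Each \<open>y i\<close> is a root of the characteristic polynomial of \<open>Y\<close>, and eigenvectors for distinct eigenvalues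
  are independent.\<close>

lemma diagonalise:
  assumes "det Y = 1" "trace Y = al" "trace (matrix_inv Y) = be"
  obtains B where "det B \<noteq> 0" "B ** Y = diag_mat y ** B"
proof -
  have ev: "\<exists>v. v \<noteq> 0 \<and> Y *v v = y i *s v" for i
  proof -
    let ?M = "\<chi> a b. Y $ a $ b - (if a = b then y i else 0)"
    have "det ?M = - (y i * (y i)\<^sup>2 - al * (y i)\<^sup>2 + be * y i - det Y)"
      unfolding assms(2)[symmetric] assms(3)[unfolded trace_matrix_inv_minors[OF assms(1)], symmetric]
      by (simp add: det_3 trace_def sum_3 algebra_simps power2_eq_square)
    then have "det ?M = 0" using y_cube[of i] assms(1) by simp
    then have "\<not> invertible ?M" by (simp add: invertible_det_nz)
    then obtain v where v: "v \<noteq> 0" "?M *v v = 0"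
      unfolding invertible_left_inverse matrix_left_invertible_ker by blast
    have "(?M *v v) $ a = (Y *v v) $ a - y i * v $ a" for a
      using exhaust_3[of a] by (auto simp: matrix_vector_mult_def sum_3 algebra_simps)
    then have "Y *v v = y i *s v" using v(2) by (simp add: vec_eq_iff)
    then show ?thesis using v(1) by blast
  qed
  then obtain v where v: "\<And>i. v i \<noteq> 0" "\<And>i. Y *v v i = y i *s v i" by metis
  define V where "V = (\<chi> a i. v i $ a)"
  have YV: "Y ** V = V ** diag_mat y"
    using v(2) by (simp add: vec_eq_iff diag_mat_mult) (simp add: V_def matrix_matrix_mult_def matrix_vector_mult_def mult.commute)
  have "c = 0" if c: "V *v c = 0" for c
  proof -
    \<comment> \<open>the kernel of the matrix of eigenvectors is invariant under \<open>diag_mat y\<close>, so that interpolation isolates each coordinate\<close>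
    have pw: "V *v (\<chi> i. y i * d $ i) = 0" if "V *v d = 0" for d
    proof -
      have "(\<chi> i. y i * d $ i) = diag_mat y *v d"
        by (simp add: vec_eq_iff forall_3 diag_mat_def matrix_vector_mult_def sum_3)
      then have "V *v (\<chi> i. y i * d $ i) = Y *v (V *v d)" by (simp add: matrix_vector_mul_assoc YV)
      then show ?thesis using that by simp
    qed
    have 1: "V *v (\<chi> i. y i * c $ i) = 0" by (rule pw[OF c])
    have 2: "V *v (\<chi> i. y i * (\<chi> i. y i * c $ i) $ i) = 0" by (rule pw[OF 1])
    have "c $ i = 0" for i
    proof -
      obtain a where a: "v i $ a \<noteq> 0" using v(1)[of i] by (auto simp: vec_eq_iff)
      have "(\<Sum>j\<in>UNIV. (v j $ a * c $ j)) = 0" using c by (simp add: vec_eq_iff V_def matrix_vector_mult_def)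
      moreover have "(\<Sum>j\<in>UNIV. (v j $ a * c $ j) * y j) = 0"
        using 1 by (simp add: vec_eq_iff V_def matrix_vector_mult_def mult_ac)
      moreover have "(\<Sum>j\<in>UNIV. (v j $ a * c $ j) * (y j)\<^sup>2) = 0"
        using 2 by (simp add: vec_eq_iff V_def matrix_vector_mult_def mult_ac power2_eq_square)
      ultimately have "(v i $ a * c $ i) * dv i = 0" using lagrange[of "\<lambda>j. v j $ a * c $ j" i] by simp
      then show ?thesis using dv_nonzero a by simp
    qed
    then show ?thesis by (simp add: vec_eq_iff)
  qed
  then have "invertible V" unfolding invertible_left_inverse matrix_left_invertible_ker by blast
  then obtain B where B: "V ** B = mat 1" "B ** V = mat 1" unfolding invertible_def by blast
  have "det B \<noteq> 0" using arg_cong[OF B(1), of det] by (auto simp: det_mul)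
  moreover have "B ** Y = diag_mat y ** B"
  proof -
    have "B ** Y = B ** (Y ** V) ** B" using B by (simp flip: matrix_mul_assoc)
    also have "\<dots> = diag_mat y ** B" unfolding YV using B by (simp add: matrix_mul_assoc)
    finally show ?thesis .
  qed
  ultimately show thesis by (rule that)
qed

text \<open>The two traces of commutators differ by the product of a Vandermonde determinant and the
  difference of the two cyclic products of off-diagonal entries.\<close>

lemma commutator_traces:
  assumes "det X = 1"
    and "trace (word_value (diag_mat y) (matrix_inv X) [(GenY, True), (GenZ, True), (GenY, False), (GenZ, False)]) =
      trace (word_value (diag_mat y) (matrix_inv X) [(GenZ, True), (GenY, True), (GenZ, False), (GenY, False)])"
  shows "X$1$2 * X$2$3 * X$3$1 = X$1$3 * X$3$2 * X$2$1"
proof -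
  let ?A = "adjugate X"
  define d where "d = (\<lambda>i. 1 / y i)"
  have d: "d 1 = y 2 * y 3" "d 2 = y 1 * y 3" "d 3 = y 1 * y 2" unfolding d_def by (rule inverse_y)+
  have 1: "trace (diag_mat y ** ?A ** diag_mat d ** X) = trace (?A ** diag_mat y ** X ** diag_mat d)"
    using assms(2) unfolding d_def
    by (simp add: letter_def inverse_diag matrix_inv_twice[OF assms(1)] matrix_mul_assoc flip: matrix_inv_adjugate[OF assms(1)])
  have t1: "trace (diag_mat y ** ?A ** diag_mat d ** X) = (\<Sum>i\<in>UNIV. \<Sum>j\<in>UNIV. y i * ?A$i$j * d j * X$j$i)" for d
    by (simp add: trace_def matrix_matrix_mult_def[of _ X] diag_mat_mult)
  have t2: "trace (?A ** diag_mat y ** X ** diag_mat d) = (\<Sum>i\<in>UNIV. \<Sum>j\<in>UNIV. d i * ?A$i$j * y j * X$j$i)" for d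
    by (simp add: trace_def diag_mat_mult) (simp add: matrix_matrix_mult_def[of _ X] diag_mat_mult sum_3 algebra_simps)
  have "(X$1$3 * X$3$2 * X$2$1 - X$1$2 * X$2$3 * X$3$1) *
      ((y 1 * (y 1 * y 3) - y 2 * (y 2 * y 3)) + (y 2 * (y 1 * y 2) - y 3 * (y 1 * y 3)) + (y 3 * (y 2 * y 3) - y 1 * (y 1 * y 2))) = 0"
    using 1 unfolding t1 t2
    by (simp add: sum_3 d adjugate_def vector_3 algebra_simps)
  moreover have "(y 1 * (y 1 * y 3) - y 2 * (y 2 * y 3)) + (y 2 * (y 1 * y 2) - y 3 * (y 1 * y 3)) + (y 3 * (y 2 * y 3) - y 1 * (y 1 * y 2)) =
      (y 1 - y 2) * (y 2 - y 3) * (y 3 - y 1)"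
    by (simp add: algebra_simps)
  ultimately show ?thesis using distinct by auto
qed

end

text \<open>Diagonal conjugation makes the off-diagonal entries constant along columns.\<close>

lemma diagonal_scaling:
  fixes X :: "complex^3^3"
  defines "p \<equiv> X$1$2 * X$2$3 * X$3$1"
  assumes sym: "p = X$1$3 * X$3$2 * X$2$1" and p0: "p \<noteq> 0"
    and rho: "rho 1 = p / (X$2$3 * X$3$2)" "rho 2 = p / (X$1$3 * X$3$1)" "rho 3 = p / (X$1$2 * X$2$1)"
  obtains d where "\<And>i. d i \<noteq> 0"
    "diag_mat d ** X = diag_plus_rank_one (\<lambda>i. X$i$i - rho i) rho ** diag_mat d"
proof -
  have nz: "X$1$2 \<noteq> 0" "X$2$3 \<noteq> 0" "X$3$1 \<noteq> 0" "X$1$3 \<noteq> 0" "X$3$2 \<noteq> 0" "X$2$1 \<noteq> 0"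
    using p0 sym unfolding p_def by auto
  have r1: "rho 1 = X$1$3 * X$2$1 / X$2$3" using rho(1) nz unfolding sym by (simp add: field_simps)
  have r1': "rho 1 = X$1$2 * X$3$1 / X$3$2" using rho(1) nz unfolding p_def by (simp add: field_simps)
  have r2: "rho 2 = X$3$2 * X$2$1 / X$3$1" using rho(2) nz unfolding sym by (simp add: field_simps)
  have r2': "rho 2 = X$1$2 * X$2$3 / X$1$3" using rho(2) nz unfolding p_def by (simp add: field_simps)
  have r3: "rho 3 = X$1$3 * X$3$2 / X$1$2" using rho(3) nz unfolding sym by (simp add: field_simps)
  have r3': "rho 3 = X$2$3 * X$3$1 / X$2$1" using rho(3) nz unfolding p_def by (simp add: field_simps)
  \<comment> \<open>the first column of the conjugated matrix becomes constant; the other columns follow from the hypotheses\<close>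
  define d where "d i = (if i = 1 then 1 else if i = 2 then rho 1 / X$2$1 else rho 1 / X$3$1)" for i :: 3
  have d: "d 1 = 1" "d 2 = rho 1 / X$2$1" "d 3 = rho 1 / X$3$1" by (simp_all add: d_def)
  have rho1: "rho 1 \<noteq> 0" using r1 nz by simp
  have "d i \<noteq> 0" for i using exhaust_3[of i] d nz rho1 by auto
  moreover have "diag_mat d ** X = diag_plus_rank_one (\<lambda>i. X$i$i - rho i) rho ** diag_mat d"
  proof -
    have "d 1 * X$1$2 = rho 2 * d 2" unfolding d r1 r2' using nz by simp
    moreover have "d 1 * X$1$3 = rho 3 * d 3" unfolding d r1' r3 using nz by simp
    moreover have "d 2 * X$2$3 = rho 3 * d 3" unfolding d r3' using nz by simp
    moreover have "d 3 * X$3$2 = rho 2 * d 2" unfolding d r2 using nz by simp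
    moreover have "d 2 * X$2$1 = rho 1 * d 1" "d 3 * X$3$1 = rho 1 * d 1" unfolding d using nz by simp_all
    ultimately show ?thesis
      by (simp add: vec_eq_iff diag_mat_mult) (simp add: forall_3 diag_plus_rank_one_def)
  qed
  ultimately show thesis by (rule that)
qed

section \<open>From parameters to representations\<close>

text \<open>The discriminant of \<open>z\<^sup>3 - al z\<^sup>2 + be z - 1\<close>.\<close>

definition discriminant :: "complex \<Rightarrow> complex \<Rightarrow> complex" where
  "discriminant al be = al\<^sup>2 * be\<^sup>2 - 4 * al ^ 3 - 4 * be ^ 3 + 18 * al * be - 27"

text \<open>The roots of this cubic in an arbitrary order; the constructions below are symmetric in them.\<close>

definition spectrum :: "complex \<Rightarrow> complex \<Rightarrow> 3 \<Rightarrow> complex" where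
  "spectrum al be = (SOME y. y 1 + y 2 + y 3 = al \<and> y 1 * y 2 + y 1 * y 3 + y 2 * y 3 = be \<and> y 1 * y 2 * y 3 = 1)"

lemma spectrum_exists:
  "\<exists>y :: 3 \<Rightarrow> complex. y 1 + y 2 + y 3 = al \<and> y 1 * y 2 + y 1 * y 3 + y 2 * y 3 = be \<and> y 1 * y 2 * y 3 = 1"
proof -
  have "\<not> constant (poly [:-1, be, -al, 1:])" by (simp add: constant_degree)
  then obtain a where "poly [:-1, be, -al, 1:] a = 0" using fundamental_theorem_of_algebra by blast
  then have a: "a * (be - al * a + a\<^sup>2) = 1" by (simp add: algebra_simps power2_eq_square)
  then have a0: "a \<noteq> 0" by auto
  define d where "d = csqrt ((al - a)\<^sup>2 - 4 / a)"
  have d: "d * d = (al - a)\<^sup>2 - 4 / a" using power2_csqrt[of "(al - a)\<^sup>2 - 4 / a"] by (simp add: d_def power2_eq_square)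
  have bc: "((al - a + d) / 2) * ((al - a - d) / 2) = 1 / a"
  proof -
    have "((al - a + d) / 2) * ((al - a - d) / 2) = ((al - a)\<^sup>2 - d * d) / 4" by (simp add: field_simps power2_eq_square)
    also have "\<dots> = ((al - a)\<^sup>2 - ((al - a)\<^sup>2 - 4 / a)) / 4" by (simp only: d)
    finally show ?thesis by simp
  qed
  define y where "y i = (if i = 1 then a else if i = 2 then (al - a + d) / 2 else (al - a - d) / 2)" for i :: 3
  have y: "y 1 = a" "y 2 = (al - a + d) / 2" "y 3 = (al - a - d) / 2" by (simp_all add: y_def)
  have 1: "y 1 + y 2 + y 3 = al" by (simp add: y field_simps)
  have 23: "y 2 * y 3 = 1 / a" unfolding y by (rule bc)
  have "y 1 * y 2 + y 1 * y 3 + y 2 * y 3 = a * (al - a) + 1 / a"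
  proof -
    have "y 2 + y 3 = al - a" by (simp add: y field_simps)
    moreover have "y 1 * y 2 + y 1 * y 3 + y 2 * y 3 = y 1 * (y 2 + y 3) + y 2 * y 3" by (simp add: algebra_simps)
    ultimately show ?thesis unfolding 23 by (simp add: y(1))
  qed
  also have "1 / a = be - al * a + a\<^sup>2" using a a0 by (simp add: field_simps)
  finally have 2: "y 1 * y 2 + y 1 * y 3 + y 2 * y 3 = be" by (simp add: algebra_simps power2_eq_square)
  have "y 1 * (y 2 * y 3) = 1" unfolding 23 unfolding y(1) using a0 by simp
  then show ?thesis using 1 2 by (auto simp: mult.assoc intro!: exI[of _ y])
qed

lemma spectrum:
  "spectrum al be 1 + spectrum al be 2 + spectrum al be 3 = al"
  "spectrum al be 1 * spectrum al be 2 + spectrum al be 1 * spectrum al be 3 + spectrum al be 2 * spectrum al be 3 = be"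
  "spectrum al be 1 * spectrum al be 2 * spectrum al be 3 = 1"
  using someI_ex[OF spectrum_exists[of al be]] unfolding spectrum_def by blast+

lemma discriminant_vandermonde:
  assumes "a * b * c = 1"
  shows "discriminant (a + b + c) (a * b + a * c + b * c) = ((a - b) * (a - c) * (b - c))\<^sup>2"
proof -
  have "((a - b) * (a - c) * (b - c))\<^sup>2 = (a + b + c)\<^sup>2 * (a * b + a * c + b * c)\<^sup>2 - 4 * (a + b + c) ^ 3 * (a * b * c)
      - 4 * (a * b + a * c + b * c) ^ 3 + 18 * (a + b + c) * (a * b + a * c + b * c) * (a * b * c) - 27 * (a * b * c)\<^sup>2"
    by (simp add: algebra_simps power2_eq_square power3_eq_cube)
  then show ?thesis unfolding assms by (simp add: discriminant_def)
qed

lemma eigenvalues_spectrum: "discriminant al be \<noteq> 0 \<Longrightarrow> eigenvalues (spectrum al be) al be"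
  using discriminant_vandermonde[OF spectrum(3)[of al be]] spectrum[of al be] by unfold_locales auto

text \<open>The product of \<open>a + b z + c z\<^sup>2\<close> over the roots \<open>z\<close> of the same cubic.\<close>

definition cubic_norm :: "complex \<Rightarrow> complex \<Rightarrow> complex \<Rightarrow> complex \<Rightarrow> complex \<Rightarrow> complex" where
  "cubic_norm al be a b c = a ^ 3 + a\<^sup>2 * b * al + a\<^sup>2 * c * (al\<^sup>2 - 2 * be) + a * b\<^sup>2 * be + a * b * c * (al * be - 3)
    + a * c\<^sup>2 * (be\<^sup>2 - 2 * al) + b ^ 3 + b\<^sup>2 * c * al + b * c\<^sup>2 * be + c ^ 3"

context eigenvalues
begin

lemma cubic_norm:
  "(a + b * y 1 + c * (y 1)\<^sup>2) * (a + b * y 2 + c * (y 2)\<^sup>2) * (a + b * y 3 + c * (y 3)\<^sup>2) = cubic_norm al be a b c"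
proof -
  have "(a + b * x + c * x\<^sup>2) * (a + b * u + c * u\<^sup>2) * (a + b * v + c * v\<^sup>2) =
     a ^ 3 + a\<^sup>2 * b * (x + u + v) + a\<^sup>2 * c * ((x + u + v)\<^sup>2 - 2 * (x * u + x * v + u * v)) + a * b\<^sup>2 * (x * u + x * v + u * v)
     + a * b * c * ((x + u + v) * (x * u + x * v + u * v) - 3 * (x * u * v))
     + a * c\<^sup>2 * ((x * u + x * v + u * v)\<^sup>2 - 2 * (x + u + v) * (x * u * v)) + b ^ 3 * (x * u * v) + b\<^sup>2 * c * (x + u + v) * (x * u * v)
     + b * c\<^sup>2 * (x * u + x * v + u * v) * (x * u * v) + c ^ 3 * (x * u * v)\<^sup>2" for x u v
    by (simp add: algebra_simps power2_eq_square power3_eq_cube)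
  from this[of "y 1" "y 2" "y 3"] show ?thesis unfolding e1 e2 e3 by (simp add: cubic_norm_def)
qed

lemma eigenvalues_inverse: "eigenvalues (\<lambda>i. 1 / y i) be al"
proof
  show "1 / y 1 + 1 / y 2 + 1 / y 3 = be" unfolding inverse_y using e2 by (simp add: ac_simps)
  have "y 2 * y 3 * (y 1 * y 3) + y 2 * y 3 * (y 1 * y 2) + y 1 * y 3 * (y 1 * y 2) = (y 1 * y 2 * y 3) * (y 1 + y 2 + y 3)"
    by (simp add: algebra_simps)
  then show "1 / y 1 * (1 / y 2) + 1 / y 1 * (1 / y 3) + 1 / y 2 * (1 / y 3) = al" unfolding inverse_y e1 e3 by simp
  have "1 / y 1 * (1 / y 2) * (1 / y 3) = 1 / (y 1 * y 2 * y 3)" by simp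
  then show "1 / y 1 * (1 / y 2) * (1 / y 3) = 1" unfolding e3 by simp
qed (use distinct y_nonzero in \<open>auto simp: field_simps\<close>)

lemma spectral_sums:
  "(\<Sum>i\<in>UNIV. 1 / dv i) = 0" "(\<Sum>i\<in>UNIV. y i / dv i) = 0" "(\<Sum>i\<in>UNIV. (y i)\<^sup>2 / dv i) = 1"
proof -
  have 1: "(1 / dv i) * dv i = 1 - (al - y i) * 0 + 0 / y i" for i using dv_nonzero by simp
  from lagrange_converse[OF 1]
  show "(\<Sum>i\<in>UNIV. 1 / dv i) = 0" "(\<Sum>i\<in>UNIV. y i / dv i) = 0" "(\<Sum>i\<in>UNIV. (y i)\<^sup>2 / dv i) = 1" by simp_all
qed

end

context params
begin

text \<open>\<open>F\<close> is the determinant of the unscaled normal form (\<open>det_X\<close>), and \<open>K\<close> vanishes only if some \<open>k\<^sub>i = 1\<close>,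
  that is, if some off-diagonal column vanishes (\<open>k_product\<close>).\<close>

definition F where "F = cubic_norm al be w (r + p) (- 2 * t) * (s - 1) / 2"
definition K where "K = cubic_norm al be (km - be) (kp - al * s + 2 * al) (s - 3)"
definition good :: bool where
  "good \<longleftrightarrow> r \<noteq> 0 \<and> t \<noteq> 0 \<and> r ^ 3 \<noteq> t ^ 3 \<and> la \<noteq> 1 \<and> s \<noteq> 1 \<and> discriminant al be \<noteq> 0 \<and> F \<noteq> 0 \<and> K \<noteq> 0"

end

context normal_form
begin

lemma m_product: "m 1 * m 2 * m 3 = cubic_norm al be w (r + p) (- 2 * t)"
proof -
  have "m i * y i = w + (r + p) * y i + (- 2 * t) * (y i)\<^sup>2" for i
    using y_nonzero[of i] by (simp add: m_def field_simps power2_eq_square)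
  then have "(m 1 * y 1) * (m 2 * y 2) * (m 3 * y 3) = cubic_norm al be w (r + p) (- 2 * t)"
    by (simp only: cubic_norm)
  moreover have "(m 1 * y 1) * (m 2 * y 2) * (m 3 * y 3) = (m 1 * m 2 * m 3) * (y 1 * y 2 * y 3)" by (simp add: ac_simps)
  ultimately show ?thesis unfolding e3 by simp
qed

lemma E_product: "E 1 * E 2 * E 3 = cubic_norm be al w (t + q) (- 2 * r)"
proof -
  interpret inv: eigenvalues "\<lambda>i. 1 / y i" be al by (rule eigenvalues_inverse)
  have "E i * (1 / y i) = w + (t + q) * (1 / y i) + (- 2 * r) * (1 / y i)\<^sup>2" for i
    using y_nonzero[of i] by (simp add: E_def field_simps power2_eq_square)
  then have "(E 1 * (1 / y 1)) * (E 2 * (1 / y 2)) * (E 3 * (1 / y 3)) = cubic_norm be al w (t + q) (- 2 * r)"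
    by (simp only: inv.cubic_norm)
  moreover have "(E 1 * (1 / y 1)) * (E 2 * (1 / y 2)) * (E 3 * (1 / y 3)) = (E 1 * E 2 * E 3) / (y 1 * y 2 * y 3)" by simp
  ultimately show ?thesis unfolding e3 by simp
qed

lemma k_product: "(k 1 - 1) * (k 2 - 1) * (k 3 - 1) * (dv 1 * dv 2 * dv 3) = K"
proof -
  have "(k i - 1) * dv i = (km - be) + (kp - al * s + 2 * al) * y i + (s - 3) * (y i)\<^sup>2" for i
    using k_dv[of i] by (simp add: left_diff_distrib) (simp add: spec_deriv_def algebra_simps power2_eq_square)
  then have "((k 1 - 1) * dv 1) * ((k 2 - 1) * dv 2) * ((k 3 - 1) * dv 3) = K"
    by (simp only: cubic_norm K_def)
  then show ?thesis by (simp add: ac_simps)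
qed

lemma F_eq: "F = m 1 * m 2 * m 3 * (s - 1) / 2"
  by (simp add: F_def m_product)

end

locale good_params = params +
  fixes z :: complex
  assumes good: good and z: "z ^ 3 = F"
begin

sublocale normal_form r t w la "spectrum al be"
  unfolding normal_form_def normal_form_axioms_def using good eigenvalues_spectrum by (simp add: good_def)

abbreviation y where "y \<equiv> spectrum al be"

lemma z0: "z \<noteq> 0" using z good by (auto simp: good_def)

lemma m_nonzero: "m i \<noteq> 0"
proof -
  have "m 1 * m 2 * m 3 \<noteq> 0" using good F_eq by (auto simp: good_def)
  then show ?thesis using exhaust_3[of i] by auto
qed

lemma rho_nonzero: "rho i \<noteq> 0"
proof -
  have "(k 1 - 1) * (k 2 - 1) * (k 3 - 1) \<noteq> 0" using good k_product by (auto simp: good_def)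
  then have "k i - 1 \<noteq> 0" using exhaust_3[of i] by auto
  then show ?thesis using m_nonzero by (simp add: rho_def)
qed

definition X where "X = diag_plus_rank_one (\<lambda>i. m i / z) (\<lambda>i. rho i / z)"

lemma det_X: "det X = 1"
proof -
  have rho: "rho i = m i * (k i - 1) / 2" for i by (simp add: rho_def)
  have k3: "k 1 + k 2 + k 3 = s" using k_moments(2) by (simp add: sum_3)
  have "det X * z ^ 3 = m 1 * m 2 * m 3 + rho 1 * m 2 * m 3 + rho 2 * m 1 * m 3 + rho 3 * m 1 * m 2"
    using z0 by (simp add: X_def det_diag_plus_rank_one field_simps power3_eq_cube)
  also have "\<dots> = m 1 * m 2 * m 3 * ((k 1 + k 2 + k 3) - 1) / 2" unfolding rho by (simp add: field_simps)
  also have "\<dots> = F" unfolding k3 F_eq ..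
  finally show ?thesis using z good by (simp add: good_def)
qed

lemma X_relation:
  "y i * y j * (\<Sum>l\<in>UNIV. X $ i $ l * X $ l $ j) = (\<Sum>l\<in>UNIV. X $ i $ l * (E l / m l) * X $ l $ j)"
proof -
  have Xe: "X $ i $ j = ((if i = j then m i else 0) + rho j) / z" for i j
    by (simp add: X_def diag_plus_rank_one_def add_divide_distrib)
  have L: "(\<Sum>l\<in>UNIV. X $ i $ l * X $ l $ j) = ((if i = j then (m i)\<^sup>2 else 0) + rho j * (m i + m j + 2 * h)) / z\<^sup>2"
    unfolding rho_sum[symmetric] square_entry[symmetric] Xe
    by (simp add: sum_divide_distrib power2_eq_square)
  have "(\<Sum>l\<in>UNIV. rho l * (E l / m l)) = (\<Sum>l\<in>UNIV. E l * (k l - 1)) / 2"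
    using m_nonzero by (simp add: sum_divide_distrib rho_def mult.commute)
  then have b: "(\<Sum>l\<in>UNIV. rho l * (E l / m l)) = 2 * b" unfolding E_sum by simp
  have mE: "m l * (E l / m l) = E l" "(m l)\<^sup>2 * (E l / m l) = m l * E l" for l
    using m_nonzero[of l] by (simp_all add: power2_eq_square)
  have R: "(\<Sum>l\<in>UNIV. X $ i $ l * (E l / m l) * X $ l $ j) = ((if i = j then m i * E i else 0) + rho j * (E i + E j + 2 * b)) / z\<^sup>2"
  proof -
    have "(\<Sum>l\<in>UNIV. X $ i $ l * (E l / m l) * X $ l $ j) =
        (\<Sum>l\<in>UNIV. ((if i = l then m i else 0) + rho l) * (E l / m l) * ((if l = j then m l else 0) + rho j)) / z\<^sup>2"
      unfolding Xe sum_divide_distrib by (simp add: power2_eq_square mult_ac)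
    moreover have "(\<Sum>l\<in>UNIV. ((if i = l then m i else 0) + rho l) * (E l / m l) * ((if l = j then m l else 0) + rho j)) =
        (if i = j then m i * E i else 0) + rho j * (E i + E j + 2 * b)"
      using twisted_square_entry[of i m rho "\<lambda>l. E l / m l" j] unfolding b mE .
    ultimately show ?thesis by (simp only:)
  qed
  have "y i * y j * ((if i = j then (m i)\<^sup>2 else 0) + rho j * (m i + m j + 2 * h)) =
      (if i = j then m i * E i else 0) + rho j * (E i + E j + 2 * b)"
  proof (cases "i = j")
    case True
    then show ?thesis using diagonal[of i] by (simp add: algebra_simps power2_eq_square)
  next
    case False
    then show ?thesis using arg_cong[OF off_diagonal[OF False], of "\<lambda>z. rho j * z"] by (simp add: algebra_simps)
  qed
  then show ?thesis unfolding L R by simp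
qed

lemma X_pair: "whitehead_pair (diag_mat y) (matrix_inv X)"
  unfolding whitehead_pair_iff[OF det_X] using X_relation by (intro exI[of _ "\<lambda>l. E l / m l"]) simp

lemma X_off: "i \<noteq> j \<Longrightarrow> X $ i $ j \<noteq> 0"
  using rho_nonzero z0 by (simp add: X_def diag_plus_rank_one_def)

text \<open>Taking determinants in the relation shows that \<open>\<Prod>E\<^sub>i = \<Prod>m\<^sub>i\<close>; this makes \<open>F\<close>
  symmetric in \<open>r\<close> and \<open>t\<close>.\<close>

lemma F_swap: "params.F t r w la = F"
proof -
  have "diag_mat y ** (X ** X) ** diag_mat y = X ** diag_mat (\<lambda>l. E l / m l) ** X"
  proof -
    have "(diag_mat y ** (X ** X) ** diag_mat y) $ i $ j = y i * y j * (\<Sum>l\<in>UNIV. X $ i $ l * X $ l $ j)" for i j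
      by (simp add: diag_mat_mult) (simp add: matrix_matrix_mult_def)
    moreover have "(X ** diag_mat (\<lambda>l. E l / m l) ** X) $ i $ j = (\<Sum>l\<in>UNIV. X $ i $ l * (E l / m l) * X $ l $ j)" for i j
      by (subst matrix_matrix_mult_def) (simp add: diag_mat_mult)
    ultimately show ?thesis unfolding vec_eq_iff using X_relation by simp
  qed
  from arg_cong[OF this, of det] have "(E 1 / m 1) * (E 2 / m 2) * (E 3 / m 3) = 1"
    by (simp add: det_mul e3 det_X det_diag_mat m_nonzero)
  then have "E 1 * E 2 * E 3 = m 1 * m 2 * m 3" using m_nonzero by (simp add: field_simps)
  moreover have "params.P t r la = Q" "params.Q t r la = P"
    by (simp_all add: params.P_def Q_def params.Q_def P_def)
  moreover from this have "params.p t r w la = q" "params.q t r w la = p"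
    by (simp_all add: params.p_def q_def params.q_def p_def)
  moreover from calculation have "params.al t r w la = be" "params.be t r w la = al"
    by (simp_all add: params.al_def be_def params.be_def al_def)
  ultimately show ?thesis unfolding params.F_def using E_product m_product by simp
qed

text \<open>Interpolation applied to the normal form gives back its parameters, up to the scale \<open>z\<close>.\<close>

lemma coords_scaled:
  defines "m' \<equiv> \<lambda>i. m i / z" and "rho' \<equiv> \<lambda>i. rho i / z"
  shows "coords.r y al be m' rho' = r / z" "coords.t y al be m' rho' = t / z" "coords.w y al be m' rho' = w / z"
    "coords.s m' rho' = s" "coords.la y al be m' rho' = la" "coords.nu y al be m' rho' = z"
proof -
  have h': "coords.h rho' = h / z" using rho_sum by (simp add: coords.h_def rho'_def flip: sum_divide_distrib)
  have al2: "2 * (p + h) = 2 * (t * al)" using al_eq h_eq by (simp add: algebra_simps)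
  have ph: "p + h = t * al" using al2 by (simp only: mult_cancel_left) simp
  have n': "coords.n m' rho' i = (w / y i + (r + t * al) - 2 * t * y i) / z" for i
    unfolding coords.n_def h' ph[symmetric] by (simp add: m'_def m_def add_divide_distrib diff_divide_distrib)
  have yn: "coords.n m' rho' i * y i = (w + (r + t * al) * y i - 2 * t * (y i)\<^sup>2) / z" for i
    unfolding n' using y_nonzero[of i] z0 by (simp add: field_simps power2_eq_square)
  have S: "(\<Sum>i\<in>UNIV. y i / dv i) = 0" "(\<Sum>i\<in>UNIV. (y i)\<^sup>2 / dv i) = 1" "(\<Sum>i\<in>UNIV. 1 / dv i) = 0" by (rule spectral_sums)+
  have inv: "(\<Sum>i\<in>UNIV. (1 / y i) / dv i) = 1"
  proof -
    have "(\<Sum>i\<in>UNIV. (1 / y i) / dv i) = (\<Sum>i\<in>UNIV. (y i)\<^sup>2 / dv i) - al * (\<Sum>i\<in>UNIV. y i / dv i) + be * (\<Sum>i\<in>UNIV. 1 / dv i)"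
      unfolding inverse_y_poly by (simp add: sum_3 add_divide_distrib diff_divide_distrib algebra_simps)
    then show ?thesis unfolding S by simp
  qed
  have lin: "(\<Sum>i\<in>UNIV. (a * f i + b * g i - c * e i) / z / dv i) =
      (a * (\<Sum>i\<in>UNIV. f i / dv i) + b * (\<Sum>i\<in>UNIV. g i / dv i) - c * (\<Sum>i\<in>UNIV. e i / dv i)) / z" for a b c f g e
    by (simp add: sum_3 add_divide_distrib diff_divide_distrib algebra_simps)
  have w': "coords.w y al be m' rho' = w / z"
    using lin[of w "\<lambda>i. 1 / y i" "r + t * al" "\<lambda>i. 1" "2 * t" y] unfolding S inv
    by (simp add: coords.w_def n')
  have c1: "(\<Sum>i\<in>UNIV. coords.n m' rho' i * y i / dv i) = - 2 * (t / z)"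
    using lin[of w "\<lambda>i. 1" "r + t * al" y "2 * t" "\<lambda>i. (y i)\<^sup>2"] unfolding S by (simp add: yn)
  show t': "coords.t y al be m' rho' = t / z" unfolding coords.t_def c1 by simp
  have ynal: "coords.n m' rho' i * y i * (y i - al) = (w * (y i - al) + (r + t * al) * ((y i)\<^sup>2 - al * y i) - 2 * t * (1 - be * y i)) / z" for i
  proof -
    have "coords.n m' rho' i * y i * (y i - al) = (w * (y i - al) + (r + t * al) * ((y i)\<^sup>2 - al * y i) - 2 * t * (y i * (y i)\<^sup>2 - al * (y i)\<^sup>2)) / z"
      unfolding yn by (simp add: algebra_simps power2_eq_square)
    then show ?thesis unfolding y_cube by (simp add: algebra_simps)
  qed
  have "(\<Sum>i\<in>UNIV. coords.n m' rho' i * y i * (y i - al) / dv i) =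
     (w * ((\<Sum>i\<in>UNIV. y i / dv i) - al * (\<Sum>i\<in>UNIV. 1 / dv i)) + (r + t * al) * ((\<Sum>i\<in>UNIV. (y i)\<^sup>2 / dv i) - al * (\<Sum>i\<in>UNIV. y i / dv i))
       - 2 * t * ((\<Sum>i\<in>UNIV. 1 / dv i) - be * (\<Sum>i\<in>UNIV. y i / dv i))) / z"
    unfolding ynal by (simp add: sum_3 add_divide_distrib diff_divide_distrib algebra_simps)
  also have "\<dots> = (r + t * al) / z" unfolding S by simp
  finally show r': "coords.r y al be m' rho' = r / z" unfolding coords.r_def t' by (simp add: add_divide_distrib)
  have k': "coords.k m' rho' i = k i" for i
    using m_nonzero[of i] z0 by (simp add: coords.k_def m'_def rho'_def) (simp add: rho_def)
  show s': "coords.s m' rho' = s" using k_moments(2) by (simp add: coords.s_def k')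
  have b': "coords.b y al be m' rho' = b / z"
    unfolding coords.b_def k' k_moments(1) t' r' s' using km_eq by (simp add: diff_divide_distrib[symmetric] mult.commute)
  have P': "al * (t / z) + h / z = P / z" "be * (r / z) + b / z = Q / z"
  proof -
    have "al * t + h = P" using al_eq h_eq by algebra
    moreover have "be * r + b = Q" using be_eq b_eq by algebra
    ultimately show "al * (t / z) + h / z = P / z" "be * (r / z) + b / z = Q / z"
      by (simp_all flip: add_divide_distrib)
  qed
  have R: "r ^ 3 - t ^ 3 \<noteq> 0" using good by (simp add: good_def)
  have d: "(r / z) ^ 3 - (t / z) ^ 3 = (r ^ 3 - t ^ 3) / z ^ 3" by (simp add: power_divide diff_divide_distrib)
  have "P * r\<^sup>2 - Q * t\<^sup>2 = la * (r ^ 3 - t ^ 3)" "Q * r - P * t = r ^ 3 - t ^ 3"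
    by (simp_all add: P_def Q_def algebra_simps power2_eq_square power3_eq_cube)
  moreover have "P / z * (r / z)\<^sup>2 - Q / z * (t / z)\<^sup>2 = (P * r\<^sup>2 - Q * t\<^sup>2) / z ^ 3"
    "Q / z * (r / z) - P / z * (t / z) = (Q * r - P * t) / z\<^sup>2"
    by (simp_all add: power_divide diff_divide_distrib power2_eq_square power3_eq_cube mult_ac)
  ultimately show "coords.la y al be m' rho' = la" "coords.nu y al be m' rho' = z"
    unfolding coords.la_def coords.nu_def t' r' h' b' P' d using R z0
    by (simp_all add: power2_eq_square power3_eq_cube)
  show "coords.w y al be m' rho' = w / z" by (rule w')
qed

end

section \<open>From characters to parameters\<close>

lemma matrix_inv_conj:
  fixes A M :: "complex^3^3"
  assumes "det A = 1" "det M = 1"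
  shows "matrix_inv (A ** M ** matrix_inv A) = A ** matrix_inv M ** matrix_inv A"
  using word_value_conj[OF assms(1) assms(2) assms(2), of "[(GenY, False)]"] by (simp add: letter_def)

lemma whitehead_pair_iff_relator:
  assumes "(u, v) \<in> whitehead_rel"
  shows "whitehead_pair Y Z \<longleftrightarrow> det Y = 1 \<and> det Z = 1 \<and> word_value Y Z u = word_value Y Z v"
  using word_value_relator[OF assms] by (simp add: whitehead_pair_def)

lemma whitehead_pair_conj:
  assumes "det A = 1" "whitehead_pair Y Z"
  shows "whitehead_pair (A ** Y ** matrix_inv A) (A ** Z ** matrix_inv A)"
proof -
  obtain u v where uv: "(u, v) \<in> whitehead_rel" by (auto simp: whitehead_rel_def)
  show ?thesis using assms unfolding whitehead_pair_iff_relator[OF uv]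
    by (simp add: word_value_conj det_mul det_matrix_inv)
qed

lemma conj_rel_rep_of:
  assumes "det A = 1" "whitehead_pair Y Z"
  shows "(rep_of Y Z, rep_of (A ** Y ** matrix_inv A) (A ** Z ** matrix_inv A)) \<in> conj_rel whitehead_group"
  unfolding conj_rel_def
  using assms whitehead_pair_conj[OF assms]
  by (auto simp: carrier_whitehead rep_of_class word_value_conj whitehead_pair_def intro!: exI[of _ A])

lemma conj_rel_hom:
  assumes "\<rho> \<in> hom whitehead_group SL3"
  shows "(\<rho>, rep_of (\<rho> gen_y) (\<rho> gen_z)) \<in> conj_rel whitehead_group"
proof -
  have "matrix_inv (mat 1 :: complex^3^3) = mat 1" by (rule matrix_inv_eqI) simp
  then show ?thesis unfolding conj_rel_def
    by (auto simp: carrier_whitehead rep_of_class[OF hom_word_value(2)[OF assms]] hom_word_value(1)[OF assms] intro!: exI[of _ "mat 1"])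
qed

lemma trace_conj: "det A = 1 \<Longrightarrow> trace (A ** M ** matrix_inv (A :: complex^3^3)) = trace M"
proof -
  assume A: "det A = 1"
  have "trace (A ** M ** matrix_inv A) = trace (matrix_inv A ** (A ** M))" by (rule trace_mul_sym)
  then show ?thesis by (simp add: matrix_mul_assoc matrix_inv_left[OF A])
qed

type_synonym character = "(gen word set \<Rightarrow> complex^3^3) set"

definition char_al :: "character \<Rightarrow> complex" where "char_al = word_trace [(GenY, True)]"
definition char_be :: "character \<Rightarrow> complex" where "char_be = word_trace [(GenY, False)]"
definition char_y :: "character \<Rightarrow> 3 \<Rightarrow> complex" where "char_y C = spectrum (char_al C) (char_be C)"

text \<open>The diagonal entries of a matrix in the eigenbasis, from its traces against the powers of
  the diagonal matrix.\<close>

definition char_diag :: "gen word \<Rightarrow> character \<Rightarrow> 3 \<Rightarrow> complex" where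
  "char_diag u C i = (word_trace (u @ [(GenY, True), (GenY, True)]) C - (char_al C - char_y C i) * word_trace (u @ [(GenY, True)]) C
    + word_trace u C / char_y C i) / spec_deriv (char_al C) (char_be C) (char_y C i)"

abbreviation "xx \<equiv> [(GenZ, False), (GenZ, False)]"

text \<open>With \<open>y\<close> diagonal, \<open>(x\<^sup>2)\<^sub>i\<^sub>i - (x\<^sub>i\<^sub>i)\<^sup>2\<close> is the sum of the two products \<open>x\<^sub>i\<^sub>j x\<^sub>j\<^sub>i\<close>; half of the sum over all \<open>i\<close>,
  minus this one, is the product \<open>x\<^sub>j\<^sub>k x\<^sub>k\<^sub>j\<close> opposite to \<open>i\<close>.\<close>

definition char_off :: "character \<Rightarrow> 3 \<Rightarrow> complex" where
  "char_off C i = (\<Sum>j\<in>UNIV. char_diag xx C j - (char_diag [(GenZ, False)] C j)\<^sup>2) / 2 -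
    (char_diag xx C i - (char_diag [(GenZ, False)] C i)\<^sup>2)"

text \<open>On the slice, this is the common value of the two cyclic products of off-diagonal entries, read off
  from the expansion of \<open>det x = 1\<close>.\<close>

definition char_cycle :: "character \<Rightarrow> complex" where
  "char_cycle C = (1 - char_diag [(GenZ, False)] C 1 * char_diag [(GenZ, False)] C 2 * char_diag [(GenZ, False)] C 3
    + (\<Sum>i\<in>UNIV. char_diag [(GenZ, False)] C i * char_off C i)) / 2"

definition char_rho :: "character \<Rightarrow> 3 \<Rightarrow> complex" where "char_rho C i = char_cycle C / char_off C i"
definition char_m :: "character \<Rightarrow> 3 \<Rightarrow> complex" where "char_m C i = char_diag [(GenZ, False)] C i - char_rho C i"

context eigenvalues
begin

lemma char_of_diagonal_pair:
  assumes tr: "\<And>u. word_trace u C = trace (word_value (diag_mat y) (matrix_inv X) u)" and X: "det X = 1"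
    and y: "y = spectrum al be"
  shows "char_al C = al" "char_be C = be" "char_y C = y" "char_diag [(GenZ, False)] C i = X $ i $ i"
    "char_off C 1 = X$2$3 * X$3$2" "char_off C 2 = X$1$3 * X$3$1" "char_off C 3 = X$1$2 * X$2$1"
    "2 * char_cycle C = X$1$2 * X$2$3 * X$3$1 + X$1$3 * X$3$2 * X$2$1"
proof -
  show al: "char_al C = al" unfolding char_al_def tr by (simp add: letter_def trace_def diag_mat_def sum_3 e1)
  show be: "char_be C = be" unfolding char_be_def tr
    by (simp add: letter_def inverse_diag) (simp add: trace_def diag_mat_def sum_3 inverse_y e2[symmetric])
  show yy: "char_y C = y" by (simp add: char_y_def al be y)
  have diag: "char_diag u C i = word_value (diag_mat y) (matrix_inv X) u $ i $ i" for u i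
  proof -
    let ?M = "word_value (diag_mat y) (matrix_inv X) u"
    have "word_trace u C = (\<Sum>j\<in>UNIV. ?M $ j $ j)" "word_trace (u @ [(GenY, True)]) C = (\<Sum>j\<in>UNIV. ?M $ j $ j * y j)"
      "word_trace (u @ [(GenY, True), (GenY, True)]) C = (\<Sum>j\<in>UNIV. ?M $ j $ j * (y j)\<^sup>2)"
      unfolding tr by (simp_all add: word_value_append letter_def trace_def diag_mat_mult matrix_mul_assoc power2_eq_square mult_ac)
    then show ?thesis using lagrange[of "\<lambda>j. ?M $ j $ j" i] dv_nonzero[of i]
      by (simp add: char_diag_def al be yy field_simps)
  qed
  have inv: "matrix_inv (matrix_inv X) = X" by (rule matrix_inv_twice[OF X])
  show d: "char_diag [(GenZ, False)] C i = X $ i $ i" for i unfolding diag by (simp add: letter_def inv)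
  have dd: "char_diag xx C i = (\<Sum>l\<in>UNIV. X $ i $ l * X $ l $ i)" for i
    unfolding diag by (simp add: letter_def inv) (simp add: matrix_matrix_mult_def)
  show off: "char_off C 1 = X$2$3 * X$3$2" "char_off C 2 = X$1$3 * X$3$1" "char_off C 3 = X$1$2 * X$2$1"
    unfolding char_off_def d dd by (simp_all add: sum_3 power2_eq_square field_simps)
  show "2 * char_cycle C = X$1$2 * X$2$3 * X$3$1 + X$1$3 * X$3$2 * X$2$1"
  proof -
    have "2 * char_cycle C = det X - X$1$1 * X$2$2 * X$3$3 +
        (X$1$1 * (X$2$3 * X$3$2) + X$2$2 * (X$1$3 * X$3$1) + X$3$3 * (X$1$2 * X$2$1))"
      unfolding char_cycle_def d by (simp add: sum_3 off X)
    then show ?thesis by (simp add: det_3 algebra_simps)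
  qed
qed

end

text \<open>Diagonalise the image of \<open>y\<close> and then rescale the basis by \<open>diagonal_scaling\<close>, which applies because the
  two cyclic products agree on the slice. The resulting entries are the functions \<open>char_m\<close> and
  \<open>char_rho\<close>, as these are computed from traces in the eigenbasis.\<close>

lemma character_normal_form:
  assumes C: "C \<in> sym_slice" and disc: "discriminant (char_al C) (char_be C) \<noteq> 0"
    and cycle: "char_cycle C \<noteq> 0"
  defines "X \<equiv> diag_plus_rank_one (char_m C) (char_rho C)"
  shows "det X = 1" "whitehead_pair (diag_mat (char_y C)) (matrix_inv X)"
    "C = char_class (rep_of (diag_mat (char_y C)) (matrix_inv X))" "char_rho C i \<noteq> 0"
proof -
  obtain \<rho> where \<rho>: "irreducible_rep whitehead_group \<rho>" "\<rho> \<in> hom whitehead_group SL3" "C = char_class \<rho>"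
    using C irr_char_rep unfolding sym_slice_iff by blast
  have pair: "whitehead_pair (\<rho> gen_y) (\<rho> gen_z)" by (rule hom_word_value(2)[OF \<rho>(2)])
  then have dets: "det (\<rho> gen_y) = 1" "det (\<rho> gen_z) = 1" by (simp_all add: whitehead_pair_def)
  have tr0: "word_trace u C = trace (word_value (\<rho> gen_y) (\<rho> gen_z) u)" for u unfolding \<rho>(3) by (rule word_trace_eq[OF \<rho>(1)])
  let ?y = "char_y C"
  interpret eigenvalues ?y "char_al C" "char_be C" unfolding char_y_def by (rule eigenvalues_spectrum[OF disc])
  have "trace (\<rho> gen_y) = char_al C" "trace (matrix_inv (\<rho> gen_y)) = char_be C"
    unfolding char_al_def char_be_def tr0 by (simp_all add: letter_def)
  then obtain B where B: "det B \<noteq> 0" "B ** \<rho> gen_y = diag_mat ?y ** B" using diagonalise[OF dets(1)] by blast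
  obtain A where A: "det A = 1" "diag_mat ?y = A ** \<rho> gen_y ** matrix_inv A" using conjugator_det_one[OF B B(2)] by blast
  define Z1 where "Z1 = A ** \<rho> gen_z ** matrix_inv A"
  define X1 where "X1 = matrix_inv Z1"
  have dZ1: "det Z1 = 1" unfolding Z1_def using A(1) dets by (simp add: det_mul det_matrix_inv)
  have dX1: "det X1 = 1" unfolding X1_def by (rule det_matrix_inv[OF dZ1])
  have Z1: "matrix_inv X1 = Z1" unfolding X1_def by (rule matrix_inv_twice[OF dZ1])
  have pair1: "whitehead_pair (diag_mat ?y) (matrix_inv X1)"
    using whitehead_pair_conj[OF A(1) pair] unfolding Z1 Z1_def A(2) .
  have tr: "word_trace u C = trace (word_value (diag_mat ?y) (matrix_inv X1) u)" for u
    unfolding tr0 Z1 Z1_def A(2) word_value_conj[OF A(1) dets] trace_conj[OF A(1)] ..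
  note ch = char_of_diagonal_pair[OF tr dX1 char_y_def]
  have sym: "X1$1$2 * X1$2$3 * X1$3$1 = X1$1$3 * X1$3$2 * X1$2$1"
    using C commutator_traces[OF dX1] unfolding sym_slice_iff tr by blast
  then have p: "char_cycle C = X1$1$2 * X1$2$3 * X1$3$1" using ch(8) by simp
  have rho: "char_rho C 1 = X1$1$2 * X1$2$3 * X1$3$1 / (X1$2$3 * X1$3$2)"
    "char_rho C 2 = X1$1$2 * X1$2$3 * X1$3$1 / (X1$1$3 * X1$3$1)"
    "char_rho C 3 = X1$1$2 * X1$2$3 * X1$3$1 / (X1$1$2 * X1$2$1)"
    by (simp_all only: char_rho_def p ch)
  have p0: "X1$1$2 * X1$2$3 * X1$3$1 \<noteq> 0" using cycle p by simp
  have "char_rho C 1 \<noteq> 0 \<and> char_rho C 2 \<noteq> 0 \<and> char_rho C 3 \<noteq> 0" unfolding rho using p0 sym by auto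
  then show "char_rho C i \<noteq> 0" using exhaust_3[of i] by auto
  have m: "char_m C = (\<lambda>i. X1$i$i - char_rho C i)" by (simp add: fun_eq_iff char_m_def ch(4))
  obtain d where d: "\<And>i. d i \<noteq> 0" "diag_mat d ** X1 = X ** diag_mat d"
    using diagonal_scaling[OF sym p0 rho] unfolding X_def m by blast
  have "det (diag_mat d) \<noteq> 0" using d(1) by (simp add: det_diag_mat)
  moreover have "diag_mat d ** diag_mat ?y = diag_mat ?y ** diag_mat d"
    by (simp add: vec_eq_iff diag_mat_mult) (simp add: diag_mat_def)
  ultimately obtain A2 where A2: "det A2 = 1" "diag_mat ?y = A2 ** diag_mat ?y ** matrix_inv A2" "X = A2 ** X1 ** matrix_inv A2"
    using conjugator_det_one d(2) by metis
  show dX: "det X = 1" unfolding A2(3) using A2(1) dX1 by (simp add: det_mul det_matrix_inv)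
  have Z2: "matrix_inv X = A2 ** matrix_inv X1 ** matrix_inv A2" unfolding A2(3) by (rule matrix_inv_conj[OF A2(1) dX1])
  have "(\<rho>, rep_of (\<rho> gen_y) (\<rho> gen_z)) \<in> conj_rel whitehead_group" by (rule conj_rel_hom[OF \<rho>(2)])
  moreover have "(rep_of (\<rho> gen_y) (\<rho> gen_z), rep_of (diag_mat ?y) (matrix_inv X1)) \<in> conj_rel whitehead_group"
    using conj_rel_rep_of[OF A(1) pair] unfolding Z1 Z1_def A(2)[symmetric] .
  moreover have "(rep_of (diag_mat ?y) (matrix_inv X1), rep_of (diag_mat ?y) (matrix_inv X)) \<in> conj_rel whitehead_group"
    using conj_rel_rep_of[OF A2(1) pair1] unfolding Z2 A2(2)[symmetric] .
  ultimately show "C = char_class (rep_of (diag_mat ?y) (matrix_inv X))"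
    unfolding \<rho>(3) using conj_rel_trans char_class_eq by blast
  show "whitehead_pair (diag_mat ?y) (matrix_inv X)"
    using whitehead_pair_conj[OF A2(1) pair1] unfolding Z2 A2(2)[symmetric] .
qed

definition char_r where "char_r C = coords.r (char_y C) (char_al C) (char_be C) (char_m C) (char_rho C)"
definition char_t where "char_t C = coords.t (char_y C) (char_al C) (char_be C) (char_m C) (char_rho C)"
definition char_w where "char_w C = coords.w (char_y C) (char_al C) (char_be C) (char_m C) (char_rho C)"
definition char_s where "char_s C = coords.s (char_m C) (char_rho C)"
definition char_la where "char_la C = coords.la (char_y C) (char_al C) (char_be C) (char_m C) (char_rho C)"
definition char_nu where "char_nu C = coords.nu (char_y C) (char_al C) (char_be C) (char_m C) (char_rho C)"

text \<open>The open conditions under which the normal form exists and can be solved for the parameters.\<close>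

definition generic_character :: "character \<Rightarrow> bool" where
  "generic_character C \<longleftrightarrow> C \<in> sym_slice \<and> discriminant (char_al C) (char_be C) \<noteq> 0 \<and> char_cycle C \<noteq> 0 \<and>
    (\<forall>i. char_off C i \<noteq> 0) \<and> (\<forall>i. char_m C i \<noteq> 0) \<and> char_r C \<noteq> 0 \<and> char_t C \<noteq> 0 \<and> char_r C ^ 3 \<noteq> char_t C ^ 3 \<and>
    char_nu C \<noteq> 0 \<and> char_la C \<noteq> 1 \<and> char_s C \<noteq> 1"

lemma generic_character_params:
  assumes "generic_character C"
  defines "R \<equiv> char_nu C * char_r C" and "T \<equiv> char_nu C * char_t C" and "W \<equiv> char_nu C * char_w C" and "L \<equiv> char_la C"
  shows "params.al R T W L = char_al C" "params.be R T W L = char_be C" "char_nu C ^ 3 = params.F R T W L"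
    and "normal_form R T W L (char_y C)"
    and "normal_form.m R T W L (char_y C) i = char_nu C * char_m C i"
    and "normal_form.rho R T W L (char_y C) i = char_nu C * char_rho C i"
proof -
  note g = assms(1)[unfolded generic_character_def]
  let ?m = "char_m C" and ?rho = "char_rho C" and ?y = "char_y C" and ?al = "char_al C" and ?be = "char_be C" and ?nu = "char_nu C"
  let ?X = "diag_plus_rank_one ?m ?rho"
  have dX: "det ?X = 1" and pair: "whitehead_pair (diag_mat ?y) (matrix_inv ?X)" and rho0: "\<And>i. ?rho i \<noteq> 0"
    using character_normal_form[of C] g by blast+
  interpret eigenvalues ?y ?al ?be unfolding char_y_def using g eigenvalues_spectrum by blast
  obtain D where D: "\<And>i j. ?y i * ?y j * (\<Sum>l\<in>UNIV. ?X $ i $ l * ?X $ l $ j) = (\<Sum>l\<in>UNIV. ?X $ i $ l * D l * ?X $ l $ j)"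
    using pair unfolding whitehead_pair_iff[OF dX] by blast
  interpret relation_solution ?y ?al ?be ?m ?rho D
  proof
    show "?y i * ?y j * (\<Sum>l\<in>UNIV. ((if i = l then ?m i else 0) + ?rho l) * ((if l = j then ?m l else 0) + ?rho j)) =
      (\<Sum>l\<in>UNIV. ((if i = l then ?m i else 0) + ?rho l) * D l * ((if l = j then ?m l else 0) + ?rho j))" for i j
      using D[of i j] by (simp add: diag_plus_rank_one_def)
  qed (use g rho0 in \<open>auto simp: char_r_def char_t_def char_nu_def char_la_def char_s_def\<close>)
  note P = params_eqs[folded char_r_def char_t_def char_w_def char_nu_def char_la_def char_s_def,
      folded R_def T_def W_def L_def]
  show al: "params.al R T W L = ?al" and be: "params.be R T W L = ?be" by (rule P)+
  have r0: "R \<noteq> 0" and t0: "T \<noteq> 0" and la1: "L \<noteq> 1" and s1: "params.s W L \<noteq> 1"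
    unfolding P(1) unfolding R_def T_def L_def using g by auto
  show nf: "normal_form R T W L ?y"
    unfolding normal_form_def normal_form_axioms_def al be using eigenvalues_axioms r0 t0 la1 s1 by blast
  interpret nf: normal_form R T W L ?y by (rule nf)
  have nu0: "?nu \<noteq> 0" using g by blast
  have mi: "char_m C i = char_w C * (1 / ?y i) + (char_r C + ?al * char_t C - coords.h ?rho) - 2 * char_t C * ?y i" for i
    using n_eq'[of i, folded char_r_def char_t_def char_w_def] by (simp add: coords.n_def algebra_simps)
  show m: "nf.m i = ?nu * ?m i" for i
    unfolding nf.m_def P(4) mi unfolding R_def T_def W_def by (simp add: algebra_simps)
  have kp: "nf.kp = (\<Sum>i\<in>UNIV. coords.k ?m ?rho i * ?y i)"
  proof -
    have "char_t C * (\<Sum>i\<in>UNIV. coords.k ?m ?rho i * ?y i) = char_r C * char_s C - coords.h ?rho"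
      using k_moments(1)[folded char_r_def char_t_def char_s_def] by (simp add: algebra_simps)
    then have "T * (\<Sum>i\<in>UNIV. coords.k ?m ?rho i * ?y i) = R * char_s C - ?nu * coords.h ?rho"
      unfolding T_def R_def by (simp add: mult.assoc flip: right_diff_distrib)
    then show ?thesis using t0 unfolding nf.kp_def P(1) P(8) by (simp add: field_simps)
  qed
  have km: "nf.km = (\<Sum>i\<in>UNIV. coords.k ?m ?rho i / ?y i)"
  proof -
    have "char_r C * (\<Sum>i\<in>UNIV. coords.k ?m ?rho i / ?y i) = char_t C * char_s C - coords.b ?y ?al ?be ?m ?rho"
      unfolding coords.b_def char_r_def char_t_def char_s_def by simp
    then have "R * (\<Sum>i\<in>UNIV. coords.k ?m ?rho i / ?y i) = T * char_s C - ?nu * coords.b ?y ?al ?be ?m ?rho"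
      unfolding T_def R_def by (simp add: mult.assoc flip: right_diff_distrib)
    then show ?thesis using r0 unfolding nf.km_def P(1) P(9) by (simp add: field_simps)
  qed
  have k: "nf.k i = coords.k ?m ?rho i" for i
  proof -
    have "(coords.k ?m ?rho i / ?y i) * dv i = nf.kp - (?al - ?y i) * char_s C + nf.km / ?y i"
      using lagrange[of "\<lambda>i. coords.k ?m ?rho i / ?y i" i] y_nonzero
      unfolding kp km char_s_def coords.s_def by (simp add: power2_eq_square)
    then have "coords.k ?m ?rho i * dv i = ?y i * nf.kp - (?al - ?y i) * ?y i * char_s C + nf.km"
      using y_nonzero[of i] by (simp add: field_simps)
    then show ?thesis unfolding nf.k_def al be P(1) using dv_nonzero[of i] by (simp add: field_simps)
  qed
  show "nf.rho i = ?nu * ?rho i" for i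
    using m0[of i] by (simp add: nf.rho_def m k coords.k_def)
  have S: "?rho 1 / ?m 1 + ?rho 2 / ?m 2 + ?rho 3 / ?m 3 = (char_s C - 3) / 2"
    unfolding char_s_def coords.s_def by (simp add: sum_3 coords.k_def add_divide_distrib)
  have "det ?X = ?m 1 * ?m 2 * ?m 3 * (1 + (?rho 1 / ?m 1 + ?rho 2 / ?m 2 + ?rho 3 / ?m 3))"
    using m0[of 1] m0[of 2] m0[of 3] by (simp add: det_diag_plus_rank_one field_simps)
  then have "?m 1 * ?m 2 * ?m 3 * (char_s C - 1) / 2 = 1" unfolding S dX by (simp add: field_simps)
  then show "?nu ^ 3 = nf.F"
    unfolding nf.F_eq m P(1) by (simp add: power3_eq_cube field_simps)
qed

section \<open>The two families of coordinates determine each other rationally\<close>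

lemma (in cubic_spectrum) spec_fun_deriv: "spec_fun (\<lambda>x i. spec_deriv (al x) (be x) (y x i))"
  by (rule spec_funI[of be "\<lambda>x. - 2 * al x" "\<lambda>_. 3"])
    (auto intro!: frac_intros al be simp: spec_deriv_def)

lemma exhaust_5: fixes x :: 5 shows "x = 1 \<or> x = 2 \<or> x = 3 \<or> x = 4 \<or> x = 5"
proof (induct x)
  case (of_int z)
  then have "z = 0 \<or> z = 1 \<or> z = 2 \<or> z = 3 \<or> z = 4" by fastforce
  then show ?case by auto
qed

definition vec5 :: "complex \<Rightarrow> complex \<Rightarrow> complex \<Rightarrow> complex \<Rightarrow> complex \<Rightarrow> complex^5" where
  "vec5 a b c d e = (\<chi> i. if i = 1 then a else if i = 2 then b else if i = 3 then c else if i = 4 then d else e)"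

lemma vec5_nth [simp]:
  "vec5 a b c d e $ 1 = a" "vec5 a b c d e $ 2 = b" "vec5 a b c d e $ 3 = c" "vec5 a b c d e $ 4 = d" "vec5 a b c d e $ 5 = e"
  by (simp_all add: vec5_def)

lemma vec5_eqI:
  assumes "u $ 1 = v $ 1" "u $ 2 = v $ 2" "u $ 3 = v $ 3" "u $ 4 = v $ 4" "u $ 5 = (v :: complex^5) $ 5"
  shows "u = v"
proof (unfold vec_eq_iff, rule allI)
  show "u $ i = v $ i" for i using exhaust_5[of i] assms by auto
qed

lemma vec5_collapse [simp]: "vec5 (u $ 1) (u $ 2) (u $ 3) (u $ 4) (u $ 5) = u"
  by (rule vec5_eqI) simp_all

abbreviation "A5 \<equiv> (affine_coords :: (complex^5 \<Rightarrow> complex) set)"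
abbreviation "TC \<equiv> trace_coords whitehead_group"

lemma A5_coord: "(\<lambda>u. u $ i) \<in> A5" by (auto simp: affine_coords_def)
lemma A5_cases: "g \<in> A5 \<Longrightarrow> \<exists>i. g = (\<lambda>u. u $ i)" by (auto simp: affine_coords_def)
lemma A5_nonempty: "A5 \<noteq> {}" by (auto simp: affine_coords_def)
lemma TC_nonempty: "TC \<noteq> {}" using word_trace_coord by blast
lemma frac_nth: "frac A5 Z (\<lambda>u. u $ i)" by (rule frac_coord[OF A5_coord])

definition good5 :: "complex^5 \<Rightarrow> bool" where "good5 u = params.good (u $ 1) (u $ 2) (u $ 3) (u $ 4)"
definition F5 :: "complex^5 \<Rightarrow> complex" where "F5 u = params.F (u $ 1) (u $ 2) (u $ 3) (u $ 4)"
definition al5 :: "complex^5 \<Rightarrow> complex" where "al5 u = params.al (u $ 1) (u $ 2) (u $ 3) (u $ 4)"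
definition be5 :: "complex^5 \<Rightarrow> complex" where "be5 u = params.be (u $ 1) (u $ 2) (u $ 3) (u $ 4)"

lemma frac_params:
  fixes Z :: "(complex^5) set"
  assumes Z: "\<And>u. u \<in> Z \<Longrightarrow> u $ 1 \<noteq> 0" "\<And>u. u \<in> Z \<Longrightarrow> u $ 2 \<noteq> 0" "\<And>u. u \<in> Z \<Longrightarrow> u $ 4 \<noteq> 1"
    "\<And>u. u \<in> Z \<Longrightarrow> params.s (u $ 3) (u $ 4) \<noteq> 1"
  shows "frac A5 Z (\<lambda>u. params.s (u $ 3) (u $ 4))" "frac A5 Z (\<lambda>u. params.p (u $ 1) (u $ 2) (u $ 3) (u $ 4))"
    "frac A5 Z al5" "frac A5 Z be5" "frac A5 Z F5"
    "frac A5 Z (\<lambda>u. params.kp (u $ 1) (u $ 2) (u $ 3) (u $ 4))" "frac A5 Z (\<lambda>u. params.km (u $ 1) (u $ 2) (u $ 3) (u $ 4))"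
    "frac A5 Z (\<lambda>u. params.K (u $ 1) (u $ 2) (u $ 3) (u $ 4))"
proof -
  show s: "frac A5 Z (\<lambda>u. params.s (u $ 3) (u $ 4))"
    unfolding params.s_def by (intro frac_intros frac_nth) (use Z in auto)
  have P: "frac A5 Z (\<lambda>u. params.P (u $ 1) (u $ 2) (u $ 4))" "frac A5 Z (\<lambda>u. params.Q (u $ 1) (u $ 2) (u $ 4))"
    unfolding params.P_def params.Q_def by (intro frac_intros frac_nth)+
  show p: "frac A5 Z (\<lambda>u. params.p (u $ 1) (u $ 2) (u $ 3) (u $ 4))"
    unfolding params.p_def by (intro frac_intros frac_nth s P) (use Z in auto)
  have q: "frac A5 Z (\<lambda>u. params.q (u $ 1) (u $ 2) (u $ 3) (u $ 4))"
    unfolding params.q_def by (intro frac_intros frac_nth s P) (use Z in auto)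
  show al: "frac A5 Z al5" unfolding al5_def params.al_def by (intro frac_intros frac_nth p P) (use Z in auto)
  show be: "frac A5 Z be5" unfolding be5_def params.be_def by (intro frac_intros frac_nth q P) (use Z in auto)
  show kp: "frac A5 Z (\<lambda>u. params.kp (u $ 1) (u $ 2) (u $ 3) (u $ 4))"
    unfolding params.kp_def params.h_def by (intro frac_intros frac_nth s p P) (use Z in auto)
  show km: "frac A5 Z (\<lambda>u. params.km (u $ 1) (u $ 2) (u $ 3) (u $ 4))"
    unfolding params.km_def params.b_def by (intro frac_intros frac_nth s q P) (use Z in auto)
  show "frac A5 Z F5" unfolding F5_def params.F_def cubic_norm_def
    by (intro frac_intros frac_nth s p al[unfolded al5_def] be[unfolded be5_def]) auto
  show "frac A5 Z (\<lambda>u. params.K (u $ 1) (u $ 2) (u $ 3) (u $ 4))" unfolding params.K_def cubic_norm_def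
    by (intro frac_intros frac_nth s kp km al[unfolded al5_def] be[unfolded be5_def])
qed

lemma frac_on_good:
  assumes "\<And>u. u \<in> Z \<Longrightarrow> good5 u"
  shows "frac A5 Z al5" "frac A5 Z be5" "frac A5 Z F5" "frac A5 Z (\<lambda>u. params.s (u $ 3) (u $ 4))"
    "frac A5 Z (\<lambda>u. params.p (u $ 1) (u $ 2) (u $ 3) (u $ 4))"
    "frac A5 Z (\<lambda>u. params.kp (u $ 1) (u $ 2) (u $ 3) (u $ 4))" "frac A5 Z (\<lambda>u. params.km (u $ 1) (u $ 2) (u $ 3) (u $ 4))"
  using assms by (auto intro!: frac_params simp: good5_def params.good_def)

lemma principal_open_good: "principal_open A5 UNIV {u. good5 u}"
proof -
  define Z1 where "Z1 = {u \<in> (UNIV :: (complex^5) set). u $ 1 * u $ 2 * (u $ 1 ^ 3 - u $ 2 ^ 3) * (u $ 4 - 1) \<noteq> 0}"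
  have 1: "principal_open A5 UNIV Z1" unfolding Z1_def
    by (rule principal_open_step[OF principal_open_refl]) (intro frac_intros frac_nth)
  define Z2 where "Z2 = {u \<in> Z1. params.s (u $ 3) (u $ 4) - 1 \<noteq> 0}"
  have 2: "principal_open A5 UNIV Z2" unfolding Z2_def
    by (rule principal_open_step[OF 1], unfold params.s_def, intro frac_intros frac_nth) (auto simp: Z1_def)
  have Z: "u \<in> Z2 \<Longrightarrow> u $ 1 \<noteq> 0" "u \<in> Z2 \<Longrightarrow> u $ 2 \<noteq> 0" "u \<in> Z2 \<Longrightarrow> u $ 4 \<noteq> 1" "u \<in> Z2 \<Longrightarrow> params.s (u $ 3) (u $ 4) \<noteq> 1" for u
    by (auto simp: Z1_def Z2_def)
  note f = frac_params[OF Z]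
  have "principal_open A5 UNIV {u \<in> Z2. discriminant (al5 u) (be5 u) * F5 u * params.K (u $ 1) (u $ 2) (u $ 3) (u $ 4) \<noteq> 0}"
    unfolding discriminant_def by (rule principal_open_step[OF 2]) (intro frac_intros f)
  moreover have "{u \<in> Z2. discriminant (al5 u) (be5 u) * F5 u * params.K (u $ 1) (u $ 2) (u $ 3) (u $ 4) \<noteq> 0} = {u. good5 u}"
    by (auto simp: Z1_def Z2_def good5_def params.good_def al5_def be5_def F5_def)
  ultimately show ?thesis by simp
qed

definition swap5 :: "complex^5 \<Rightarrow> complex^5" where "swap5 u = vec5 (u $ 2) (u $ 1) (u $ 3) (u $ 4) (u $ 5)"

text \<open>The conditions are imposed on both orders of \<open>r\<close> and \<open>t\<close> to make the set stable under the swap.\<close>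

definition param_variety :: "(complex^5) set" where
  "param_variety = {u. good5 u \<and> good5 (swap5 u) \<and> u $ 5 ^ 3 = F5 u}"

lemma param_good: "u \<in> param_variety \<Longrightarrow> good_params (u $ 1) (u $ 2) (u $ 3) (u $ 4) (u $ 5)"
  by (simp add: good_params_def param_variety_def good5_def F5_def)

definition param_class :: "complex^5 \<Rightarrow> character" where
  "param_class u = char_class (rep_of (diag_mat (spectrum (al5 u) (be5 u)))
    (matrix_inv (good_params.X (u $ 1) (u $ 2) (u $ 3) (u $ 4) (u $ 5))))"

definition char_param :: "character \<Rightarrow> complex^5" where
  "char_param C = vec5 (char_nu C * char_r C) (char_nu C * char_t C) (char_nu C * char_w C) (char_la C) (char_nu C)"

lemma commutator_traces_eqI:
  assumes "X$1$2 * X$2$3 * X$3$1 = X$1$3 * X$3$2 * X$2$1"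
  shows "trace (diag_mat a ** (adjugate X ** (diag_mat b ** X))) = trace (adjugate X ** (diag_mat a ** (X ** diag_mat b)))"
proof -
  have "trace (diag_mat a ** (adjugate X ** (diag_mat b ** X))) - trace (adjugate X ** (diag_mat a ** (X ** diag_mat b))) =
      (X$1$3 * X$3$2 * X$2$1 - X$1$2 * X$2$3 * X$3$1) * ((a 1 * b 2 - a 2 * b 1) + (a 2 * b 3 - a 3 * b 2) + (a 3 * b 1 - a 1 * b 3))"
    by (simp add: trace_def matrix_matrix_mult_def sum_3 diag_mat_def adjugate_def vector_3 algebra_simps)
  then show ?thesis by (simp add: assms)
qed

lemma param_class_trace:
  assumes "u \<in> param_variety"
  shows "word_trace v (param_class u) =
    trace (word_value (diag_mat (spectrum (al5 u) (be5 u))) (matrix_inv (good_params.X (u $ 1) (u $ 2) (u $ 3) (u $ 4) (u $ 5))) v)"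
    and "param_class u \<in> sym_slice"
proof -
  interpret good_params "u $ 1" "u $ 2" "u $ 3" "u $ 4" "u $ 5" by (rule param_good[OF assms])
  have irr: "irreducible_rep whitehead_group (rep_of (diag_mat y) (matrix_inv X))"
    by (rule irreducible_rep_of[OF X_pair det_X X_off])
  have gens: "rep_of (diag_mat y) (matrix_inv X) gen_y = diag_mat y" "rep_of (diag_mat y) (matrix_inv X) gen_z = matrix_inv X"
    unfolding gen_y_def gen_z_def rep_of_class[OF X_pair] by (simp_all add: letter_def)
  have tr: "word_trace v (param_class u) = trace (word_value (diag_mat y) (matrix_inv X) v)" for v
    unfolding param_class_def al5_def be5_def word_trace_eq[OF irr] gens ..
  then show "word_trace v (param_class u) =
    trace (word_value (diag_mat (spectrum (al5 u) (be5 u))) (matrix_inv (good_params.X (u $ 1) (u $ 2) (u $ 3) (u $ 4) (u $ 5))) v)"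
    unfolding al5_def be5_def .
  have offd: "X$1$2 * X$2$3 * X$3$1 = X$1$3 * X$3$2 * X$2$1"
    by (simp add: X_def diag_plus_rank_one_def)
  have ia: "matrix_inv (adjugate X) = X"
    using matrix_inv_twice[OF det_X] unfolding matrix_inv_adjugate[OF det_X] .
  from commutator_traces_eqI[OF offd, of y "\<lambda>i. 1 / y i"]
  show "param_class u \<in> sym_slice"
    unfolding sym_slice_iff tr
    using irr unfolding param_class_def al5_def be5_def irr_char_variety_eq
    by (simp add: letter_def inverse_diag matrix_inv_adjugate[OF det_X] ia)
qed

lemma param_class_coords:
  assumes "u \<in> param_variety"
  shows "generic_character (param_class u)" "char_param (param_class u) = u"
proof -
  interpret good_params "u $ 1" "u $ 2" "u $ 3" "u $ 4" "u $ 5" by (rule param_good[OF assms])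
  let ?C = "param_class u" and ?z = "u $ 5"
  have y: "y = spectrum al be" ..
  note tr = param_class_trace(1)[OF assms, unfolded al5_def be5_def]
  note ch = char_of_diagonal_pair[OF tr det_X y]
  have Xij: "X $ i $ j = (if i = j then m i / ?z else 0) + rho j / ?z" for i j
    by (simp add: X_def diag_plus_rank_one_def)
  have cyc: "char_cycle ?C = rho 1 * rho 2 * rho 3 / ?z ^ 3"
  proof -
    have "2 * char_cycle ?C = 2 * (rho 1 * rho 2 * rho 3 / ?z ^ 3)"
      using ch(8) by (simp add: Xij power3_eq_cube mult_ac)
    then show ?thesis by (simp only: mult_cancel_left) simp
  qed
  have off: "char_off ?C 1 = rho 2 * rho 3 / ?z\<^sup>2" "char_off ?C 2 = rho 1 * rho 3 / ?z\<^sup>2" "char_off ?C 3 = rho 1 * rho 2 / ?z\<^sup>2"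
    unfolding ch by (simp_all add: Xij power2_eq_square mult_ac)
  have "char_rho ?C i = rho i / ?z" for i
    using exhaust_3[of i] rho_nonzero z0
    by (elim disjE) (simp_all add: char_rho_def cyc off power2_eq_square power3_eq_cube field_simps)
  then have rho': "char_rho ?C = (\<lambda>i. rho i / ?z)" by blast
  have m': "char_m ?C = (\<lambda>i. m i / ?z)"
    by (simp add: fun_eq_iff char_m_def ch(4) rho' Xij add_divide_distrib)
  note co = coords_scaled[folded rho' m' ch(1) ch(2) ch(3)]
  have co': "char_r ?C = u $ 1 / ?z" "char_t ?C = u $ 2 / ?z" "char_w ?C = u $ 3 / ?z" "char_s ?C = s" "char_la ?C = u $ 4" "char_nu ?C = ?z"
    unfolding char_r_def char_t_def char_w_def char_s_def char_la_def char_nu_def rho' m' ch(1-3) by (rule coords_scaled)+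
  show "char_param ?C = u" unfolding char_param_def co' using z0 by simp
  have offn: "char_off ?C i \<noteq> 0" for i
    using exhaust_3[of i] rho_nonzero z0 by (elim disjE) (simp_all add: off)
  show "generic_character ?C"
    unfolding generic_character_def co' ch(1,2) m'
    using param_class_trace(2)[OF assms] good cyc offn rho_nonzero z0 m_nonzero
    by (auto simp: good_def power_divide)
qed

lemma param_of_generic:
  assumes "generic_character C" "good5 (char_param C)" "good5 (swap5 (char_param C))"
  shows "char_param C \<in> param_variety" "param_class (char_param C) = C"
proof -
  let ?u = "char_param C"
  have u: "?u $ 1 = char_nu C * char_r C" "?u $ 2 = char_nu C * char_t C" "?u $ 3 = char_nu C * char_w C" "?u $ 4 = char_la C" "?u $ 5 = char_nu C"
    by (simp_all add: char_param_def)
  note g = generic_character_params[OF assms(1), folded u]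
  show in_var: "?u \<in> param_variety" using assms(2,3) g(3) by (simp add: param_variety_def F5_def)
  interpret good_params "?u $ 1" "?u $ 2" "?u $ 3" "?u $ 4" "?u $ 5" by (rule param_good[OF in_var])
  have y: "y = char_y C" unfolding g(1,2) char_y_def ..
  have nu0: "?u $ 5 \<noteq> 0" by (rule z0)
  have "X = diag_plus_rank_one (char_m C) (char_rho C)"
    unfolding X_def unfolding y g(5) g(6) using nu0 by simp
  then show "param_class ?u = C"
    using character_normal_form(3)[of C] assms(1) unfolding generic_character_def param_class_def al5_def be5_def y by simp
qed

text \<open>All matrices involved are given by formulas that treat the eigenvalues alike; for the inverse of the
  diagonal plus rank one matrix this is the Sherman--Morrison formula.\<close>

lemma frac_word_trace_param: "frac A5 param_variety (\<lambda>u. word_trace v (param_class u))"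
proof -
  let ?y = "\<lambda>u. spectrum (al5 u) (be5 u)"
  have gd: "u \<in> param_variety \<Longrightarrow> good5 u" for u by (simp add: param_variety_def)
  note fr = frac_on_good[OF gd]
  interpret cubic_spectrum A5 param_variety ?y al5 be5
  proof
    show "frac A5 param_variety al5" by (rule fr(1))
    show "frac A5 param_variety be5" by (rule fr(2))
  qed (rule spectrum)+
  define m where "m u i = u $ 3 / ?y u i + (u $ 1 + params.p (u $ 1) (u $ 2) (u $ 3) (u $ 4)) - 2 * u $ 2 * ?y u i" for u i
  define k where "k u i = (?y u i * params.kp (u $ 1) (u $ 2) (u $ 3) (u $ 4) - (al5 u - ?y u i) * ?y u i * params.s (u $ 3) (u $ 4)
    + params.km (u $ 1) (u $ 2) (u $ 3) (u $ 4)) / spec_deriv (al5 u) (be5 u) (?y u i)" for u i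
  have nf: "normal_form.m (u $ 1) (u $ 2) (u $ 3) (u $ 4) (?y u) i = m u i"
    "normal_form.rho (u $ 1) (u $ 2) (u $ 3) (u $ 4) (?y u) i = m u i * (k u i - 1) / 2"
    "spec_deriv (al5 u) (be5 u) (?y u i) \<noteq> 0" "m u i \<noteq> 0" "u $ 5 \<noteq> 0" "params.s (u $ 3) (u $ 4) \<noteq> 1"
    "det (good_params.X (u $ 1) (u $ 2) (u $ 3) (u $ 4) (u $ 5)) = 1"
    "(m u 1 * (k u 1 - 1) / 2) / m u 1 + (m u 2 * (k u 2 - 1) / 2) / m u 2 + (m u 3 * (k u 3 - 1) / 2) / m u 3 = (params.s (u $ 3) (u $ 4) - 3) / 2"
    if u: "u \<in> param_variety" for u i
  proof -
    interpret g: good_params "u $ 1" "u $ 2" "u $ 3" "u $ 4" "u $ 5" by (rule param_good[OF u])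
    show 1: "normal_form.m (u $ 1) (u $ 2) (u $ 3) (u $ 4) (?y u) i = m u i" for i
      by (simp add: al5_def be5_def g.m_def m_def)
    have k: "normal_form.k (u $ 1) (u $ 2) (u $ 3) (u $ 4) (?y u) i = k u i" for i
      by (simp add: al5_def be5_def g.k_def k_def)
    show "normal_form.rho (u $ 1) (u $ 2) (u $ 3) (u $ 4) (?y u) i = m u i * (k u i - 1) / 2" for i
      unfolding 1[symmetric] k[symmetric] by (simp add: al5_def be5_def g.rho_def)
    show "spec_deriv (al5 u) (be5 u) (?y u i) \<noteq> 0" using g.dv_nonzero by (simp add: al5_def be5_def)
    show m0: "m u i \<noteq> 0" for i unfolding 1[symmetric] using g.m_nonzero by (simp add: al5_def be5_def)
    show "u $ 5 \<noteq> 0" "params.s (u $ 3) (u $ 4) \<noteq> 1" by (rule g.z0, rule g.s1)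
    show "det (good_params.X (u $ 1) (u $ 2) (u $ 3) (u $ 4) (u $ 5)) = 1" by (rule g.det_X)
    have c: "(m u i * (k u i - 1) / 2) / m u i = (k u i - 1) / 2" for i using m0[of i] by simp
    have ks: "k u 1 + k u 2 + k u 3 = params.s (u $ 3) (u $ 4)"
      unfolding k[symmetric] using g.k_moments(2) by (simp add: sum_3 al5_def be5_def)
    show "(m u 1 * (k u 1 - 1) / 2) / m u 1 + (m u 2 * (k u 2 - 1) / 2) / m u 2 + (m u 3 * (k u 3 - 1) / 2) / m u 3 = (params.s (u $ 3) (u $ 4) - 3) / 2"
      unfolding c ks[symmetric] by (simp add: field_simps)
  qed
  have inv_y: "spec_fun (\<lambda>u i. 1 / ?y u i)" by (intro spec_fun_intros frac_const y_nonzero)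
  have sm: "spec_fun m" unfolding m_def
    by (intro spec_fun_intros frac_intros fr frac_nth y_nonzero)
  have sk: "spec_fun k" unfolding k_def
    by (intro spec_fun_divide spec_fun_add spec_fun_diff spec_fun_mult spec_fun_y spec_fun_const fr spec_fun_deriv nf(3))
  define Xm where "Xm u = (\<chi> i j. if i = j then m u i / u $ 5 else 0) + (\<chi> i j. 1 * (m u j * (k u j - 1) / 2 / u $ 5))" for u :: "complex^5"
  define c where "c u = 2 / (params.s (u $ 3) (u $ 4) - 1)" for u :: "complex^5"
  \<comment> \<open>the Sherman--Morrison formula for the inverse of \<open>Xm u\<close>\<close>
  define Zm where "Zm u = (\<chi> i j. if i = j then u $ 5 / m u i else 0) + (\<chi> i j. (u $ 5 / m u i) * (- c u * ((k u j - 1) / 2)))" for u :: "complex^5"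
  have fc: "frac A5 param_variety c" unfolding c_def by (intro frac_intros fr) (use nf(6) in auto)
  have parts: "spec_fun (\<lambda>u i. m u i / u $ 5)" "spec_fun (\<lambda>u i. 1)" "spec_fun (\<lambda>u j. m u j * (k u j - 1) / 2 / u $ 5)"
    "spec_fun (\<lambda>u i. u $ 5 / m u i)" "spec_fun (\<lambda>u j. - c u * ((k u j - 1) / 2))"
    by (intro spec_fun_divide spec_fun_mult spec_fun_diff sm sk spec_fun_const frac_const frac_nth frac_uminus fc nf(4,5), simp?)+
  have mats: "spec_matrix Xm" "spec_matrix Zm" "spec_matrix (\<lambda>u. diag_mat (?y u))" "spec_matrix (\<lambda>u. diag_mat (\<lambda>i. 1 / ?y u i))"
    unfolding Xm_def Zm_def diag_mat_def
    by (rule spec_matrix.add[OF spec_matrix.diag[OF parts(1)] spec_matrix.outer[OF parts(2,3)]],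
        rule spec_matrix.add[OF spec_matrix.diag[OF parts(4)] spec_matrix.outer[OF parts(4,5)]],
        rule spec_matrix.diag[OF spec_fun_y], rule spec_matrix.diag[OF inv_y])
  have X: "good_params.X (u $ 1) (u $ 2) (u $ 3) (u $ 4) (u $ 5) = Xm u" if u: "u \<in> param_variety" for u
  proof -
    interpret g: good_params "u $ 1" "u $ 2" "u $ 3" "u $ 4" "u $ 5" by (rule param_good[OF u])
    have "g.m = m u" by (intro ext) (rule nf(1)[OF u, unfolded al5_def be5_def])
    moreover have "g.rho = (\<lambda>i. m u i * (k u i - 1) / 2)"
      by (intro ext) (rule nf(2)[OF u, unfolded al5_def be5_def])
    ultimately show ?thesis unfolding g.X_def by (simp add: Xm_def diag_plus_rank_one_def vec_eq_iff)
  qed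
  have Z: "matrix_inv (Xm u) = Zm u" if u: "u \<in> param_variety" for u
  proof (rule matrix_inv_eqI)
    have c0: "c u * (1 + ((k u 1 - 1) / 2 + (k u 2 - 1) / 2 + (k u 3 - 1) / 2)) = 1"
    proof -
      have "(k u 1 - 1) / 2 + (k u 2 - 1) / 2 + (k u 3 - 1) / 2 = (params.s (u $ 3) (u $ 4) - 3) / 2"
        using nf(8)[OF u] nf(4)[OF u, of 1] nf(4)[OF u, of 2] nf(4)[OF u, of 3] by simp
      then have e: "1 + ((k u 1 - 1) / 2 + (k u 2 - 1) / 2 + (k u 3 - 1) / 2) = (params.s (u $ 3) (u $ 4) - 1) / 2"
        by (simp add: field_simps)
      show ?thesis unfolding c_def e using nf(6)[OF u] by simp
    qed
    define a where "a i = (k u i - 1) / 2" for i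
    have c1: "c u * (1 + (a 1 + a 2 + a 3)) = 1" unfolding a_def by (rule c0)
    have a: "m u j * (k u j - 1) / 2 / u $ 5 = m u j * a j / u $ 5" for j unfolding a_def by simp
    have Xe: "Xm u $ i $ j = ((if i = j then m u i else 0) + m u j * a j) / u $ 5"
      and Ze: "Zm u $ i $ j = u $ 5 / m u i * ((if i = j then 1 else 0) - c u * a j)" for i j
      by (simp_all only: Xm_def Zm_def a a_def[symmetric]) (simp_all add: add_divide_distrib algebra_simps)
    have "(Xm u ** Zm u) $ i $ j = (\<Sum>l\<in>UNIV. ((if i = l then 1 else 0) + a l) * ((if l = j then 1 else 0) - c u * a j))" for i j
      unfolding matrix_matrix_mult_def Xe Ze using nf(4)[OF u] nf(5)[OF u]
      by (auto intro!: sum.cong simp: field_simps)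
    moreover have "(\<Sum>l\<in>UNIV. ((if i = l then 1 else 0) + a l) * ((if l = j then 1 else 0) - c u * a j)) =
        (if i = j then 1 else 0) + a j * (1 - c u * (1 + (a 1 + a 2 + a 3)))" for i j
      using exhaust_3[of i] exhaust_3[of j] by (elim disjE) (simp_all add: sum_3 algebra_simps)
    ultimately show "Xm u ** Zm u = mat 1" unfolding c1 by (simp add: vec_eq_iff mat_def)
  qed
  define L where "L a u = (case a of (GenY, True) \<Rightarrow> diag_mat (?y u) | (GenY, False) \<Rightarrow> diag_mat (\<lambda>i. 1 / ?y u i)
    | (GenZ, True) \<Rightarrow> Zm u | (GenZ, False) \<Rightarrow> Xm u)" for a u
  have sL: "spec_matrix (L a)" for a
    unfolding L_def using mats by (cases a; cases "fst a"; cases "snd a") auto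
  have L: "letter (diag_mat (?y u)) (matrix_inv (Xm u)) a = L a u" if u: "u \<in> param_variety" for a u
  proof -
    interpret g: good_params "u $ 1" "u $ 2" "u $ 3" "u $ 4" "u $ 5" by (rule param_good[OF u])
    have 1: "matrix_inv (diag_mat (?y u)) = diag_mat (\<lambda>i. 1 / ?y u i)" using g.inverse_diag by (simp add: al5_def be5_def)
    have 2: "matrix_inv (Zm u) = Xm u" using matrix_inv_twice[OF nf(7)[OF u, unfolded X[OF u]]] Z[OF u] by simp
    show ?thesis by (cases a; cases "fst a"; cases "snd a") (auto simp: letter_def L_def 1 2 Z[OF u])
  qed
  have one: "spec_matrix (\<lambda>u. mat 1)"
    using spec_matrix.diag[OF spec_fun_const[OF frac_const[of A5 param_variety 1]]] by (simp add: mat_def)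
  have "spec_matrix (\<lambda>u. foldr (\<lambda>a M. L a u ** M) v (mat 1))"
    by (induction v) (simp_all add: one sL spec_matrix_mult)
  then have "frac A5 param_variety (\<lambda>u. trace (foldr (\<lambda>a M. L a u ** M) v (mat 1)))" by (rule frac_trace_spec_matrix)
  moreover have "word_trace v (param_class u) = trace (foldr (\<lambda>a M. L a u ** M) v (mat 1))" if u: "u \<in> param_variety" for u
    unfolding param_class_trace(1)[OF u] X[OF u] word_value_def L[OF u] ..
  ultimately show ?thesis by (subst frac_cong) auto
qed

lemma char_frac_spectral:
  assumes Z: "\<And>C. C \<in> Z \<Longrightarrow> discriminant (char_al C) (char_be C) \<noteq> 0"
  shows "frac TC Z char_al" "frac TC Z char_be" "cubic_spectrum TC Z char_y char_al char_be"
    "cubic_spectrum.spec_fun TC Z char_y (char_diag u)" "cubic_spectrum.spec_fun TC Z char_y char_off" "frac TC Z char_cycle"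
proof -
  show al: "frac TC Z char_al" unfolding char_al_def by (rule frac_coord[OF word_trace_coord])
  show be: "frac TC Z char_be" unfolding char_be_def by (rule frac_coord[OF word_trace_coord])
  show cs: "cubic_spectrum TC Z char_y char_al char_be"
    by unfold_locales (simp_all add: al be char_y_def spectrum)
  interpret cubic_spectrum TC Z char_y char_al char_be by (rule cs)
  have wt: "frac TC Z (word_trace v)" for v by (rule frac_coord[OF word_trace_coord])
  have dv: "spec_deriv (char_al C) (char_be C) (char_y C i) \<noteq> 0" if "C \<in> Z" for C i
    using eigenvalues.dv_nonzero[OF eigenvalues_spectrum[OF Z[OF that]], of i] by (simp add: char_y_def)
  show d: "spec_fun (char_diag u)" for u
    unfolding char_diag_def[abs_def]
    by (intro spec_fun_divide spec_fun_add spec_fun_diff spec_fun_mult spec_fun_y spec_fun_deriv spec_fun_const al wt y_nonzero dv)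
  show off: "spec_fun char_off"
    unfolding char_off_def[abs_def]
    by (intro spec_fun_diff[OF spec_fun_const] spec_fun_diff spec_fun_power d frac_divide frac_sum_spec frac_const) simp_all
  show "frac TC Z char_cycle"
    unfolding char_cycle_def[abs_def]
    by (intro frac_divide frac_add frac_diff frac_const frac_prod_spec frac_sum_spec spec_fun_mult d off) simp_all
qed

lemma char_frac_coords:
  assumes Z: "\<And>C. C \<in> Z \<Longrightarrow> discriminant (char_al C) (char_be C) \<noteq> 0" and off: "\<And>C i. C \<in> Z \<Longrightarrow> char_off C i \<noteq> 0"
  shows "cubic_spectrum.spec_fun TC Z char_y char_m"
    and "(\<And>C i. C \<in> Z \<Longrightarrow> char_m C i \<noteq> 0) \<Longrightarrow> frac TC Z char_r" "(\<And>C i. C \<in> Z \<Longrightarrow> char_m C i \<noteq> 0) \<Longrightarrow> frac TC Z char_t"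
    "(\<And>C i. C \<in> Z \<Longrightarrow> char_m C i \<noteq> 0) \<Longrightarrow> frac TC Z char_w" "(\<And>C i. C \<in> Z \<Longrightarrow> char_m C i \<noteq> 0) \<Longrightarrow> frac TC Z char_s"
    "(\<And>C i. C \<in> Z \<Longrightarrow> char_m C i \<noteq> 0) \<Longrightarrow> (\<And>C. C \<in> Z \<Longrightarrow> char_r C ^ 3 \<noteq> char_t C ^ 3) \<Longrightarrow> frac TC Z char_la"
    "(\<And>C i. C \<in> Z \<Longrightarrow> char_m C i \<noteq> 0) \<Longrightarrow> (\<And>C. C \<in> Z \<Longrightarrow> char_r C ^ 3 \<noteq> char_t C ^ 3) \<Longrightarrow> frac TC Z char_nu"
proof -
  note f = char_frac_spectral[OF Z]
  interpret cubic_spectrum TC Z char_y char_al char_be by (rule f(3))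
  have dv: "spec_deriv (char_al C) (char_be C) (char_y C i) \<noteq> 0" if "C \<in> Z" for C i
    using eigenvalues.dv_nonzero[OF eigenvalues_spectrum[OF Z[OF that]], of i] by (simp add: char_y_def)
  have rho: "spec_fun char_rho" unfolding char_rho_def[abs_def]
    by (intro spec_fun_divide spec_fun_const f(6) f(5) off)
  show m: "spec_fun char_m" unfolding char_m_def[abs_def] by (intro spec_fun_diff f(4) rho)
  have h: "frac TC Z (\<lambda>C. coords.h (char_rho C))" unfolding coords.h_def
    by (intro frac_divide frac_sum_spec rho frac_const) simp_all
  have n: "spec_fun (\<lambda>C. coords.n (char_m C) (char_rho C))" unfolding coords.n_def[abs_def]
    by (intro spec_fun_add m spec_fun_const h)
  have t: "frac TC Z char_t" unfolding char_t_def[abs_def] coords.t_def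
    by (intro frac_divide frac_uminus frac_const frac_sum_spec spec_fun_divide spec_fun_mult n spec_fun_y spec_fun_deriv dv) simp_all
  have r: "frac TC Z char_r" unfolding char_r_def[abs_def] coords.r_def char_t_def[symmetric]
    by (intro frac_diff frac_mult f(1) t frac_sum_spec spec_fun_divide spec_fun_mult spec_fun_diff n spec_fun_y spec_fun_const spec_fun_deriv dv)
  have w: "frac TC Z char_w" unfolding char_w_def[abs_def] coords.w_def
    by (intro frac_sum_spec spec_fun_divide n spec_fun_deriv dv)
  show "frac TC Z char_t" "frac TC Z char_r" "frac TC Z char_w" by (rule t, rule r, rule w)
  assume m0: "\<And>C i. C \<in> Z \<Longrightarrow> char_m C i \<noteq> 0"
  have k: "spec_fun (\<lambda>C. coords.k (char_m C) (char_rho C))" unfolding coords.k_def[abs_def]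
    by (intro spec_fun_add spec_fun_divide spec_fun_mult spec_fun_const frac_const rho m m0)
  show s: "frac TC Z char_s" unfolding char_s_def[abs_def] coords.s_def by (intro frac_sum_spec k)
  have b: "frac TC Z (\<lambda>C. coords.b (char_y C) (char_al C) (char_be C) (char_m C) (char_rho C))"
    unfolding coords.b_def char_t_def[symmetric] char_r_def[symmetric] char_s_def[symmetric]
    by (intro frac_diff frac_mult t s r frac_sum_spec spec_fun_divide k spec_fun_y y_nonzero)
  assume rt: "\<And>C. C \<in> Z \<Longrightarrow> char_r C ^ 3 \<noteq> char_t C ^ 3"
  show "frac TC Z char_la" unfolding char_la_def[abs_def] coords.la_def char_t_def[symmetric] char_r_def[symmetric]
    by (intro frac_divide frac_diff frac_mult frac_add frac_power f(1,2) t r h b) (use rt in auto)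
  show "frac TC Z char_nu" unfolding char_nu_def[abs_def] coords.nu_def char_t_def[symmetric] char_r_def[symmetric]
    by (intro frac_divide frac_diff frac_mult frac_add frac_power f(1,2) t r h b) (use rt in auto)
qed

definition good_characters :: "character set" where
  "good_characters = {C. generic_character C \<and> good5 (char_param C) \<and> good5 (swap5 (char_param C))}"

lemma frac_char_param:
  assumes "\<And>C. C \<in> Z \<Longrightarrow> generic_character C" shows "frac TC Z (\<lambda>C. char_param C $ i)"
proof -
  have f: "frac TC Z char_r" "frac TC Z char_t" "frac TC Z char_w" "frac TC Z char_la" "frac TC Z char_nu"
    using assms by (auto intro!: char_frac_coords simp: generic_character_def)
  show ?thesis using exhaust_5[of i]
    by (elim disjE; simp add: char_param_def; intro frac_mult f)
qed

lemma principal_open_good_characters: "principal_open TC sym_slice good_characters"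
proof -
  define S1 where "S1 = {C \<in> sym_slice. discriminant (char_al C) (char_be C) \<noteq> 0}"
  have "frac TC sym_slice char_al" "frac TC sym_slice char_be"
    unfolding char_al_def char_be_def by (rule frac_coord[OF word_trace_coord])+
  then have 1: "principal_open TC sym_slice S1" unfolding S1_def discriminant_def
    by (intro principal_open_step[OF principal_open_refl] frac_intros)
  have d1: "C \<in> S1 \<Longrightarrow> discriminant (char_al C) (char_be C) \<noteq> 0" for C by (simp add: S1_def)
  interpret s1: cubic_spectrum TC S1 char_y char_al char_be by (rule char_frac_spectral(3)[OF d1])
  define S2 where "S2 = {C \<in> S1. char_cycle C * (char_off C 1 * char_off C 2 * char_off C 3) \<noteq> 0}"
  have 2: "principal_open TC sym_slice S2" unfolding S2_def
    by (intro principal_open_step[OF 1] frac_mult[OF char_frac_spectral(6)[OF d1]] s1.frac_prod_spec char_frac_spectral(5)[OF d1])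
  have d2: "C \<in> S2 \<Longrightarrow> discriminant (char_al C) (char_be C) \<noteq> 0" and o2: "C \<in> S2 \<Longrightarrow> char_off C i \<noteq> 0" for C i
    using exhaust_3[of i] by (auto simp: S1_def S2_def)
  interpret s2: cubic_spectrum TC S2 char_y char_al char_be by (rule char_frac_spectral(3)[OF d2])
  define S3 where "S3 = {C \<in> S2. char_m C 1 * char_m C 2 * char_m C 3 \<noteq> 0}"
  have 3: "principal_open TC sym_slice S3" unfolding S3_def
    by (intro principal_open_step[OF 2] s2.frac_prod_spec char_frac_coords(1)[OF d2 o2])
  have d3: "C \<in> S3 \<Longrightarrow> discriminant (char_al C) (char_be C) \<noteq> 0" and o3: "C \<in> S3 \<Longrightarrow> char_off C i \<noteq> 0"
    and m3: "C \<in> S3 \<Longrightarrow> char_m C i \<noteq> 0" for C i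
    using exhaust_3[of i] d2 o2 by (auto simp: S3_def)
  note f3 = char_frac_coords(2-5)[OF d3 o3 m3]
  define S4 where "S4 = {C \<in> S3. char_r C * char_t C * (char_r C ^ 3 - char_t C ^ 3) \<noteq> 0}"
  have 4: "principal_open TC sym_slice S4" unfolding S4_def
    by (intro principal_open_step[OF 3] frac_mult frac_diff frac_power f3)
  have d4: "C \<in> S4 \<Longrightarrow> discriminant (char_al C) (char_be C) \<noteq> 0" and o4: "C \<in> S4 \<Longrightarrow> char_off C i \<noteq> 0"
    and m4: "C \<in> S4 \<Longrightarrow> char_m C i \<noteq> 0" and r4: "C \<in> S4 \<Longrightarrow> char_r C ^ 3 \<noteq> char_t C ^ 3" for C i
    using d3 o3 m3 by (auto simp: S4_def)
  note f4 = char_frac_coords(2-7)[OF d4 o4 m4]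
  define S5 where "S5 = {C \<in> S4. char_nu C * (char_la C - 1) * (char_s C - 1) \<noteq> 0}"
  have 5: "principal_open TC sym_slice S5" unfolding S5_def
    by (intro principal_open_step[OF 4] frac_mult frac_diff frac_const f4(4,5,6) r4 | assumption)+
  have S5_iff: "C \<in> S5 \<longleftrightarrow> generic_character C" for C
  proof
    assume C: "C \<in> S5"
    then have C4: "C \<in> S4" by (simp add: S5_def)
    then have "C \<in> S2" by (simp add: S4_def S3_def)
    then have "C \<in> sym_slice" "char_cycle C \<noteq> 0" by (simp_all add: S2_def S1_def)
    moreover have "char_r C \<noteq> 0" "char_t C \<noteq> 0" using C4 by (simp_all add: S4_def)
    moreover have "char_nu C \<noteq> 0" "char_la C \<noteq> 1" "char_s C \<noteq> 1" using C by (simp_all add: S5_def)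
    ultimately show "generic_character C"
      unfolding generic_character_def using d4[OF C4] o4[OF C4] m4[OF C4] r4[OF C4] by (intro conjI allI)
  next
    assume "generic_character C"
    note g = this[unfolded generic_character_def]
    have "C \<in> S2" using g by (simp add: S1_def S2_def)
    then have "C \<in> S3" using g by (simp add: S3_def)
    then have "C \<in> S4" using g by (simp add: S4_def)
    then show "C \<in> S5" using g by (simp add: S5_def)
  qed
  have S5: "S5 = {C. generic_character C}" using S5_iff by blast
  obtain f where f: "f \<in> poly_funs A5" "\<And>u. good5 u \<longleftrightarrow> f u \<noteq> 0"
    using principal_open_good unfolding principal_open_def by blast
  have fp: "frac TC S5 (\<lambda>C. char_param C $ i)" for i by (rule frac_char_param) (simp add: S5)
  have "frac TC S5 (\<lambda>C. f (char_param C))"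
    by (rule frac_poly_comp[OF f(1)]) (use fp A5_cases in blast)
  moreover have "frac TC S5 (\<lambda>C. f (swap5 (char_param C)))"
  proof (rule frac_poly_comp[OF f(1)])
    fix g assume "g \<in> A5"
    then obtain i where g: "g = (\<lambda>u. u $ i)" using A5_cases by blast
    show "frac TC S5 (\<lambda>C. g (swap5 (char_param C)))"
      using exhaust_5[of i] unfolding g by (elim disjE) (simp_all add: swap5_def fp)
  qed
  ultimately have "principal_open TC sym_slice {C \<in> S5. f (char_param C) * f (swap5 (char_param C)) \<noteq> 0}"
    by (intro principal_open_step[OF 5] frac_mult)
  moreover have "{C \<in> S5. f (char_param C) * f (swap5 (char_param C)) \<noteq> 0} = good_characters"
    unfolding S5 good_characters_def f(2) by auto
  ultimately show ?thesis by simp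
qed

section \<open>The cyclic action on the parameter variety\<close>

definition omega :: complex where "omega = Complex (- 1 / 2) (sqrt 3 / 2)"

lemma omega_square: "omega\<^sup>2 = - omega - 1"
  by (simp add: omega_def complex_eq_iff power2_eq_square field_simps)

lemma omega3: "omega ^ 3 = 1"
proof -
  have "omega ^ 3 - 1 = (omega - 1) * (omega\<^sup>2 - (- omega - 1))" by (simp add: algebra_simps power2_eq_square power3_eq_cube)
  then show ?thesis unfolding omega_square by simp
qed

lemma omega_neq_1: "omega \<noteq> 1" "omega\<^sup>2 \<noteq> 1"
  unfolding omega_square by (simp_all add: omega_def complex_eq_iff)

lemma cube_root_of_unity: "(x::complex) ^ 3 = 1 \<Longrightarrow> x = 1 \<or> x = omega \<or> x = omega\<^sup>2"
proof -
  assume x: "x ^ 3 = 1"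
  have "(x - 1) * ((x - omega) * (x - (- omega - 1))) = x ^ 3 - 1 + (1 - x) * (omega\<^sup>2 + omega + 1)"
    by (simp add: algebra_simps power2_eq_square power3_eq_cube)
  also have "\<dots> = 0" unfolding omega_square x by simp
  finally show ?thesis unfolding omega_square by auto
qed

text \<open>A generator of the group of order 6: its cube is the exchange of the first two coordinates and
  its fourth power the multiplication of the last one by \<open>omega\<close>.\<close>

definition gamma5 :: "complex^5 \<Rightarrow> complex^5" where
  "gamma5 u = vec5 (u $ 2) (u $ 1) (u $ 3) (u $ 4) (omega * u $ 5)"

text \<open>The fifth coordinate \<open>0\<close> places the quotient in a hyperplane of \<open>\<complex>\<^sup>5\<close>.\<close>

definition quot5 :: "complex^5 \<Rightarrow> complex^5" where
  "quot5 u = vec5 (u $ 1 + u $ 2) (u $ 1 * u $ 2) (u $ 3) (u $ 4) 0"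

lemma gamma5_funpow:
  "(gamma5 ^^ i) u = vec5 (if even i then u $ 1 else u $ 2) (if even i then u $ 2 else u $ 1) (u $ 3) (u $ 4) (omega ^ i * u $ 5)"
  by (induction i) (auto simp: gamma5_def mult.assoc)

lemma good5_cong: "u $ 1 = v $ 1 \<Longrightarrow> u $ 2 = v $ 2 \<Longrightarrow> u $ 3 = v $ 3 \<Longrightarrow> u $ 4 = v $ 4 \<Longrightarrow> good5 u = good5 v"
  by (simp add: good5_def)

lemma F5_nonzero: "good5 u \<Longrightarrow> F5 u \<noteq> 0" by (simp add: good5_def F5_def params.good_def)

lemma F5_swap: "good5 u \<Longrightarrow> F5 (swap5 u) = F5 u"
proof -
  assume u: "good5 u"
  obtain z where "z ^ 3 = F5 u"
  proof
    show "(exp (Ln (F5 u) / 3)) ^ 3 = F5 u" using F5_nonzero[OF u] by (simp flip: exp_of_nat_mult)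
  qed
  then interpret good_params "u $ 1" "u $ 2" "u $ 3" "u $ 4" z
    using u by (simp add: good_params_def good5_def F5_def)
  show ?thesis using F_swap by (simp add: F5_def swap5_def)
qed

lemma param_varietyD:
  assumes "u \<in> param_variety" shows "good5 u" "good5 (swap5 u)" "u $ 5 ^ 3 = F5 u" "u $ 5 \<noteq> 0" "u $ 1 \<noteq> u $ 2"
  using assms F5_nonzero[of u] by (auto simp: param_variety_def good5_def params.good_def)

lemma gamma5_in: "u \<in> param_variety \<Longrightarrow> gamma5 u \<in> param_variety"
proof -
  assume u: "u \<in> param_variety"
  note d = param_varietyD[OF u]
  have "good5 (gamma5 u) = good5 (swap5 u)" by (rule good5_cong) (simp_all add: gamma5_def swap5_def)
  moreover have "good5 (swap5 (gamma5 u)) = good5 u" by (rule good5_cong) (simp_all add: gamma5_def swap5_def)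
  moreover have "F5 (gamma5 u) = F5 (swap5 u)" by (simp add: F5_def gamma5_def swap5_def)
  ultimately show ?thesis
    using d F5_swap[OF d(1)] by (simp add: param_variety_def) (simp add: gamma5_def power_mult_distrib omega3)
qed

lemma gamma5_funpow_in: "u \<in> param_variety \<Longrightarrow> (gamma5 ^^ i) u \<in> param_variety"
  by (induction i) (simp_all add: gamma5_in)

lemma gamma5_period: "(gamma5 ^^ 6) u = u"
proof -
  have "omega ^ 6 = (omega ^ 3) ^ 2" by (simp flip: power_mult)
  then show ?thesis by (intro vec5_eqI) (simp_all add: gamma5_funpow omega3)
qed

lemma gamma5_free:
  assumes "u \<in> param_variety" "0 < i" "i < 6" shows "(gamma5 ^^ i) u \<noteq> u"
proof
  assume e: "(gamma5 ^^ i) u = u"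
  have "even i" using arg_cong[OF e, of "\<lambda>v. v $ 1"] param_varietyD(5)[OF assms(1)] by (auto simp: gamma5_funpow split: if_splits)
  then have "i = 2 \<or> i = 4" using assms(2,3) by presburger
  moreover have "omega ^ i = 1" using arg_cong[OF e, of "\<lambda>v. v $ 5"] param_varietyD(4)[OF assms(1)] by (simp add: gamma5_funpow)
  moreover have "omega ^ 4 = omega" using omega3 by (simp add: power4_eq_xxxx power3_eq_cube)
  ultimately show False using omega_neq_1 by auto
qed

lemma quot5_eq_cases:
  assumes "quot5 u = quot5 v"
  shows "v $ 1 = u $ 1 \<and> v $ 2 = u $ 2 \<or> v $ 1 = u $ 2 \<and> v $ 2 = u $ 1" "v $ 3 = u $ 3" "v $ 4 = u $ 4"
proof -
  have s: "u $ 1 + u $ 2 = v $ 1 + v $ 2" "u $ 1 * u $ 2 = v $ 1 * v $ 2"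
    using arg_cong[OF assms, of "\<lambda>v. v $ 1"] arg_cong[OF assms, of "\<lambda>v. v $ 2"] by (simp_all add: quot5_def)
  show "v $ 3 = u $ 3" "v $ 4 = u $ 4"
    using arg_cong[OF assms, of "\<lambda>v. v $ 3"] arg_cong[OF assms, of "\<lambda>v. v $ 4"] by (simp_all add: quot5_def)
  have "(v $ 1 - u $ 1) * (v $ 1 - u $ 2) = 0" using s by algebra
  then show "v $ 1 = u $ 1 \<and> v $ 2 = u $ 2 \<or> v $ 1 = u $ 2 \<and> v $ 2 = u $ 1" using s(1) by auto
qed

lemma quot5_fibre:
  assumes "u \<in> param_variety" "v \<in> param_variety"
  shows "quot5 u = quot5 v \<longleftrightarrow> (\<exists>i<6. v = (gamma5 ^^ i) u)"
proof
  assume q: "quot5 u = quot5 v"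
  note s = quot5_eq_cases(2,3)[OF q]
  from quot5_eq_cases(1)[OF q] consider "v $ 1 = u $ 1" "v $ 2 = u $ 2" | "v $ 1 = u $ 2" "v $ 2 = u $ 1" by blast
  then obtain b where b: "b < (2::nat)" "v $ 1 = (if even b then u $ 1 else u $ 2)" "v $ 2 = (if even b then u $ 2 else u $ 1)"
  proof cases
    case 1 then show ?thesis using that[of 0] by simp
  next
    case 2 then show ?thesis using that[of 1] by simp
  qed
  have "F5 v = F5 u"
  proof (cases "even b")
    case True then show ?thesis using b s by (simp add: F5_def)
  next
    case False then show ?thesis using b s F5_swap[OF param_varietyD(1)[OF assms(1)]] by (simp add: F5_def swap5_def)
  qed
  then have "(v $ 5 / u $ 5) ^ 3 = 1"
    using param_varietyD(3,4)[OF assms(1)] param_varietyD(3,4)[OF assms(2)]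
      F5_nonzero[OF param_varietyD(1)[OF assms(1)]] by (simp add: power_divide)
  from cube_root_of_unity[OF this] obtain j where j: "j < (3::nat)" "v $ 5 / u $ 5 = omega ^ j"
  proof (elim disjE)
    assume "v $ 5 / u $ 5 = 1" then show ?thesis using that[of 0] by simp
  next
    assume "v $ 5 / u $ 5 = omega" then show ?thesis using that[of 1] by simp
  next
    assume "v $ 5 / u $ 5 = omega\<^sup>2" then show ?thesis using that[of 2] by simp
  qed
  \<comment> \<open>the residue modulo 6 with given residues modulo 2 and 3\<close>
  define i where "i = (3 * b + 4 * j) mod 6"
  have bj: "b = 0 \<or> b = 1" "j = 0 \<or> j = 1 \<or> j = 2" using b(1) j(1) by auto
  have ev: "even i = even b" unfolding i_def using bj by (elim disjE) simp_all
  have "omega ^ i = omega ^ j"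
  proof -
    have pm: "omega ^ n = omega ^ (n mod 3)" for n
    proof -
      have "omega ^ n = omega ^ (3 * (n div 3) + n mod 3)" by simp
      then show ?thesis by (simp only: power_add power_mult omega3) simp
    qed
    have "i mod 3 = j mod 3" unfolding i_def using bj by (elim disjE) simp_all
    then show ?thesis using pm[of i] pm[of j] by simp
  qed
  then have "v = (gamma5 ^^ i) u"
    using b s j param_varietyD(4)[OF assms(1)] by (intro vec5_eqI) (simp_all add: gamma5_funpow ev field_simps)
  moreover have "i < 6" by (simp add: i_def)
  ultimately show "\<exists>i<6. v = (gamma5 ^^ i) u" by blast
qed (auto simp: quot5_def gamma5_funpow add.commute mult.commute)

text \<open>Over the symmetric polynomials in \<open>r\<close> and \<open>t\<close>, the polynomials in \<open>r\<close> and \<open>t\<close> form a free module with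
  basis \<open>1, r\<close>.\<close>

lemma poly_symmetric_split:
  assumes "f \<in> poly_funs A5"
  shows "\<exists>a\<in>poly_funs A5. \<exists>b\<in>poly_funs A5. \<forall>u. f (vec5 (u $ 1) (u $ 2) (u $ 3) (u $ 4) 0) = a (quot5 u) + u $ 1 * b (quot5 u)"
  using assms
proof induction
  case (coord f)
  then obtain i where f: "f = (\<lambda>u. u $ i)" using A5_cases by blast
  have c: "(\<lambda>u. u $ j) \<in> poly_funs A5" for j by (rule poly_funs.coord[OF A5_coord])
  have k: "(\<lambda>u. k) \<in> poly_funs A5" for k by (rule poly_funs.const)
  consider "i = 1" | "i = 2" | "i = 3 \<or> i = 4 \<or> i = 5" using exhaust_5[of i] by blast
  then show ?case
  proof cases
    case 1
    then show ?thesis unfolding f by (intro bexI[OF _ k[of 0]] bexI[OF _ k[of 1]]) simp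
  next
    case 2
    then show ?thesis unfolding f by (intro bexI[OF _ c[of 1]] bexI[OF _ k[of "-1"]]) (simp add: quot5_def)
  next
    case 3
    then show ?thesis unfolding f by (intro bexI[OF _ c[of i]] bexI[OF _ k[of 0]]) (auto simp: quot5_def)
  qed
next
  case (const k)
  show ?case by (intro bexI[OF _ poly_funs.const[of k]] bexI[OF _ poly_funs.const[of 0]]) simp
next
  case (add f g)
  then obtain a b a' b' where ab: "a \<in> poly_funs A5" "b \<in> poly_funs A5" "a' \<in> poly_funs A5" "b' \<in> poly_funs A5"
    "\<And>u. f (vec5 (u $ 1) (u $ 2) (u $ 3) (u $ 4) 0) = a (quot5 u) + u $ 1 * b (quot5 u)"
    "\<And>u. g (vec5 (u $ 1) (u $ 2) (u $ 3) (u $ 4) 0) = a' (quot5 u) + u $ 1 * b' (quot5 u)" by blast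
  show ?case
    by (intro bexI[OF _ poly_funs.add[OF ab(1,3)]] bexI[OF _ poly_funs.add[OF ab(2,4)]]) (simp add: ab(5,6) algebra_simps)
next
  case (mult f g)
  then obtain a b a' b' where ab: "a \<in> poly_funs A5" "b \<in> poly_funs A5" "a' \<in> poly_funs A5" "b' \<in> poly_funs A5"
    "\<And>u. f (vec5 (u $ 1) (u $ 2) (u $ 3) (u $ 4) 0) = a (quot5 u) + u $ 1 * b (quot5 u)"
    "\<And>u. g (vec5 (u $ 1) (u $ 2) (u $ 3) (u $ 4) 0) = a' (quot5 u) + u $ 1 * b' (quot5 u)" by blast
  \<comment> \<open>reduce with \<open>r\<^sup>2 = (r + t) r - r t\<close>\<close>
  have c: "(\<lambda>u. u $ j) \<in> poly_funs A5" for j by (rule poly_funs.coord[OF A5_coord])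
  have A: "(\<lambda>v. a v * a' v + (-1) * (v $ 2 * (b v * b' v))) \<in> poly_funs A5"
    and B: "(\<lambda>v. (a v * b' v + a' v * b v) + v $ 1 * (b v * b' v)) \<in> poly_funs A5"
    by (rule poly_funs.add[OF poly_funs.mult[OF ab(1,3)] poly_funs.mult[OF poly_funs.const poly_funs.mult[OF c poly_funs.mult[OF ab(2,4)]]]],
        rule poly_funs.add[OF poly_funs.add[OF poly_funs.mult[OF ab(1,4)] poly_funs.mult[OF ab(3,2)]] poly_funs.mult[OF c poly_funs.mult[OF ab(2,4)]]])
  show ?case
  proof (rule bexI[OF _ A], rule bexI[OF _ B], rule allI)
    fix u :: "complex^5"
    have q: "quot5 u $ 1 = u $ 1 + u $ 2" "quot5 u $ 2 = u $ 1 * u $ 2" by (simp_all add: quot5_def)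
    have "(x + u $ 1 * y) * (x' + u $ 1 * y') = (x * x' + (-1) * (u $ 1 * u $ 2 * (y * y')))
        + u $ 1 * ((x * y' + x' * y) + (u $ 1 + u $ 2) * (y * y'))" for x y x' y' :: complex
      by (simp add: algebra_simps)
    then show "f (vec5 (u $ 1) (u $ 2) (u $ 3) (u $ 4) 0) * g (vec5 (u $ 1) (u $ 2) (u $ 3) (u $ 4) 0) =
        (a (quot5 u) * a' (quot5 u) + (-1) * (quot5 u $ 2 * (b (quot5 u) * b' (quot5 u))))
        + u $ 1 * ((a (quot5 u) * b' (quot5 u) + a' (quot5 u) * b (quot5 u)) + quot5 u $ 1 * (b (quot5 u) * b' (quot5 u)))"
      unfolding ab(5,6) q .
  qed
qed

section \<open>Openness of the quotient map\<close>

text \<open>The branch of the \<open>n\<close>-th root that is continuous near \<open>1\<close>, with value \<open>1\<close> there.\<close>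

definition branch_root :: "nat \<Rightarrow> complex \<Rightarrow> complex" where
  "branch_root n x = exp (Ln x / of_nat n)"

lemma branch_root_power: "n > 0 \<Longrightarrow> x \<noteq> 0 \<Longrightarrow> branch_root n x ^ n = x"
  by (simp add: branch_root_def flip: exp_of_nat_mult)

lemma tendsto_branch_root: "(f \<longlongrightarrow> 1) net \<Longrightarrow> ((\<lambda>x. branch_root n (f x)) \<longlongrightarrow> 1) net"
proof -
  assume "(f \<longlongrightarrow> 1) net"
  then have "((\<lambda>x. exp (Ln (f x) / of_nat n)) \<longlongrightarrow> exp (Ln 1 / of_nat n)) net"
    unfolding divide_inverse by (intro tendsto_intros) auto
  then show ?thesis by (simp add: branch_root_def)
qed

lemma continuous_F5: "continuous_on {u. good5 u} F5"
proof -
  have "continuous_map (classical_topology A5 {u. good5 u}) euclidean F5"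
    by (rule continuous_map_frac[OF frac_on_good(3) A5_nonempty]) simp
  then show ?thesis unfolding classical_topology_affine by simp
qed

lemma tendsto_vec5:
  assumes "(a \<longlongrightarrow> a') F" "(b \<longlongrightarrow> b') F" "(c \<longlongrightarrow> c') F" "(d \<longlongrightarrow> d') F" "(e \<longlongrightarrow> e') F"
  shows "((\<lambda>x. vec5 (a x) (b x) (c x) (d x) (e x)) \<longlongrightarrow> vec5 a' b' c' d' e') F"
proof (rule vec_tendstoI)
  fix i :: 5
  show "((\<lambda>x. vec5 (a x) (b x) (c x) (d x) (e x) $ i) \<longlongrightarrow> vec5 a' b' c' d' e' $ i) F"
    using exhaust_5[of i] assms by auto
qed

lemma continuous_on_vec5:
  assumes "continuous_on S a" "continuous_on S b" "continuous_on S c" "continuous_on S d" "continuous_on S e"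
  shows "continuous_on S (\<lambda>x. vec5 (a x) (b x) (c x) (d x) (e x))"
  using assms unfolding continuous_on_def by (auto intro: tendsto_vec5)

text \<open>A map onto a set is open if it has a section through each point that is continuous there.\<close>

lemma open_map_of_sections:
  fixes f :: "'a::topological_space \<Rightarrow> 'b::topological_space"
  assumes f: "f ` X \<subseteq> Y"
    and sec: "\<And>x. x \<in> X \<Longrightarrow> \<exists>s. (\<forall>y\<in>Y. s y \<in> X \<and> f (s y) = y) \<and> s (f x) = x \<and> (s \<longlongrightarrow> x) (at (f x) within Y)"
  shows "open_map (top_of_set X) (top_of_set Y) f"
  unfolding open_map_def
proof (intro allI impI)
  fix O' assume "openin (top_of_set X) O'"
  then obtain U where U: "open U" "O' = X \<inter> U" by (auto simp: openin_open)
  show "openin (top_of_set Y) (f ` O')"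
  proof (subst openin_subopen, intro ballI)
    fix y0 assume "y0 \<in> f ` O'"
    then obtain x where x: "x \<in> X" "x \<in> U" "y0 = f x" using U by blast
    obtain s where s: "\<And>y. y \<in> Y \<Longrightarrow> s y \<in> X \<and> f (s y) = y" "s (f x) = x" "(s \<longlongrightarrow> x) (at (f x) within Y)"
      using sec[OF x(1)] by blast
    have "eventually (\<lambda>y. s y \<in> U) (at (f x) within Y)" using s(3) U(1) x(2) by (rule topological_tendstoD)
    then obtain W where W: "open W" "f x \<in> W" "\<And>y. y \<in> W \<Longrightarrow> y \<noteq> f x \<Longrightarrow> y \<in> Y \<Longrightarrow> s y \<in> U"
      unfolding eventually_at_topological by blast
    have "Y \<inter> W \<subseteq> f ` O'"
    proof
      fix y assume y: "y \<in> Y \<inter> W"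
      then have "s y \<in> U" using W(3)[of y] s(2) x(2) by (cases "y = f x") auto
      then show "y \<in> f ` O'" using s(1)[of y] y U(2) by (intro image_eqI[of _ _ "s y"]) auto
    qed
    moreover have "y0 \<in> Y \<inter> W" using x f W by auto
    ultimately show "\<exists>T. openin (top_of_set Y) T \<and> y0 \<in> T \<and> T \<subseteq> f ` O'"
      using openin_open_Int[OF W(1), of Y] by blast
  qed
qed

lemma branch_root_1 [simp]: "branch_root n 1 = 1"
  by (simp add: branch_root_def)

lemma eventually_at_within_self: "eventually (\<lambda>x. x \<in> S) (at a within S)"
  unfolding eventually_at_topological by blast

lemma tendsto_nth_within: "((\<lambda>v. v $ i) \<longlongrightarrow> a $ i) (at (a :: complex^5) within S)"
  by (rule tendsto_vec_nth[OF tendsto_ident_at])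

lemma tendsto_F5:
  assumes "(f \<longlongrightarrow> f a) (at a within S)" "\<And>v. v \<in> S \<Longrightarrow> good5 (f v)" "good5 (f a)"
  shows "((\<lambda>v. F5 (f v)) \<longlongrightarrow> F5 (f a)) (at a within S)"
proof (rule continuous_on_tendsto_compose[OF continuous_F5 assms(1)])
  show "eventually (\<lambda>v. f v \<in> {u. good5 u}) (at a within S)"
    by (rule eventually_mono[OF eventually_at_within_self]) (simp add: assms(2))
qed (simp add: assms(3))

lemma F5_cong: "u $ 1 = v $ 1 \<Longrightarrow> u $ 2 = v $ 2 \<Longrightarrow> u $ 3 = v $ 3 \<Longrightarrow> u $ 4 = v $ 4 \<Longrightarrow> F5 u = F5 v"
  by (simp add: F5_def)

definition quot_base :: "(complex^5) set" where
  "quot_base = quot5 ` {u. good5 u \<and> good5 (swap5 u)}"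

lemma quot_base_iff: "quot5 u \<in> quot_base \<longleftrightarrow> good5 u \<and> good5 (swap5 u)"
proof
  assume "quot5 u \<in> quot_base"
  then obtain u' where u': "good5 u'" "good5 (swap5 u')" "quot5 u' = quot5 u" unfolding quot_base_def by auto
  note e = quot5_eq_cases[OF u'(3)]
  from e(1) show "good5 u \<and> good5 (swap5 u)"
  proof (elim disjE conjE)
    assume "u $ 1 = u' $ 1" "u $ 2 = u' $ 2"
    then have "good5 u = good5 u'" "good5 (swap5 u) = good5 (swap5 u')" using e by (simp_all add: good5_def swap5_def)
    then show ?thesis using u' by simp
  next
    assume "u $ 1 = u' $ 2" "u $ 2 = u' $ 1"
    then have "good5 u = good5 (swap5 u')" "good5 (swap5 u) = good5 u'" using e by (simp_all add: good5_def swap5_def)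
    then show ?thesis using u' by simp
  qed
qed (auto simp: quot_base_def)

lemma quot_base_fifth: "v \<in> quot_base \<Longrightarrow> v $ 5 = 0"
  by (auto simp: quot_base_def quot5_def)

lemma quot5_onto: "quot5 ` param_variety = quot_base"
proof
  show "quot5 ` param_variety \<subseteq> quot_base" using param_varietyD by (auto simp: quot_base_def)
  show "quot_base \<subseteq> quot5 ` param_variety"
  proof
    fix v assume "v \<in> quot_base"
    then obtain u where u: "good5 u" "good5 (swap5 u)" "v = quot5 u" unfolding quot_base_def by auto
    define u' where "u' = vec5 (u $ 1) (u $ 2) (u $ 3) (u $ 4) (branch_root 3 (F5 u))"
    have "good5 u' = good5 u" "good5 (swap5 u') = good5 (swap5 u)" "F5 u' = F5 u"
      by (simp_all add: good5_def F5_def u'_def swap5_def)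
    then have "u' \<in> param_variety"
      using u F5_nonzero[OF u(1)] by (simp add: param_variety_def) (simp add: u'_def branch_root_power)
    moreover have "quot5 u' = v" by (simp add: u'_def u(3) quot5_def)
    ultimately show "v \<in> quot5 ` param_variety" by blast
  qed
qed

text \<open>The symmetric functions \<open>r + t\<close> and \<open>r t\<close> determine \<open>r - t \<noteq> 0\<close> up to sign, and then
  \<open>F\<close> determines the fifth coordinate up to a cube root of unity. Locally the branches of the square
  root and the cube root with the prescribed value at a given point give a section.\<close>

lemma quot5_section:
  assumes u0: "u0 \<in> param_variety"
  shows "\<exists>s. (\<forall>v\<in>quot_base. s v \<in> param_variety \<and> quot5 (s v) = v) \<and> s (quot5 u0) = u0
    \<and> (s \<longlongrightarrow> u0) (at (quot5 u0) within quot_base)"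
proof -
  note d0 = param_varietyD[OF u0]
  define v0 where "v0 = quot5 u0"
  have v0n: "v0 $ 1 = u0 $ 1 + u0 $ 2" "v0 $ 2 = u0 $ 1 * u0 $ 2" "v0 $ 3 = u0 $ 3" "v0 $ 4 = u0 $ 4"
    by (simp_all add: v0_def quot5_def)
  have v0: "v0 \<in> quot_base" using quot5_onto u0 by (auto simp: v0_def)
  define d where "d = u0 $ 1 - u0 $ 2"
  have dnz: "d \<noteq> 0" using d0(5) by (simp add: d_def)
  define D where "D v = d * branch_root 2 ((v $ 1 ^ 2 - 4 * v $ 2) / d\<^sup>2)" for v :: "complex^5"
  define base where "base v = vec5 ((v $ 1 + D v) / 2) ((v $ 1 - D v) / 2) (v $ 3) (v $ 4) 0" for v
  define z where "z v = u0 $ 5 * branch_root 3 (F5 (base v) / F5 u0)" for v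
  define s where "s v = vec5 ((v $ 1 + D v) / 2) ((v $ 1 - D v) / 2) (v $ 3) (v $ 4) (z v)" for v
  have D2: "(D v)\<^sup>2 = v $ 1 ^ 2 - 4 * v $ 2" if v: "v \<in> quot_base" for v
  proof -
    obtain u where u: "good5 u" "v = quot5 u" using v unfolding quot_base_def by auto
    have "u $ 1 \<noteq> u $ 2" using u(1) by (auto simp: good5_def params.good_def)
    moreover have "v $ 1 ^ 2 - 4 * v $ 2 = (u $ 1 - u $ 2)\<^sup>2"
      by (simp add: u(2) quot5_def power2_eq_square algebra_simps)
    ultimately show ?thesis using dnz by (simp add: D_def power_mult_distrib branch_root_power)
  qed
  have qb: "quot5 (base v) = v" if v: "v \<in> quot_base" for v
  proof (rule vec5_eqI)
    have "(v $ 1 + D v) / 2 * ((v $ 1 - D v) / 2) = ((v $ 1)\<^sup>2 - (D v)\<^sup>2) / 4" by (simp add: power2_eq_square algebra_simps)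
    then show "quot5 (base v) $ 2 = v $ 2" unfolding D2[OF v] by (simp add: quot5_def base_def)
  qed (use quot_base_fifth[OF v] in \<open>simp_all add: quot5_def base_def field_simps\<close>)
  have bg: "good5 (base v)" "good5 (swap5 (base v))" if v: "v \<in> quot_base" for v
    using quot_base_iff[of "base v"] qb[OF v] v by simp_all
  have sV: "s v \<in> param_variety \<and> quot5 (s v) = v" if v: "v \<in> quot_base" for v
  proof -
    have "good5 (s v) = good5 (base v)" "good5 (swap5 (s v)) = good5 (swap5 (base v))" "F5 (s v) = F5 (base v)"
      by (simp_all add: good5_def F5_def s_def base_def swap5_def)
    moreover have "(z v) ^ 3 = F5 (base v)"
      using d0(3) F5_nonzero[OF d0(1)] F5_nonzero[OF bg(1)[OF v]] by (simp add: z_def power_mult_distrib branch_root_power)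
    ultimately have "s v \<in> param_variety"
      using bg[OF v] by (simp add: param_variety_def) (simp add: s_def)
    moreover have "quot5 (s v) = quot5 (base v)" by (simp add: quot5_def s_def base_def)
    ultimately show ?thesis using qb[OF v] by simp
  qed
  have "v0 $ 1 ^ 2 - 4 * v0 $ 2 = d\<^sup>2" by (simp add: v0n d_def power2_eq_square algebra_simps)
  then have disc0: "(v0 $ 1 ^ 2 - 4 * v0 $ 2) / d\<^sup>2 = 1" using dnz by simp
  have D0: "D v0 = d" unfolding D_def disc0 by simp
  have b0: "F5 (base v0) = F5 u0"
    by (rule F5_cong) (simp_all add: base_def D0 v0n, simp_all add: d_def)
  have z0: "z v0 = u0 $ 5" using F5_nonzero[OF d0(1)] by (simp add: z_def b0)
  have s0: "s v0 = u0"
    by (rule vec5_eqI) (simp_all add: s_def D0 v0n z0, simp_all add: d_def)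
  let ?N = "at v0 within quot_base"
  have "((\<lambda>v. (v $ 1 ^ 2 - 4 * v $ 2) / d\<^sup>2) \<longlongrightarrow> (v0 $ 1 ^ 2 - 4 * v0 $ 2) / d\<^sup>2) ?N"
    by (intro tendsto_intros tendsto_nth_within) (use dnz in simp)
  then have "((\<lambda>v. branch_root 2 ((v $ 1 ^ 2 - 4 * v $ 2) / d\<^sup>2)) \<longlongrightarrow> 1) ?N"
    unfolding disc0 by (rule tendsto_branch_root)
  then have "(D \<longlongrightarrow> d * 1) ?N" unfolding D_def[abs_def] by (intro tendsto_mult tendsto_const)
  then have Dl: "(D \<longlongrightarrow> D v0) ?N" by (simp add: D0)
  have "(base \<longlongrightarrow> base v0) ?N"
    unfolding base_def[abs_def] by (intro tendsto_vec5 tendsto_intros tendsto_nth_within Dl) simp_all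
  then have "((\<lambda>v. F5 (base v)) \<longlongrightarrow> F5 (base v0)) ?N"
    by (rule tendsto_F5) (use bg v0 in auto)
  then have "((\<lambda>v. F5 (base v) / F5 u0) \<longlongrightarrow> F5 (base v0) / F5 u0) ?N"
    by (intro tendsto_divide tendsto_const) (use F5_nonzero[OF d0(1)] in auto)
  then have "((\<lambda>v. F5 (base v) / F5 u0) \<longlongrightarrow> 1) ?N" using F5_nonzero[OF d0(1)] by (simp add: b0)
  then have "(z \<longlongrightarrow> u0 $ 5 * 1) ?N"
    unfolding z_def[abs_def] by (intro tendsto_mult tendsto_const tendsto_branch_root)
  then have zl: "(z \<longlongrightarrow> z v0) ?N" by (simp add: z0)
  have "(s \<longlongrightarrow> s v0) ?N"
    unfolding s_def[abs_def] by (intro tendsto_vec5 tendsto_intros tendsto_nth_within Dl zl) simp_all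
  then show ?thesis unfolding v0_def[symmetric] s0 using sV s0 by blast
qed

lemma open_map_quot5: "open_map (top_of_set param_variety) (top_of_set quot_base) quot5"
  by (rule open_map_of_sections) (use quot5_onto quot5_section in auto)

section \<open>Connectedness of the parameter variety\<close>

lemma poly_funs_comp:
  assumes "f \<in> poly_funs G" "\<And>g. g \<in> G \<Longrightarrow> (\<lambda>x. g (\<phi> x)) \<in> poly_funs F"
  shows "(\<lambda>x. f (\<phi> x)) \<in> poly_funs F"
  using assms(1) by induction (auto intro: poly_funs.intros assms(2))

lemma poly_funs_on_line:
  assumes "f \<in> poly_funs A5"
  shows "\<exists>p. \<forall>x. f (a + x *s (b - a)) = poly p x"
  using assms
proof induction
  case (coord f)
  then obtain i where "f = (\<lambda>u. u $ i)" using A5_cases by blast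
  then show ?case by (intro exI[of _ "[:a $ i, b $ i - a $ i:]"]) (simp add: algebra_simps)
next
  case (const c)
  show ?case by (intro exI[of _ "[:c:]"]) simp
next
  case (add f g)
  then obtain p q where "\<And>x. f (a + x *s (b - a)) = poly p x" "\<And>x. g (a + x *s (b - a)) = poly q x" by blast
  then show ?case by (intro exI[of _ "p + q"]) simp
next
  case (mult f g)
  then obtain p q where "\<And>x. f (a + x *s (b - a)) = poly p x" "\<And>x. g (a + x *s (b - a)) = poly q x" by blast
  then show ?case by (intro exI[of _ "p * q"]) simp
qed

lemma connected_cofinite: "finite A \<Longrightarrow> connected (- A :: complex set)"
  by (intro path_connected_imp_connected path_connected_complement_countable) (simp_all add: countable_finite)

text \<open>The complex line through two points of a principal open set meets the set in the complement
  of the finitely many roots of a polynomial in one variable.\<close>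

lemma connected_principal_open:
  assumes h: "h \<in> poly_funs A5"
  shows "connected {v :: complex^5. v $ 5 = 0 \<and> h v \<noteq> 0}" (is "connected ?B")
  unfolding connected_iff_connected_component
proof (intro ballI)
  fix a b assume ab: "a \<in> ?B" "b \<in> ?B"
  let ?l = "\<lambda>x. a + x *s (b - a)"
  obtain p where p: "\<And>x. h (?l x) = poly p x" using poly_funs_on_line[OF h] by blast
  have "poly p 0 \<noteq> 0" using p[of 0] ab(1) by simp
  then have "finite {x. poly p x = 0}" by (intro poly_roots_finite) auto
  then have "connected (- {x. poly p x = 0})" by (rule connected_cofinite)
  moreover have "continuous_on (- {x. poly p x = 0}) ?l"
    unfolding continuous_on_def
    by (intro ballI vec_tendstoI) (auto intro!: tendsto_intros)
  ultimately have conn: "connected (?l ` (- {x. poly p x = 0}))" using connected_continuous_image by blast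
  have "?l ` (- {x. poly p x = 0}) \<subseteq> ?B" using p ab by auto
  moreover have "a \<in> ?l ` (- {x. poly p x = 0})" using p[of 0] ab by (intro image_eqI[of _ _ 0]) auto
  moreover have "b \<in> ?l ` (- {x. poly p x = 0})" using p[of 1] ab by (intro image_eqI[of _ _ 1]) auto
  ultimately show "connected_component ?B a b" unfolding connected_component_def using conn by blast
qed

definition good_base :: "(complex^5) set" where
  "good_base = {v. v $ 5 = 0 \<and> good5 v \<and> good5 (swap5 v)}"

lemma good_base_poly:
  obtains h where "h \<in> poly_funs A5" "\<And>v. h v \<noteq> 0 \<longleftrightarrow> good5 v \<and> good5 (swap5 v)"
proof -
  obtain f where f: "f \<in> poly_funs A5" "\<And>u. good5 u \<longleftrightarrow> f u \<noteq> 0"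
    using principal_open_good unfolding principal_open_def by blast
  have "(\<lambda>v. f (swap5 v)) \<in> poly_funs A5"
  proof (rule poly_funs_comp[OF f(1)])
    fix g assume "g \<in> A5"
    then obtain i where "g = (\<lambda>u. u $ i)" using A5_cases by blast
    then show "(\<lambda>x. g (swap5 x)) \<in> poly_funs A5"
      using exhaust_5[of i] by (auto simp: swap5_def intro!: poly_funs.coord A5_coord)
  qed
  then show ?thesis using that[OF poly_funs.mult[OF f(1)]] f(2) by simp
qed

definition base_proj :: "complex^5 \<Rightarrow> complex^5" where
  "base_proj u = vec5 (u $ 1) (u $ 2) (u $ 3) (u $ 4) 0"

lemma base_proj_in: "u \<in> param_variety \<Longrightarrow> base_proj u \<in> good_base"
proof -
  assume u: "u \<in> param_variety"
  have "good5 (base_proj u) = good5 u" "good5 (swap5 (base_proj u)) = good5 (swap5 u)"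
    by (simp_all add: good5_def base_proj_def swap5_def)
  then show ?thesis using param_varietyD[OF u] by (simp add: good_base_def) (simp add: base_proj_def)
qed

lemma param_varietyI:
  assumes "b \<in> good_base" "e ^ 3 = F5 b"
  shows "vec5 (b $ 1) (b $ 2) (b $ 3) (b $ 4) e \<in> param_variety" "base_proj (vec5 (b $ 1) (b $ 2) (b $ 3) (b $ 4) e) = b"
proof -
  let ?u = "vec5 (b $ 1) (b $ 2) (b $ 3) (b $ 4) e"
  have "good5 ?u = good5 b" "good5 (swap5 ?u) = good5 (swap5 b)" "F5 ?u = F5 b"
    by (simp_all add: good5_def F5_def swap5_def)
  then show "?u \<in> param_variety" using assms by (simp add: good_base_def param_variety_def)
  show "base_proj ?u = b" using assms(1) by (intro vec5_eqI) (simp_all add: base_proj_def good_base_def)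
qed

lemma open_map_base_proj: "open_map (top_of_set param_variety) (top_of_set good_base) base_proj"
proof (rule open_map_of_sections)
  show "base_proj ` param_variety \<subseteq> good_base" using base_proj_in by blast
  fix u assume u: "u \<in> param_variety"
  note d = param_varietyD[OF u]
  have F0: "F5 u \<noteq> 0" by (rule F5_nonzero[OF d(1)])
  have Fb: "F5 (base_proj u) = F5 u" by (rule F5_cong) (simp_all add: base_proj_def)
  define z where "z b = u $ 5 * branch_root 3 (F5 b / F5 u)" for b
  define s where "s b = vec5 (b $ 1) (b $ 2) (b $ 3) (b $ 4) (z b)" for b
  have z3: "z b ^ 3 = F5 b" if "b \<in> good_base" for b
    using that d(3) F0 F5_nonzero[of b] by (simp add: z_def power_mult_distrib branch_root_power good_base_def)
  have z0: "z (base_proj u) = u $ 5" using F0 by (simp add: z_def Fb)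
  have s0: "s (base_proj u) = u" by (rule vec5_eqI) (simp_all add: s_def z0, simp_all add: base_proj_def)
  let ?N = "at (base_proj u) within good_base"
  have "((\<lambda>b. F5 b) \<longlongrightarrow> F5 (base_proj u)) ?N"
    by (rule tendsto_F5[OF tendsto_ident_at]) (use base_proj_in[OF u] in \<open>auto simp: good_base_def\<close>)
  then have "((\<lambda>b. F5 b / F5 u) \<longlongrightarrow> F5 (base_proj u) / F5 u) ?N"
    by (intro tendsto_divide tendsto_const) (use F0 in auto)
  then have "((\<lambda>b. F5 b / F5 u) \<longlongrightarrow> 1) ?N" using F0 by (simp add: Fb)
  then have "(z \<longlongrightarrow> u $ 5 * 1) ?N"
    unfolding z_def[abs_def] by (intro tendsto_mult tendsto_const tendsto_branch_root)
  then have zl: "(z \<longlongrightarrow> z (base_proj u)) ?N" by (simp add: z0)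
  have "(s \<longlongrightarrow> s (base_proj u)) ?N"
    unfolding s_def[abs_def] by (intro tendsto_vec5 tendsto_nth_within zl)
  then show "\<exists>s. (\<forall>y\<in>good_base. s y \<in> param_variety \<and> base_proj (s y) = y) \<and> s (base_proj u) = u \<and> (s \<longlongrightarrow> u) ?N"
    unfolding s0 using s0 param_varietyI z3 by (intro exI[of _ s]) (auto simp: s_def)
qed

text \<open>On this line the parameters are simple enough to evaluate everything by hand; at \<open>la = 0\<close> the eigenvalue
  discriminant is \<open>49\<close>, \<open>F = - 8\<close> and \<open>K = 8\<close>.\<close>

lemma good_base_curve:
  shows "vec5 1 (-1) 0 0 0 \<in> good_base"
    and "la \<noteq> 1 \<Longrightarrow> la \<noteq> -1 \<Longrightarrow> F5 (vec5 1 (-1) 0 la e) = - 8 / (1 + la)"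
proof -
  have s: "params.s 0 0 = 3" by (simp add: params.s_def)
  have P: "params.P 1 (-1) 0 = 1" "params.Q 1 (-1) 0 = 1" "params.P (-1) 1 0 = 1" "params.Q (-1) 1 0 = 1"
    by (simp_all add: params.P_def params.Q_def)
  have p: "params.p 1 (-1) 0 0 = 3" "params.q 1 (-1) 0 0 = -3" "params.p (-1) 1 0 0 = -3" "params.q (-1) 1 0 0 = 3"
    by (simp_all add: params.p_def params.q_def s P)
  have a: "params.al 1 (-1) 0 0 = -2" "params.be 1 (-1) 0 0 = -1" "params.al (-1) 1 0 0 = -1" "params.be (-1) 1 0 0 = -2"
    by (simp_all add: params.al_def params.be_def P p)
  have k: "params.kp 1 (-1) 0 0 = -4" "params.km 1 (-1) 0 0 = -5" "params.kp (-1) 1 0 0 = -5" "params.km (-1) 1 0 0 = -4"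
    by (simp_all add: params.kp_def params.km_def params.h_def params.b_def s P p)
  have F: "params.F 1 (-1) 0 0 = -8" "params.F (-1) 1 0 0 = -8"
    by (simp_all add: params.F_def cubic_norm_def s p a)
  have K: "params.K 1 (-1) 0 0 = 8" "params.K (-1) 1 0 0 = 8"
    by (simp_all add: params.K_def cubic_norm_def s k a)
  have "params.good 1 (-1) 0 0" "params.good (-1) 1 0 0"
    by (simp_all add: params.good_def s a F K discriminant_def)
  then show "vec5 1 (-1) 0 0 0 \<in> good_base" by (simp add: good_base_def good5_def swap5_def)
next
  assume la: "la \<noteq> 1" "la \<noteq> -1"
  define L where "L = 1 + la"
  have L: "L \<noteq> 0" "2 - L \<noteq> 0" "la = L - 1" using la by (auto simp: L_def add_eq_0_iff)
  have s: "params.s 0 la = (2 + L) / (2 - L)" by (simp add: params.s_def L(3))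
  have s1: "params.s 0 la - 1 = 2 * L / (2 - L)" "params.s 0 la + 3 = (8 - 2 * L) / (2 - L)"
    using L by (simp_all add: s field_simps)
  have P: "params.P 1 (-1) la = L" "params.Q 1 (-1) la = 2 - L" by (simp_all add: params.P_def params.Q_def L(3))
  have "(8 - 2 * L) / (2 - L) / (2 * L / (2 - L)) = (4 - L) / L"
    using L(1,2) by (simp add: divide_simps; simp add: algebra_simps)
  then have "(params.s 0 la + 3) / (params.s 0 la - 1) = (4 - L) / L" unfolding s1 .
  then have p: "params.p 1 (-1) 0 la = (4 - L) / L" "params.q 1 (-1) 0 la = - ((4 - L) / L)"
    using minus_divide_right[of "params.s 0 la + 3" "params.s 0 la - 1"] by (simp_all add: params.p_def params.q_def)
  have al: "params.al 1 (-1) 0 la = - (L\<^sup>2 - L + 4) / (2 * L)"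
    using L(1) by (simp add: params.al_def P p power2_eq_square field_simps)
  have be: "params.be 1 (-1) 0 la = (3 * L - L\<^sup>2 - 4) / (2 * L)"
    using L(1) by (simp add: params.be_def P p power2_eq_square field_simps)
  have b: "1 + (4 - L) / L = 4 / L" using L(1) by (simp add: field_simps)
  have "cubic_norm (params.al 1 (-1) 0 la) (params.be 1 (-1) 0 la) 0 (4 / L) 2 =
      (4 / L) ^ 3 + (4 / L)\<^sup>2 * 2 * (- (L\<^sup>2 - L + 4) / (2 * L)) + 4 / L * 4 * ((3 * L - L\<^sup>2 - 4) / (2 * L)) + 8"
    by (simp add: cubic_norm_def al be)
  also have "\<dots> = - 8 * (2 - L) / L\<^sup>2"
    using L(1) by (simp add: power2_eq_square power3_eq_cube divide_simps) (simp add: algebra_simps)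
  finally have N: "cubic_norm (params.al 1 (-1) 0 la) (params.be 1 (-1) 0 la) 0 (4 / L) 2 = - 8 * (2 - L) / L\<^sup>2" .
  have "params.F 1 (-1) 0 la = - 8 * (2 - L) / L\<^sup>2 * (2 * L / (2 - L)) / 2"
    unfolding params.F_def p(1) b s1(1) using N by simp
  also have "\<dots> = - 8 / L" using L(1,2) by (simp add: power2_eq_square divide_simps; simp add: algebra_simps)
  finally show "F5 (vec5 1 (-1) 0 la e) = - 8 / (1 + la)" by (simp add: F5_def L_def)
qed

text \<open>One fibre of \<open>base_proj\<close> lies in a connected curve of the parameter variety: over the line
  \<open>(1, -1, 0, la)\<close> the equation of the variety reads \<open>zeta\<^sup>3 (1 + la) = - 8\<close>, which can be solved for
  \<open>la\<close> instead of \<open>zeta\<close>.\<close>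

lemma connected_fibre_curve:
  obtains G where "connected G" "G \<subseteq> param_variety"
    "\<And>u. u \<in> param_variety \<Longrightarrow> base_proj u = vec5 1 (-1) 0 0 0 \<Longrightarrow> u \<in> G"
proof -
  obtain h where h: "h \<in> poly_funs A5" "\<And>v. h v \<noteq> 0 \<longleftrightarrow> good5 v \<and> good5 (swap5 v)" by (rule good_base_poly) blast
  obtain p where p: "\<And>x. h (vec5 1 (-1) 0 0 0 + x *s (vec5 1 (-1) 0 1 0 - vec5 1 (-1) 0 0 0)) = poly p x"
    using poly_funs_on_line[OF h(1)] by blast
  have line: "vec5 1 (-1) 0 0 0 + x *s (vec5 1 (-1) 0 1 0 - vec5 1 (-1) 0 0 0) = vec5 1 (-1) 0 x 0" for x
    by (rule vec5_eqI) simp_all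
  have pg: "poly p x \<noteq> 0 \<longleftrightarrow> vec5 1 (-1) 0 x 0 \<in> good_base" for x
    using h(2)[of "vec5 1 (-1) 0 x 0"] unfolding p[of x, unfolded line] by (simp add: good_base_def)
  have "poly p 0 \<noteq> 0" using pg[of 0] good_base_curve(1) by simp
  then have fin: "finite {x. poly p x = 0}" by (intro poly_roots_finite) auto
  \<comment> \<open>zero and the values of the fifth coordinate that lead to \<open>la\<close> outside the good range\<close>
  define A where "A = insert 0 (\<Union>x\<in>{x. poly p x = 0}. {e :: complex. e ^ 3 = - 8 / (1 + x)})"
  have "finite A" unfolding A_def using fin by (auto intro!: finite_nth_roots)
  then have cA: "connected (- A)" by (rule connected_cofinite)
  define c where "c e = vec5 1 (-1) 0 (- 1 - 8 / e ^ 3) e" for e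
  have "continuous_on (- A) c" unfolding c_def[abs_def]
    by (intro continuous_on_vec5 continuous_intros) (auto simp: A_def)
  then have "connected (c ` (- A))" using cA by (rule connected_continuous_image)
  moreover have "c ` (- A) \<subseteq> param_variety"
  proof
    fix u assume "u \<in> c ` (- A)"
    then obtain e where e: "e \<notin> A" "u = c e" by auto
    define x where "x = - 1 - 8 / e ^ 3"
    have e0: "e \<noteq> 0" using e(1) by (auto simp: A_def)
    then have x: "x \<noteq> -1" "e ^ 3 = - 8 / (1 + x)" by (simp_all add: x_def)
    have "poly p x \<noteq> 0" using e(1) x(2) by (auto simp: A_def)
    then have gb: "vec5 1 (-1) 0 x 0 \<in> good_base" using pg by simp
    then have "x \<noteq> 1" by (auto simp: good_base_def good5_def params.good_def)
    then have "e ^ 3 = F5 (vec5 1 (-1) 0 x 0)" using good_base_curve(2)[of x 0] x by simp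
    from param_varietyI(1)[OF gb this] show "u \<in> param_variety" by (simp add: e(2) c_def x_def)
  qed
  moreover have "u \<in> c ` (- A)" if u: "u \<in> param_variety" "base_proj u = vec5 1 (-1) 0 0 0" for u
  proof -
    have n: "u $ 1 = 1" "u $ 2 = -1" "u $ 3 = 0" "u $ 4 = 0"
      using arg_cong[OF u(2), of "\<lambda>v. v $ 1"] arg_cong[OF u(2), of "\<lambda>v. v $ 2"] arg_cong[OF u(2), of "\<lambda>v. v $ 3"]
        arg_cong[OF u(2), of "\<lambda>v. v $ 4"] by (simp_all add: base_proj_def)
    have "F5 u = F5 (vec5 1 (-1) 0 0 0)" by (simp add: F5_def n)
    also have "\<dots> = - 8" using good_base_curve(2)[of 0 0] by simp
    finally have z: "u $ 5 ^ 3 = - 8" using param_varietyD(3)[OF u(1)] by simp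
    have "u = c (u $ 5)" by (rule vec5_eqI) (simp_all add: c_def n z)
    moreover have "u $ 5 \<notin> A"
    proof
      assume "u $ 5 \<in> A"
      then obtain x where x: "poly p x = 0" "u $ 5 ^ 3 = - 8 / (1 + x)" using param_varietyD(4)[OF u(1)] by (auto simp: A_def)
      then have "1 + x \<noteq> 0" using z by auto
      then have "x = 0" using x(2) unfolding z by (simp add: field_simps)
      then show False using x(1) \<open>poly p 0 \<noteq> 0\<close> by simp
    qed
    ultimately show ?thesis by blast
  qed
  ultimately show ?thesis using that by blast
qed

text \<open>A generator of the deck transformations of \<open>base_proj\<close>.\<close>

definition rotate5 :: "complex^5 \<Rightarrow> complex^5" where
  "rotate5 u = vec5 (u $ 1) (u $ 2) (u $ 3) (u $ 4) (omega * u $ 5)"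

lemma rotate5_in: "u \<in> param_variety \<Longrightarrow> rotate5 u \<in> param_variety"
proof -
  assume u: "u \<in> param_variety"
  have "good5 (rotate5 u) = good5 u" "good5 (swap5 (rotate5 u)) = good5 (swap5 u)" "F5 (rotate5 u) = F5 u"
    by (simp_all add: good5_def F5_def rotate5_def swap5_def)
  then show ?thesis
    using param_varietyD[OF u] by (simp add: param_variety_def) (simp add: rotate5_def power_mult_distrib omega3)
qed

lemma base_proj_fibre:
  assumes "u \<in> param_variety" "v \<in> param_variety" "base_proj u = base_proj v"
  shows "v = u \<or> v = rotate5 u \<or> v = rotate5 (rotate5 u)"
proof -
  have n: "v $ 1 = u $ 1" "v $ 2 = u $ 2" "v $ 3 = u $ 3" "v $ 4 = u $ 4"
    using arg_cong[OF assms(3), of "\<lambda>v. v $ 1"] arg_cong[OF assms(3), of "\<lambda>v. v $ 2"] arg_cong[OF assms(3), of "\<lambda>v. v $ 3"]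
      arg_cong[OF assms(3), of "\<lambda>v. v $ 4"] by (simp_all add: base_proj_def)
  have "F5 v = F5 u" by (simp add: F5_def n)
  then have "(v $ 5 / u $ 5) ^ 3 = 1"
    using param_varietyD(3)[OF assms(1)] param_varietyD(3)[OF assms(2)] F5_nonzero[OF param_varietyD(1)[OF assms(1)]]
    by (simp add: power_divide)
  from cube_root_of_unity[OF this]
  have "v $ 5 = u $ 5 \<or> v $ 5 = omega * u $ 5 \<or> v $ 5 = omega * (omega * u $ 5)"
    using param_varietyD(4)[OF assms(1)] by (auto simp: field_simps power2_eq_square)
  then show ?thesis
  proof (elim disjE)
    assume "v $ 5 = u $ 5"
    then have "v = u" by (intro vec5_eqI) (simp_all add: n)
    then show ?thesis by simp
  next
    assume "v $ 5 = omega * u $ 5"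
    then have "v = rotate5 u" by (intro vec5_eqI) (simp_all add: n rotate5_def)
    then show ?thesis by simp
  next
    assume "v $ 5 = omega * (omega * u $ 5)"
    then have "v = rotate5 (rotate5 u)" by (intro vec5_eqI) (simp_all add: n rotate5_def)
    then show ?thesis by simp
  qed
qed

text \<open>The image of a clopen set under the threefold covering \<open>base_proj\<close> is clopen, its complement
  consisting of the points whose whole fibre lies in the complement. So a nontrivial clopen
  set and its complement would both meet every fibre, including one that lies in a connected curve.\<close>

lemma connected_param_variety: "connected param_variety"
proof -
  obtain h where h: "h \<in> poly_funs A5" "\<And>v. h v \<noteq> 0 \<longleftrightarrow> good5 v \<and> good5 (swap5 v)" by (rule good_base_poly) blast
  have "good_base = {v. v $ 5 = 0 \<and> h v \<noteq> 0}" by (simp add: good_base_def h(2))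
  then have conn: "connected good_base" using connected_principal_open[OF h(1)] by simp
  have cont: "continuous_on param_variety rotate5"
    unfolding rotate5_def[abs_def] by (intro continuous_on_vec5 continuous_intros)
  have opn: "openin (top_of_set good_base) (base_proj ` O')" if "openin (top_of_set param_variety) O'" for O'
    using open_map_base_proj that unfolding open_map_def by blast
  have rot: "openin (top_of_set param_variety) (param_variety \<inter> rotate5 -` O')" if "openin (top_of_set param_variety) O'" for O'
    using continuous_openin_preimage[OF cont _ that] rotate5_in by blast
  have onto: "base_proj ` O' = good_base"
    if O': "openin (top_of_set param_variety) O'" "openin (top_of_set param_variety) (param_variety - O')" "O' \<noteq> {}" for O'
  proof -
    let ?N = "param_variety - O'"
    \<comment> \<open>the points whose whole fibre avoids \<open>O'\<close>\<close>
    define M where "M = ?N \<inter> (param_variety \<inter> rotate5 -` ?N) \<inter> (param_variety \<inter> rotate5 -` (param_variety \<inter> rotate5 -` ?N))"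
    have M: "openin (top_of_set param_variety) M" unfolding M_def by (intro openin_Int rot O'(2))
    have sub: "O' \<subseteq> param_variety" using O'(1) openin_imp_subset by blast
    have eq: "good_base - base_proj ` O' = base_proj ` M"
    proof
      show "good_base - base_proj ` O' \<subseteq> base_proj ` M"
      proof
        fix b assume b: "b \<in> good_base - base_proj ` O'"
        define u where "u = vec5 (b $ 1) (b $ 2) (b $ 3) (b $ 4) (branch_root 3 (F5 b))"
        have "F5 b \<noteq> 0" using b F5_nonzero[of b] by (auto simp: good_base_def)
        then have u: "u \<in> param_variety" "base_proj u = b"
          using param_varietyI[of b "branch_root 3 (F5 b)"] b by (simp_all add: u_def branch_root_power)
        have pr: "base_proj (rotate5 v) = base_proj v" for v by (simp add: base_proj_def rotate5_def)
        have "v \<notin> O'" if "base_proj v = b" for v using b that by blast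
        then have "u \<in> M" unfolding M_def using u rotate5_in pr by auto
        then show "b \<in> base_proj ` M" using u(2) by blast
      qed
      show "base_proj ` M \<subseteq> good_base - base_proj ` O'"
      proof
        fix b assume "b \<in> base_proj ` M"
        then obtain u where u: "b = base_proj u" "u \<in> M" by (rule imageE)
        have "b \<notin> base_proj ` O'"
        proof
          assume "b \<in> base_proj ` O'"
          then obtain v where v: "b = base_proj v" "v \<in> O'" by (rule imageE)
          have uM: "u \<in> param_variety" "u \<notin> O'" "rotate5 u \<notin> O'" "rotate5 (rotate5 u) \<notin> O'"
            using u(2) by (simp_all add: M_def)
          have "v \<in> param_variety" using v(2) sub by (rule rev_subsetD)
          have "base_proj u = base_proj v" using u(1) v(1) by simp
          from base_proj_fibre[OF uM(1) \<open>v \<in> param_variety\<close> this] show False using uM v(2) by (elim disjE) simp_all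
        qed
        moreover have "u \<in> param_variety" using u(2) by (simp add: M_def)
        ultimately show "b \<in> good_base - base_proj ` O'" using base_proj_in[of u] unfolding u(1) by simp
      qed
    qed
    have "base_proj ` O' \<subseteq> good_base" using sub base_proj_in by blast
    moreover have "openin (top_of_set good_base) (good_base - base_proj ` O')" unfolding eq by (rule opn[OF M])
    ultimately have "closedin (top_of_set good_base) (base_proj ` O')" by (simp add: closedin_def)
    then show ?thesis using conn opn[OF O'(1)] O'(3) unfolding connected_clopen by blast
  qed
  obtain G where G: "connected G" "G \<subseteq> param_variety"
    "\<And>u. u \<in> param_variety \<Longrightarrow> base_proj u = vec5 1 (-1) 0 0 0 \<Longrightarrow> u \<in> G" by (rule connected_fibre_curve) blast
  show ?thesis unfolding connected_clopen
  proof (intro allI impI, rule ccontr)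
    fix O' assume O': "openin (top_of_set param_variety) O' \<and> closedin (top_of_set param_variety) O'" "\<not> (O' = {} \<or> O' = param_variety)"
    let ?N = "param_variety - O'"
    have sub: "O' \<subseteq> param_variety" using O'(1) openin_imp_subset by blast
    have N: "openin (top_of_set param_variety) ?N" "?N \<noteq> {}" using O' sub by (auto simp: closedin_def)
    have "param_variety - ?N = O'" using sub by blast
    then have "base_proj ` O' = good_base" "base_proj ` ?N = good_base"
      using onto[of O'] onto[of ?N] N O' by simp_all
    then have "vec5 1 (-1) 0 0 0 \<in> base_proj ` O'" "vec5 1 (-1) 0 0 0 \<in> base_proj ` ?N"
      using good_base_curve(1) by blast+
    then obtain u v where uv: "u \<in> O'" "base_proj u = vec5 1 (-1) 0 0 0" "v \<in> ?N" "base_proj v = vec5 1 (-1) 0 0 0"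
      by (metis imageE)
    have "u \<in> G" "v \<in> G" using G(3) uv sub by blast+
    moreover have "openin (top_of_set G) (G \<inter> O')" "closedin (top_of_set G) (G \<inter> O')"
      using O'(1) G(2) by (auto simp: openin_open closedin_closed)
    ultimately have "G \<inter> O' = {} \<or> G \<inter> O' = G" using G(1) unfolding connected_clopen by blast
    then show False using uv \<open>u \<in> G\<close> \<open>v \<in> G\<close> by blast
  qed
qed

section \<open>The regular cover\<close>

lemma TC_cases: "g \<in> TC \<Longrightarrow> \<exists>v. g = word_trace v"
  unfolding trace_coords_def carrier_whitehead by blast

lemma frac_quot5: "frac A5 Z (\<lambda>u. quot5 u $ i)"
  using exhaust_5[of i] by (elim disjE; simp add: quot5_def; intro frac_intros frac_nth)

lemma frac_gamma5_funpow: "frac A5 Z (\<lambda>u. (gamma5 ^^ n) u $ i)"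
  unfolding gamma5_funpow
  using exhaust_5[of i] by (elim disjE; cases "even n"; simp; intro frac_intros frac_nth)

lemma continuous_gamma5: "continuous_map (classical_topology A5 param_variety) (classical_topology A5 param_variety) gamma5"
proof (rule continuous_map_classical[OF _ gamma5_in A5_nonempty A5_nonempty])
  fix g assume "g \<in> A5"
  then obtain i where "g = (\<lambda>u. u $ i)" using A5_cases by blast
  then show "frac A5 param_variety (\<lambda>u. g (gamma5 u))" using frac_gamma5_funpow[of param_variety 1 i] by simp
qed

lemma good_charactersD: "C \<in> good_characters \<Longrightarrow> char_param C \<in> param_variety" "C \<in> good_characters \<Longrightarrow> param_class (char_param C) = C"
  using param_of_generic by (auto simp: good_characters_def)

lemma param_class_in: "u \<in> param_variety \<Longrightarrow> param_class u \<in> good_characters"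
  using param_class_coords param_varietyD by (simp add: good_characters_def)

lemma frac_comp_char_param:
  assumes "frac A5 param_variety h" shows "frac TC good_characters (\<lambda>C. h (char_param C))"
proof (rule frac_comp[OF assms _ good_charactersD(1)])
  fix g assume "g \<in> A5"
  then obtain i where g: "g = (\<lambda>u. u $ i)" using A5_cases by blast
  show "frac TC good_characters (\<lambda>C. g (char_param C))"
    unfolding g by (rule frac_char_param) (simp add: good_characters_def)
qed

lemma homeomorphic_maps_char_param:
  "homeomorphic_maps (classical_topology TC good_characters) (classical_topology A5 param_variety) char_param param_class"
  unfolding homeomorphic_maps_def topspace_classical_topology[OF TC_nonempty] topspace_classical_topology[OF A5_nonempty]
proof (intro conjI ballI)
  show "continuous_map (classical_topology TC good_characters) (classical_topology A5 param_variety) char_param"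
  proof (rule continuous_map_classical[OF _ good_charactersD(1) TC_nonempty A5_nonempty])
    fix g assume "g \<in> A5"
    then show "frac TC good_characters (\<lambda>C. g (char_param C))" by (intro frac_comp_char_param frac_coord)
  qed
  show "continuous_map (classical_topology A5 param_variety) (classical_topology TC good_characters) param_class"
  proof (rule continuous_map_classical[OF _ param_class_in A5_nonempty TC_nonempty])
    fix g assume "g \<in> TC"
    then obtain v where "g = word_trace v" using TC_cases by blast
    then show "frac A5 param_variety (\<lambda>u. g (param_class u))" using frac_word_trace_param by simp
  qed
qed (auto simp: good_charactersD param_class_coords)

text \<open>Writing the polynomial that cuts out the good parameters as \<open>a + r b\<close> with symmetric \<open>a\<close> and \<open>b\<close>, the quotient
  is cut out by its norm \<open>(a + r b) (a + t b)\<close>, a polynomial in \<open>r + t\<close> and \<open>r t\<close>.\<close>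

lemma quot_base_principal: "\<exists>g\<in>poly_funs A5. quot_base = {v \<in> {v. v $ 5 = 0}. g v \<noteq> 0}"
proof -
  obtain f where f: "f \<in> poly_funs A5" "\<And>u. good5 u \<longleftrightarrow> f u \<noteq> 0"
    using principal_open_good unfolding principal_open_def by blast
  obtain a b where ab: "a \<in> poly_funs A5" "b \<in> poly_funs A5"
    "\<And>u. f (vec5 (u $ 1) (u $ 2) (u $ 3) (u $ 4) 0) = a (quot5 u) + u $ 1 * b (quot5 u)"
    using poly_symmetric_split[OF f(1)] by blast
  have c: "(\<lambda>u. u $ j) \<in> poly_funs A5" for j by (rule poly_funs.coord[OF A5_coord])
  define g where "g v = a v * a v + v $ 1 * (a v * b v) + v $ 2 * (b v * b v)" for v
  have "g \<in> poly_funs A5" unfolding g_def[abs_def] by (intro poly_funs.add poly_funs.mult ab(1,2) c)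
  moreover have gq: "g (quot5 u) \<noteq> 0 \<longleftrightarrow> quot5 u \<in> quot_base" for u
  proof -
    have sq: "quot5 (swap5 u) = quot5 u" by (simp add: quot5_def swap5_def add.commute mult.commute)
    have "f (vec5 (u $ 2) (u $ 1) (u $ 3) (u $ 4) 0) = a (quot5 u) + u $ 2 * b (quot5 u)"
      using ab(3)[of "swap5 u"] unfolding sq by (simp add: swap5_def)
    moreover have "quot5 u $ 1 = u $ 1 + u $ 2" "quot5 u $ 2 = u $ 1 * u $ 2" by (simp_all add: quot5_def)
    then have "g (quot5 u) = (a (quot5 u) + u $ 1 * b (quot5 u)) * (a (quot5 u) + u $ 2 * b (quot5 u))"
      unfolding g_def by (simp add: algebra_simps)
    ultimately have "g (quot5 u) = f (vec5 (u $ 1) (u $ 2) (u $ 3) (u $ 4) 0) * f (vec5 (u $ 2) (u $ 1) (u $ 3) (u $ 4) 0)"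
      using ab(3)[of u] by simp
    moreover have "good5 u = good5 (vec5 (u $ 1) (u $ 2) (u $ 3) (u $ 4) 0)" "good5 (swap5 u) = good5 (vec5 (u $ 2) (u $ 1) (u $ 3) (u $ 4) 0)"
      by (simp_all add: good5_def swap5_def)
    ultimately show ?thesis unfolding quot_base_iff f(2) by simp
  qed
  moreover have "\<exists>u. v = quot5 u" if "v $ 5 = 0" for v
  proof
    \<comment> \<open>the roots of \<open>x\<^sup>2 - v\<^sub>1 x + v\<^sub>2\<close>\<close>
    let ?d = "csqrt (v $ 1 ^ 2 - 4 * v $ 2)"
    have "(v $ 1 + ?d) / 2 * ((v $ 1 - ?d) / 2) = ((v $ 1)\<^sup>2 - ?d\<^sup>2) / 4"
      by (simp only: power2_eq_square) (simp add: algebra_simps)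
    also have "\<dots> = v $ 2" unfolding power2_csqrt by simp
    finally show "v = quot5 (vec5 ((v $ 1 + ?d) / 2) ((v $ 1 - ?d) / 2) (v $ 3) (v $ 4) 0)"
      using that by (intro vec5_eqI) (simp_all add: quot5_def field_simps)
  qed
  ultimately have "quot_base = {v \<in> {v. v $ 5 = 0}. g v \<noteq> 0}" using quot_base_fifth by blast
  then show ?thesis using \<open>g \<in> poly_funs A5\<close> by blast
qed

lemma hypersurface_fifth: "hypersurface {v :: complex^5. v $ 5 = 0}"
  unfolding hypersurface_def
proof (intro bexI conjI)
  show "\<not> (\<lambda>v :: complex^5. v $ 5) constant_on UNIV"
  proof
    assume "(\<lambda>v :: complex^5. v $ 5) constant_on UNIV"
    then obtain c where "\<And>v :: complex^5. v $ 5 = c" by (auto simp: constant_on_def)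
    from this[of "vec5 0 0 0 0 0"] this[of "vec5 0 0 0 0 1"] show False by simp
  qed
qed (auto intro: poly_funs.coord[OF A5_coord])

lemma param_variety_nonempty: "param_variety \<noteq> {}"
  using quot5_onto good_base_curve(1) by (auto simp: quot_base_def good_base_def)

definition char_gamma :: "character \<Rightarrow> character" where
  "char_gamma C = param_class (gamma5 (char_param C))"

lemma char_gamma_funpow:
  "C \<in> good_characters \<Longrightarrow> (char_gamma ^^ i) C = param_class ((gamma5 ^^ i) (char_param C))"
  by (induction i) (simp_all add: good_charactersD char_gamma_def param_class_coords gamma5_funpow_in)

definition char_quot :: "character \<Rightarrow> complex^5" where
  "char_quot C = quot5 (char_param C)"

lemma char_quot_morphism: "variety_morphism TC good_characters A5 quot_base char_quot"
proof (rule variety_morphismI)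
  fix g assume "g \<in> A5"
  then obtain i where "g = (\<lambda>u. u $ i)" using A5_cases by blast
  then show "frac TC good_characters (\<lambda>C. g (char_quot C))"
    unfolding char_quot_def using frac_comp_char_param[OF frac_quot5] by simp
next
  show "C \<in> good_characters \<Longrightarrow> char_quot C \<in> quot_base" for C
    using good_charactersD(1) quot5_onto by (auto simp: char_quot_def)
qed

lemma char_gamma_morphism: "variety_morphism TC good_characters TC good_characters (char_gamma ^^ n)"
proof (rule variety_morphismI)
  fix g assume "g \<in> TC"
  then obtain v where g: "g = word_trace v" using TC_cases by blast
  have "frac A5 param_variety (\<lambda>u. word_trace v (param_class ((gamma5 ^^ n) u)))"
  proof (rule frac_comp[OF frac_word_trace_param _ gamma5_funpow_in])
    fix g assume "g \<in> A5"
    then obtain i where "g = (\<lambda>u. u $ i)" using A5_cases by blast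
    then show "frac A5 param_variety (\<lambda>u. g ((gamma5 ^^ n) u))" using frac_gamma5_funpow by simp
  qed
  from frac_comp_char_param[OF this] show "frac TC good_characters (\<lambda>C. g ((char_gamma ^^ n) C))"
    by (subst frac_cong[where k = "\<lambda>C. word_trace v (param_class ((gamma5 ^^ n) (char_param C)))"])
      (simp_all add: char_gamma_funpow g)
next
  show "C \<in> good_characters \<Longrightarrow> (char_gamma ^^ n) C \<in> good_characters" for C
    by (simp add: char_gamma_funpow good_charactersD param_class_in gamma5_funpow_in)
qed

lemma variety_morphism_cong:
  assumes "variety_morphism F X G Y p" "\<And>x. x \<in> X \<Longrightarrow> q x = p x"
  shows "variety_morphism F X G Y q"
  using assms unfolding variety_morphism_def regular_fun_def by simp

lemma regular_cover_good_characters: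
  "is_regular_cover (integer_mod_group 6) TC good_characters A5 quot_base char_quot"
proof -
  let ?T = "classical_topology TC good_characters" and ?P = "classical_topology A5 param_variety"
    and ?S = "classical_topology A5 quot_base"
  have ts: "topspace ?T = good_characters" "topspace ?P = param_variety" "topspace ?S = quot_base"
    by (rule topspace_classical_topology TC_nonempty A5_nonempty)+
  note hm = homeomorphic_maps_char_param
  have hs: "?T homeomorphic_space ?P" using hm unfolding homeomorphic_space_def by blast
  have P: "?P = top_of_set param_variety" "?S = top_of_set quot_base" by (rule classical_topology_affine)+
  have conn: "connected_space ?T"
    using homeomorphic_connected_space[OF hs] connected_param_variety unfolding P by (simp add: connected_space_subtopology)
  have ne: "topspace ?T \<noteq> {}" using param_variety_nonempty param_class_in unfolding ts by blast
  have gp: "char_gamma = param_class \<circ> (gamma5 \<circ> char_param)" by (simp add: fun_eq_iff char_gamma_def)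
  have qp: "char_quot = quot5 \<circ> char_param" by (simp add: fun_eq_iff char_quot_def)
  have cont: "continuous_map ?T ?P char_param" "continuous_map ?P ?T param_class"
    using hm by (simp_all add: homeomorphic_maps_def)
  have inj: "C = C'" if "C \<in> good_characters" "C' \<in> good_characters" "char_param C = char_param C'" for C C'
    using that good_charactersD(2) by metis
  interpret free_cyclic_quotient ?T ?S char_gamma char_quot 6
  proof
    show "Hausdorff_space ?T" using homeomorphic_Hausdorff_space[OF hs] unfolding P by (simp add: Hausdorff_space_subtopology)
    show "continuous_map ?T ?T char_gamma" unfolding gp
      by (rule continuous_map_compose[OF continuous_map_compose[OF cont(1) continuous_gamma5] cont(2)])
    show "continuous_map ?T ?S char_quot"
    proof (rule continuous_map_classical[OF _ _ TC_nonempty A5_nonempty])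
      fix g assume "g \<in> A5"
      then obtain i where "g = (\<lambda>u. u $ i)" using A5_cases by blast
      then show "frac TC good_characters (\<lambda>C. g (char_quot C))"
        unfolding char_quot_def using frac_comp_char_param[OF frac_quot5] by simp
    qed (use char_quot_morphism in \<open>auto simp: variety_morphism_def\<close>)
    have "homeomorphic_map ?T ?P char_param" using hm homeomorphic_map_maps by blast
    then have "open_map ?T ?P char_param" by (rule homeomorphic_imp_open_map)
    then show "open_map ?T ?S char_quot" unfolding qp
      by (rule open_map_compose) (use open_map_quot5 in \<open>simp add: P\<close>)
    have "char_param ` good_characters = param_variety"
      using good_charactersD(1) param_class_in param_class_coords(2) by (metis image_subset_iff subset_antisym image_eqI subsetI)
    then show "char_quot ` topspace ?T = topspace ?S"
      unfolding ts qp image_comp[symmetric] using quot5_onto by simp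
    fix C assume C: "C \<in> topspace ?T"
    note C' = C[unfolded ts] good_charactersD[OF C[unfolded ts]]
    show "(char_gamma ^^ 6) C = C"
      unfolding char_gamma_funpow[OF C'(1)] gamma5_period by (rule C'(3))
    show "(char_gamma ^^ i) C \<noteq> C" if "0 < i" "i < 6" for i
    proof
      assume "(char_gamma ^^ i) C = C"
      then have "char_param (param_class ((gamma5 ^^ i) (char_param C))) = char_param C"
        unfolding char_gamma_funpow[OF C'(1)] by simp
      then show False
        using gamma5_free[OF C'(2) that] param_class_coords(2)[OF gamma5_funpow_in[OF C'(2)]] by simp
    qed
    fix C2 assume C2: "C2 \<in> topspace ?T"
    note C2' = C2[unfolded ts] good_charactersD[OF C2[unfolded ts]]
    have "char_param C2 = (gamma5 ^^ i) (char_param C) \<longleftrightarrow> C2 = (char_gamma ^^ i) C" for i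
    proof
      assume "char_param C2 = (gamma5 ^^ i) (char_param C)"
      from arg_cong[OF this, of param_class] show "C2 = (char_gamma ^^ i) C"
        unfolding C2'(3) char_gamma_funpow[OF C'(1)] .
    next
      assume "C2 = (char_gamma ^^ i) C"
      from arg_cong[OF this, of char_param] show "char_param C2 = (gamma5 ^^ i) (char_param C)"
        unfolding char_gamma_funpow[OF C'(1)] param_class_coords(2)[OF gamma5_funpow_in[OF C'(2)]] .
    qed
    then show "char_quot C = char_quot C2 \<longleftrightarrow> (\<exists>i<6. C2 = (char_gamma ^^ i) C)"
      unfolding char_quot_def quot5_fibre[OF C'(2) C2'(2)] by simp
  qed simp
  have "variety_morphism TC good_characters TC good_characters \<sigma>" if in_deck: "\<sigma> \<in> carrier (deck_group ?T char_quot)" for \<sigma>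
  proof -
    obtain i where "\<sigma> = deck i" using deck_eq_funpow[OF conn ne in_deck] by blast
    then show ?thesis using ts(1) by (intro variety_morphism_cong[OF char_gamma_morphism[of i]]) (simp add: deck_def)
  qed
  moreover have "\<exists>\<sigma>\<in>carrier (deck_group ?T char_quot). \<sigma> C = C2"
    if "C \<in> good_characters" "C2 \<in> good_characters" "char_quot C = char_quot C2" for C C2
    using that by (intro deck_transitive) (simp_all add: ts)
  ultimately show ?thesis
    unfolding is_regular_cover_def Let_def
    by (intro conjI ballI impI char_quot_morphism conn covering deck_group_iso[OF conn ne])
qed

theorem theorem1p1:
  shows "\<exists>(H :: (complex^5) set) V U.
    hypersurface H \<and>
    V \<noteq> {} \<and> zariski_open affine_coords H V \<and>
    U \<noteq> {} \<and> zariski_open (trace_coords whitehead_group) sym_slice U \<and>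
    (\<exists>p. is_regular_cover (integer_mod_group 6) (trace_coords whitehead_group) U affine_coords V p)"
proof (intro exI conjI)
  show "hypersurface {v :: complex^5. v $ 5 = 0}" by (rule hypersurface_fifth)
  show "quot_base \<noteq> {}" using param_variety_nonempty quot5_onto by blast
  have "principal_open A5 {v. v $ 5 = 0} quot_base"
    using quot_base_principal unfolding principal_open_def .
  then show "zariski_open A5 {v. v $ 5 = 0} quot_base" by (rule principal_open_zariski)
  show "good_characters \<noteq> {}" using param_variety_nonempty param_class_in by blast
  show "zariski_open TC sym_slice good_characters"
    by (rule principal_open_zariski[OF principal_open_good_characters])
  show "is_regular_cover (integer_mod_group 6) TC good_characters A5 quot_base char_quot"
    by (rule regular_cover_good_characters)
qed

end
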